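(* Let $p$ be a prime different from $\operatorname{char}(\Bbbk)$. Given an idele $\mathbf{t}\in\mathbb{I}_X$, a pointwise transitive subgroup $G$ of $\mathbb{G}(\mathbf{t})$, a nontrivial character $\chi:G\to\mu_p$, a generator $g$ of $G$, a primitive $p$th root of unity $\zeta\in\mu_p$, and a $(G,\chi)$-primitive element $\alpha$ of $\mathbb{A}_X\{\mathbf{t}^{1/p}\}$ (so that $\alpha^p\in\mathbb{I}_X$), for each closed point $x\in X$ one has: $\upsilon_x(\alpha^p)\equiv0\bmod p$ if and only if $x\notin\operatorname{Ram}(\mathbf{t})$, and $$\upsilon_x(\alpha^p)\equiv\frac{\log_\zeta\chi(g)}{\log_\zeta\langle g_x,z_x\rangle_x}\bmod p\qquad\text{if }x\in\operatorname{Ram}(\mathbf{t}),$$ independently of the choice of $g$ and $\zeta$. Here $(g_x)_x$ is the family of component automorphisms of $g$, and $\upsilon_x(\alpha^p)$ denotes the valuation of the $x$-component of the idele $\alpha^p$.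
   Context: $\Bbbk$ is an algebraically closed field and $X$ is a projective, irreducible, non-singular curve over $\Bbbk$. "$x\in X$" means a closed point. $A_x$ is the completion of the local ring at $x$, $K_x$ its fraction field, $\upsilon_x$ the valuation on $K_x$, $z_x$ a uniformizer. $\mathbb{A}_X=\{(\alpha_x)_x\in\prod_{x}K_x : \alpha_x\in A_x \text{ for all but finitely many } x\}$, $\mathbb{I}_X=\mathbb{A}_X^*$; $\Bbbk$ embeds diagonally in $\mathbb{A}_X$. $\mu_p\subseteq\Bbbk^*$ is the group of $p$th roots of unity. For $\mathbf{t}=(t_x)\in\mathbb{I}_X$, put $\mathbb{A}_X\{\mathbf{t}^{1/p}\}=\mathbb{A}_X[T]/(T^p-\mathbf{t})$, $K_x\{t_x^{1/p}\}=K_x[T]/(T^p-t_x)$, $\operatorname{Ram}(\mathbf{t})=\{x:\upsilon_x(t_x)\not\equiv0\bmod p\}$, $\mathbb{G}(\mathbf{t})=\operatorname{Aut}_{\mathbb{A}_X\text{-alg}}\mathbb{A}_X\{\mathbf{t}^{1/p}\}$. Every $g\in\mathbb{G}(\mathbf{t})$ acts componentwise through $K_x$-algebra automorphisms $g_x$ of $K_x\{t_x^{1/p}\}$. A cyclic subgroup $G$ of order $p$ of $\mathbb{G}(\mathbf{t})$ is pointwise transitive if $\mathbb{A}_X\{\mathbf{t}^{1/p}\}^G=\mathbb{A}_X$ (equivalently, $\mathbb{A}_X\{\mathbf{t}^{1/p}\}$ is a $G$-Galois ring extension of $\mathbb{A}_X$; equivalently, $G$ has an element all of whose components $g_x$ have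 order $p$, these elements being then exactly the generators of $G$). $\alpha\in\mathbb{A}_X\{\mathbf{t}^{1/p}\}$ is $(G,\chi)$-primitive if $g(\alpha)=\chi(g)\alpha$ for all $g\in G$ and $1,\alpha,\dots,\alpha^{p-1}$ is an $\mathbb{A}_X$-module basis of $\mathbb{A}_X\{\mathbf{t}^{1/p}\}$. Kummer pairing: for $x\in\operatorname{Ram}(\mathbf{t})$, $E_x=K_x\{t_x^{1/p}\}$ is a cyclic field extension of $K_x$ of degree $p$ containing a $p$th root of every element of $K_x^*$; for $h\in\operatorname{Gal}(E_x/K_x)$ and $\lambda\in K_x^*$, $\langle h,\lambda\rangle_x=h(\lambda^{1/p})/\lambda^{1/p}\in\mu_p$, where $\lambda^{1/p}\in E_x$ is any $p$th root. $\log_\zeta:\mu_p\to\mathbb{Z}/(p)$ is the inverse of $c\mapsto\zeta^c$. *)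

theory Defs
  imports
    "HOL-Algebra.Algebra"
    "HOL-Algebra.Algebraic_Closure_Type"
    "HOL-Library.Poly_Mapping"
    "HOL-Library.Extended_Nat"
    "HOL-Number_Theory.Residues"
begin

section \<open>Algebraic constructions\<close>

subsection \<open>Fraction fields\<close>

text \<open>For an integral domain, \<open>fraction R a b\<close> is the class of \<open>a / b\<close>.\<close>

definition fraction :: "('a, 'm) ring_scheme \<Rightarrow> 'a \<Rightarrow> 'a \<Rightarrow> ('a \<times> 'a) set" where
  "fraction R a b =
     {(c, d). c \<in> carrier R \<and> d \<in> carrier R - {\<zero>\<^bsub>R\<^esub>} \<and> a \<otimes>\<^bsub>R\<^esub> d = c \<otimes>\<^bsub>R\<^esub> b}"

definition fraction_field :: "('a, 'm) ring_scheme \<Rightarrow> ('a \<times> 'a) set ring" where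
  "fraction_field R =
     \<lparr>carrier = {fraction R a b | a b. a \<in> carrier R \<and> b \<in> carrier R - {\<zero>\<^bsub>R\<^esub>}},
      monoid.mult = (\<lambda>P Q. \<Union>(a, b)\<in>P. \<Union>(c, d)\<in>Q. fraction R (a \<otimes>\<^bsub>R\<^esub> c) (b \<otimes>\<^bsub>R\<^esub> d)),
      one = fraction R \<one>\<^bsub>R\<^esub> \<one>\<^bsub>R\<^esub>,
      ring.zero = fraction R \<zero>\<^bsub>R\<^esub> \<one>\<^bsub>R\<^esub>,
      add = (\<lambda>P Q. \<Union>(a, b)\<in>P. \<Union>(c, d)\<in>Q.
               fraction R (a \<otimes>\<^bsub>R\<^esub> d \<oplus>\<^bsub>R\<^esub> c \<otimes>\<^bsub>R\<^esub> b) (b \<otimes>\<^bsub>R\<^esub> d))\<rparr>"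

subsection \<open>Local rings, completion, valuation\<close>

text \<open>In a local ring the set of nonunits is the maximal ideal.\<close>

definition nonunits :: "('a, 'm) ring_scheme \<Rightarrow> 'a set" where
  "nonunits R = carrier R - Units R"

primrec ideal_power :: "('a, 'm) ring_scheme \<Rightarrow> 'a set \<Rightarrow> nat \<Rightarrow> 'a set" where
  "ideal_power R I 0 = carrier R"
| "ideal_power R I (Suc n) = ideal_prod R I (ideal_power R I n)"

text \<open>
  The inverse limit of the rings \<open>R / I\<^sup>n\<close>. Cosets of \<open>I\<^sup>n\<^sup>+\<^sup>1\<close> are contained in cosets of
  \<open>I\<^sup>n\<close>, and \<open>s (n + 1) \<mapsto> s n\<close> under the transition map means \<open>s (n + 1) \<subseteq> s n\<close>.
\<close>

definition adic_completion :: "('a, 'm) ring_scheme \<Rightarrow> 'a set \<Rightarrow> (nat \<Rightarrow> 'a set) ring" where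
  "adic_completion R I =
     \<lparr>carrier = {s. (\<forall>n. s n \<in> carrier (R Quot ideal_power R I n)) \<and> (\<forall>n. s (Suc n) \<subseteq> s n)},
      monoid.mult = (\<lambda>s t n. s n \<otimes>\<^bsub>R Quot ideal_power R I n\<^esub> t n),
      one = (\<lambda>n. \<one>\<^bsub>R Quot ideal_power R I n\<^esub>),
      ring.zero = (\<lambda>n. \<zero>\<^bsub>R Quot ideal_power R I n\<^esub>),
      add = (\<lambda>s t n. s n \<oplus>\<^bsub>R Quot ideal_power R I n\<^esub> t n)\<rparr>"

text \<open>For a discrete valuation ring \<open>R\<close>: the valuation of nonzero elements of \<open>R\<close>, and of
  nonzero elements of its fraction field. Nothing is intended about the value at zero.\<close>

definition dvr_ord :: "('a, 'm) ring_scheme \<Rightarrow> 'a \<Rightarrow> nat" where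
  "dvr_ord R a = (GREATEST n. a \<in> ideal_power R (nonunits R) n)"

definition dvr_val :: "('a, 'm) ring_scheme \<Rightarrow> ('a \<times> 'a) set \<Rightarrow> int" where
  "dvr_val R q =
     (THE v. \<exists>a\<in>carrier R - {\<zero>\<^bsub>R\<^esub>}. \<exists>b\<in>carrier R - {\<zero>\<^bsub>R\<^esub>}.
        q = fraction R a b \<and> v = int (dvr_ord R a) - int (dvr_ord R b))"

subsection \<open>The algebra \<open>R{a\<^sup>1\<^sup>/\<^sup>p} = R[T]/(T\<^sup>p - a)\<close>\<close>

definition root_ideal :: "('a, 'm) ring_scheme \<Rightarrow> nat \<Rightarrow> 'a \<Rightarrow> (nat \<Rightarrow> 'a) set" where
  "root_ideal R p a =
     PIdl\<^bsub>UP R\<^esub> (up_ring.monom (UP R) \<one>\<^bsub>R\<^esub> p \<ominus>\<^bsub>UP R\<^esub> up_ring.monom (UP R) a 0)"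

definition root_ext :: "('a, 'm) ring_scheme \<Rightarrow> nat \<Rightarrow> 'a \<Rightarrow> (nat \<Rightarrow> 'a) set ring" where
  "root_ext R p a = UP R Quot root_ideal R p a"

definition root_ext_emb :: "('a, 'm) ring_scheme \<Rightarrow> nat \<Rightarrow> 'a \<Rightarrow> 'a \<Rightarrow> (nat \<Rightarrow> 'a) set" where
  "root_ext_emb R p a c = root_ideal R p a +>\<^bsub>UP R\<^esub> up_ring.monom (UP R) c 0"

definition root_ext_aut ::
  "('a, 'm) ring_scheme \<Rightarrow> nat \<Rightarrow> 'a \<Rightarrow> ((nat \<Rightarrow> 'a) set \<Rightarrow> (nat \<Rightarrow> 'a) set) monoid" where
  "root_ext_aut R p a =
     (let E = root_ext R p a in
      BijGroup (carrier E)
        \<lparr>carrier := {h \<in> ring_hom E E \<inter> Bij (carrier E).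
           \<forall>c\<in>carrier R. h (root_ext_emb R p a c) = root_ext_emb R p a c}\<rparr>)"

subsection \<open>Roots of unity\<close>

definition mu_group :: "nat \<Rightarrow> 'k::field monoid" where
  "mu_group p = \<lparr>carrier = {c. c ^ p = 1}, monoid.mult = (*), one = 1\<rparr>"

definition primitive_root_of_unity :: "nat \<Rightarrow> 'k::field \<Rightarrow> bool" where
  "primitive_root_of_unity p \<zeta> \<longleftrightarrow> \<zeta> ^ p = 1 \<and> (\<forall>j. 0 < j \<and> j < p \<longrightarrow> \<zeta> ^ j \<noteq> 1)"

text \<open>The inverse of \<open>j \<mapsto> \<zeta>\<^sup>j\<close>, from the \<open>p\<close>-th roots of unity to \<open>\<int>/p\<close> (when \<open>\<zeta>\<close> is primitive).\<close>

definition log_mu :: "nat \<Rightarrow> 'k::field \<Rightarrow> 'k \<Rightarrow> int" where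
  "log_mu p \<zeta> = inv_into (carrier (residue_ring (int p))) (\<lambda>j. \<zeta> powi j)"

section \<open>Projective curves\<close>

text \<open>
  The index type \<open>'n\<close> is the set of homogeneous coordinates, so the ambient projective space
  has dimension \<open>CARD('n) - 1\<close>. Its points are the lines through the origin of \<open>'k ^ 'n\<close>
  with the origin removed. Over the algebraically closed field \<open>'k\<close> these are the closed
  points.
\<close>

type_synonym ('n, 'k) mpoly = "('n \<Rightarrow>\<^sub>0 nat) \<Rightarrow>\<^sub>0 'k"
type_synonym ('n, 'k) ppoint = "('n \<Rightarrow> 'k) set"
type_synonym ('n, 'k) homog_coord = "('n, 'k) mpoly set"
type_synonym ('n, 'k) local_elt = "(('n, 'k) homog_coord \<times> ('n, 'k) homog_coord) set"
type_synonym ('n, 'k) complete_elt = "nat \<Rightarrow> ('n, 'k) local_elt set"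
type_synonym ('n, 'k) place_elt = "(('n, 'k) complete_elt \<times> ('n, 'k) complete_elt) set"
type_synonym ('n, 'k) adele = "('n, 'k) ppoint \<Rightarrow> ('n, 'k) place_elt"

definition mpoly_eval :: "('n::finite \<Rightarrow> 'k::field) \<Rightarrow> ('n, 'k) mpoly \<Rightarrow> 'k" where
  "mpoly_eval v f = (\<Sum>m\<in>Poly_Mapping.keys f. Poly_Mapping.lookup f m *
                       (\<Prod>i\<in>UNIV. v i ^ Poly_Mapping.lookup m i))"

definition homogeneous :: "nat \<Rightarrow> ('n::finite, 'k::field) mpoly \<Rightarrow> bool" where
  "homogeneous d f \<longleftrightarrow> (\<forall>m\<in>Poly_Mapping.keys f. (\<Sum>i\<in>UNIV. Poly_Mapping.lookup m i) = d)"

definition proj_space :: "('n, 'k::field) ppoint set" where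
  "proj_space = {{(\<lambda>i. c * v i) | c. c \<noteq> 0} | v. v \<noteq> (\<lambda>i. 0)}"

definition zariski_closed :: "('n::finite, 'k::field) ppoint set \<Rightarrow> bool" where
  "zariski_closed Z \<longleftrightarrow>
     (\<exists>T. (\<forall>f\<in>T. \<exists>d. homogeneous d f) \<and>
          Z = {x \<in> proj_space. \<forall>f\<in>T. \<forall>v\<in>x. mpoly_eval v f = 0})"

definition irreducible_closed :: "('n::finite, 'k::field) ppoint set \<Rightarrow> bool" where
  "irreducible_closed Z \<longleftrightarrow> zariski_closed Z \<and> Z \<noteq> {} \<and>
     (\<forall>Z1 Z2. zariski_closed Z1 \<and> zariski_closed Z2 \<and> Z \<subseteq> Z1 \<union> Z2 \<longrightarrow> Z \<subseteq> Z1 \<or> Z \<subseteq> Z2)"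

definition zariski_dim :: "('n::finite, 'k::field) ppoint set \<Rightarrow> enat" where
  "zariski_dim C =
     Sup_class.Sup (enat ` {n. \<exists>Z. (\<forall>i\<le>n. irreducible_closed (Z i) \<and> Z i \<subseteq> C) \<and>
                                    (\<forall>i<n. Z i \<subset> Z (Suc i))})"

text \<open>
  All polynomials vanishing on the affine cone over \<open>C\<close>. As \<open>'k\<close> is infinite (and \<open>C\<close> is not
  empty), this is the homogeneous ideal generated by the homogeneous polynomials vanishing
  on \<open>C\<close>.
\<close>

definition vanishing_ideal :: "('n::finite, 'k::field) ppoint set \<Rightarrow> ('n, 'k) mpoly set" where
  "vanishing_ideal C = {f. \<forall>x\<in>C. \<forall>v\<in>x. mpoly_eval v f = 0}"

abbreviation mpoly_ring :: "('n, 'k::field) mpoly ring" where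
  "mpoly_ring \<equiv> ring_of_type_algebra"

definition coord_ring :: "('n::finite, 'k::field) ppoint set \<Rightarrow> ('n, 'k) homog_coord ring" where
  "coord_ring C = mpoly_ring Quot vanishing_ideal C"

abbreviation coord_class ::
  "('n::finite, 'k::field) ppoint set \<Rightarrow> ('n, 'k) mpoly \<Rightarrow> ('n, 'k) homog_coord" where
  "coord_class C f \<equiv> vanishing_ideal C +>\<^bsub>mpoly_ring\<^esub> f"

text \<open>
  The local ring of \<open>C\<close> at \<open>x\<close>, for irreducible \<open>C\<close>: the fractions \<open>f / g\<close> of homogeneous
  elements of equal degree with \<open>g x \<noteq> 0\<close>, inside the fraction field of the homogeneous
  coordinate ring.
\<close>

definition local_ring ::
  "('n::finite, 'k::field) ppoint set \<Rightarrow> ('n, 'k) ppoint \<Rightarrow> ('n, 'k) local_elt ring" where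
  "local_ring C x = (fraction_field (coord_ring C))
     \<lparr>carrier := {fraction (coord_ring C) (coord_class C f) (coord_class C g) | f g d.
         homogeneous d f \<and> homogeneous d g \<and> (\<forall>v\<in>x. mpoly_eval v g \<noteq> 0)}\<rparr>"

text \<open>
  For closed points of an irreducible variety \<open>C\<close> the local ring has dimension \<open>dim C\<close>; it is
  regular when its maximal ideal can be generated by that many elements.
\<close>

definition nonsingular_at :: "('n::finite, 'k::field) ppoint set \<Rightarrow> ('n, 'k) ppoint \<Rightarrow> bool" where
  "nonsingular_at C x \<longleftrightarrow>
     (\<exists>B. finite B \<and> enat (card B) = zariski_dim C \<and> B \<subseteq> nonunits (local_ring C x) \<and>
          Idl\<^bsub>local_ring C x\<^esub> B = nonunits (local_ring C x))"

definition nonsingular_projective_curve :: "('n::finite, 'k::alg_closed_field) ppoint set \<Rightarrow> bool" where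
  "nonsingular_projective_curve C \<longleftrightarrow>
     irreducible_closed C \<and> zariski_dim C = 1 \<and> (\<forall>x\<in>C. nonsingular_at C x)"

section \<open>Adeles\<close>

definition complete_local_ring ::
  "('n::finite, 'k::field) ppoint set \<Rightarrow> ('n, 'k) ppoint \<Rightarrow> ('n, 'k) complete_elt ring" where
  "complete_local_ring C x = adic_completion (local_ring C x) (nonunits (local_ring C x))"

definition place_field ::
  "('n::finite, 'k::field) ppoint set \<Rightarrow> ('n, 'k) ppoint \<Rightarrow> ('n, 'k) place_elt ring" where
  "place_field C x = fraction_field (complete_local_ring C x)"

definition place_integers ::
  "('n::finite, 'k::field) ppoint set \<Rightarrow> ('n, 'k) ppoint \<Rightarrow> ('n, 'k) place_elt set" where
  "place_integers C x =
     (\<lambda>a. fraction (complete_local_ring C x) a \<one>\<^bsub>complete_local_ring C x\<^esub>) `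
       carrier (complete_local_ring C x)"

definition place_val ::
  "('n::finite, 'k::field) ppoint set \<Rightarrow> ('n, 'k) ppoint \<Rightarrow> ('n, 'k) place_elt \<Rightarrow> int" where
  "place_val C x = dvr_val (complete_local_ring C x)"

definition uniformizers ::
  "('n::finite, 'k::field) ppoint set \<Rightarrow> ('n, 'k) ppoint \<Rightarrow> ('n, 'k) place_elt set" where
  "uniformizers C x =
     {z \<in> carrier (place_field C x) - {\<zero>\<^bsub>place_field C x\<^esub>}. place_val C x z = 1}"

definition local_const ::
  "('n::finite, 'k::field) ppoint set \<Rightarrow> 'k \<Rightarrow> ('n, 'k) local_elt" where
  "local_const C c =
     fraction (coord_ring C) (coord_class C (Poly_Mapping.single 0 c)) \<one>\<^bsub>coord_ring C\<^esub>"

definition place_const ::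
  "('n::finite, 'k::field) ppoint set \<Rightarrow> ('n, 'k) ppoint \<Rightarrow> 'k \<Rightarrow> ('n, 'k) place_elt" where
  "place_const C x c =
     fraction (complete_local_ring C x)
       (\<lambda>n. ideal_power (local_ring C x) (nonunits (local_ring C x)) n
              +>\<^bsub>local_ring C x\<^esub> local_const C c)
       \<one>\<^bsub>complete_local_ring C x\<^esub>"

definition adele_ring ::
  "('n::finite, 'k::field) ppoint set \<Rightarrow> ('n, 'k) adele ring" where
  "adele_ring C =
     \<lparr>carrier = {\<alpha> \<in> \<Pi>\<^sub>E x\<in>C. carrier (place_field C x). finite {x \<in> C. \<alpha> x \<notin> place_integers C x}},
      monoid.mult = (\<lambda>\<alpha> \<beta>. \<lambda>x\<in>C. \<alpha> x \<otimes>\<^bsub>place_field C x\<^esub> \<beta> x),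
      one = (\<lambda>x\<in>C. \<one>\<^bsub>place_field C x\<^esub>),
      ring.zero = (\<lambda>x\<in>C. \<zero>\<^bsub>place_field C x\<^esub>),
      add = (\<lambda>\<alpha> \<beta>. \<lambda>x\<in>C. \<alpha> x \<oplus>\<^bsub>place_field C x\<^esub> \<beta> x)\<rparr>"

abbreviation ideles :: "('n::finite, 'k::field) ppoint set \<Rightarrow> ('n, 'k) adele set" where
  "ideles C \<equiv> Units (adele_ring C)"

section \<open>The extension \<open>\<bbbA>\<^sub>C{t\<^sup>1\<^sup>/\<^sup>p}\<close> and its automorphisms\<close>

definition Ram :: "('n::finite, 'k::field) ppoint set \<Rightarrow> nat \<Rightarrow> ('n, 'k) adele \<Rightarrow> ('n, 'k) ppoint set" where
  "Ram C p t = {x \<in> C. \<not> [place_val C x (t x) = 0] (mod int p)}"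

abbreviation adele_ext ::
  "('n::finite, 'k::field) ppoint set \<Rightarrow> nat \<Rightarrow> ('n, 'k) adele \<Rightarrow> (nat \<Rightarrow> ('n, 'k) adele) set ring" where
  "adele_ext C p t \<equiv> root_ext (adele_ring C) p t"

abbreviation adele_emb ::
  "('n::finite, 'k::field) ppoint set \<Rightarrow> nat \<Rightarrow> ('n, 'k) adele \<Rightarrow> ('n, 'k) adele \<Rightarrow>
   (nat \<Rightarrow> ('n, 'k) adele) set" where
  "adele_emb C p t \<equiv> root_ext_emb (adele_ring C) p t"

abbreviation place_ext ::
  "('n::finite, 'k::field) ppoint set \<Rightarrow> nat \<Rightarrow> ('n, 'k) adele \<Rightarrow> ('n, 'k) ppoint \<Rightarrow>
   (nat \<Rightarrow> ('n, 'k) place_elt) set ring" where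
  "place_ext C p t x \<equiv> root_ext (place_field C x) p (t x)"

abbreviation place_emb ::
  "('n::finite, 'k::field) ppoint set \<Rightarrow> nat \<Rightarrow> ('n, 'k) adele \<Rightarrow> ('n, 'k) ppoint \<Rightarrow>
   ('n, 'k) place_elt \<Rightarrow> (nat \<Rightarrow> ('n, 'k) place_elt) set" where
  "place_emb C p t x \<equiv> root_ext_emb (place_field C x) p (t x)"

abbreviation GG ::
  "('n::finite, 'k::field) ppoint set \<Rightarrow> nat \<Rightarrow> ('n, 'k) adele \<Rightarrow>
   ((nat \<Rightarrow> ('n, 'k) adele) set \<Rightarrow> (nat \<Rightarrow> ('n, 'k) adele) set) monoid" where
  "GG C p t \<equiv> root_ext_aut (adele_ring C) p t"

text \<open>
  The projection from \<open>\<bbbA>\<^sub>C{t\<^sup>1\<^sup>/\<^sup>p}\<close> to its component \<open>K\<^sub>x{t\<^sub>x\<^sup>1\<^sup>/\<^sup>p}\<close>: on polynomials it takes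
  the \<open>x\<close>-component of each coefficient, so all members of a coset \<open>B\<close> yield the same coset.
\<close>

definition component_proj ::
  "('n::finite, 'k::field) ppoint set \<Rightarrow> nat \<Rightarrow> ('n, 'k) adele \<Rightarrow> ('n, 'k) ppoint \<Rightarrow>
   (nat \<Rightarrow> ('n, 'k) adele) set \<Rightarrow> (nat \<Rightarrow> ('n, 'k) place_elt) set" where
  "component_proj C p t x B =
     the_elem ((\<lambda>f. root_ideal (place_field C x) p (t x) +>\<^bsub>UP (place_field C x)\<^esub> (\<lambda>n. f n x)) ` B)"

text \<open>
  The component \<open>g\<^sub>x\<close> of \<open>g\<close>, the automorphism of \<open>K\<^sub>x{t\<^sub>x\<^sup>1\<^sup>/\<^sup>p}\<close> induced by \<open>g\<close>. It is unique
  because the projection is surjective.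
\<close>

definition component_aut ::
  "('n::finite, 'k::field) ppoint set \<Rightarrow> nat \<Rightarrow> ('n, 'k) adele \<Rightarrow> ('n, 'k) ppoint \<Rightarrow>
   ((nat \<Rightarrow> ('n, 'k) adele) set \<Rightarrow> (nat \<Rightarrow> ('n, 'k) adele) set) \<Rightarrow>
   (nat \<Rightarrow> ('n, 'k) place_elt) set \<Rightarrow> (nat \<Rightarrow> ('n, 'k) place_elt) set" where
  "component_aut C p t x g =
     (THE h. h \<in> carrier (root_ext_aut (place_field C x) p (t x)) \<and>
        (\<forall>\<beta>\<in>carrier (adele_ext C p t).
           h (component_proj C p t x \<beta>) = component_proj C p t x (g \<beta>)))"

definition pointwise_transitive ::
  "('n::finite, 'k::field) ppoint set \<Rightarrow> nat \<Rightarrow> ('n, 'k) adele \<Rightarrow>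
   ((nat \<Rightarrow> ('n, 'k) adele) set \<Rightarrow> (nat \<Rightarrow> ('n, 'k) adele) set) set \<Rightarrow> bool" where
  "pointwise_transitive C p t G \<longleftrightarrow>
     subgroup G (GG C p t) \<and> cyclic_group ((GG C p t)\<lparr>carrier := G\<rparr>) \<and> card G = p \<and>
     {\<beta> \<in> carrier (adele_ext C p t). \<forall>g\<in>G. g \<beta> = \<beta>} = adele_emb C p t ` carrier (adele_ring C)"

definition adele_const ::
  "('n::finite, 'k::field) ppoint set \<Rightarrow> 'k \<Rightarrow> ('n, 'k) adele" where
  "adele_const C c = (\<lambda>x\<in>C. place_const C x c)"

definition primitive_element ::
  "('n::finite, 'k::field) ppoint set \<Rightarrow> nat \<Rightarrow> ('n, 'k) adele \<Rightarrow>
   ((nat \<Rightarrow> ('n, 'k) adele) set \<Rightarrow> (nat \<Rightarrow> ('n, 'k) adele) set) set \<Rightarrow>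
   (((nat \<Rightarrow> ('n, 'k) adele) set \<Rightarrow> (nat \<Rightarrow> ('n, 'k) adele) set) \<Rightarrow> 'k) \<Rightarrow>
   (nat \<Rightarrow> ('n, 'k) adele) set \<Rightarrow> bool" where
  "primitive_element C p t G \<chi> \<alpha> \<longleftrightarrow>
     (let E = adele_ext C p t; \<iota> = adele_emb C p t in
      \<alpha> \<in> carrier E \<and>
      (\<forall>g\<in>G. g \<alpha> = \<iota> (adele_const C (\<chi> g)) \<otimes>\<^bsub>E\<^esub> \<alpha>) \<and>
      (\<forall>\<beta>\<in>carrier E. \<exists>!a. a \<in> {..<p} \<rightarrow>\<^sub>E carrier (adele_ring C) \<and>
         \<beta> = (\<Oplus>\<^bsub>E\<^esub>i\<in>{..<p}. \<iota> (a i) \<otimes>\<^bsub>E\<^esub> \<alpha> [^]\<^bsub>E\<^esub> i)))"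

text \<open>
  For \<open>x \<in> Ram C p t\<close>, where \<open>place_ext C p t x\<close> is a field, the value does not depend on the
  chosen root \<open>\<beta>\<close> of \<open>l\<close>.
\<close>

definition kummer_pairing ::
  "('n::finite, 'k::field) ppoint set \<Rightarrow> nat \<Rightarrow> ('n, 'k) adele \<Rightarrow> ('n, 'k) ppoint \<Rightarrow>
   ((nat \<Rightarrow> ('n, 'k) place_elt) set \<Rightarrow> (nat \<Rightarrow> ('n, 'k) place_elt) set) \<Rightarrow>
   ('n, 'k) place_elt \<Rightarrow> 'k" where
  "kummer_pairing C p t x h l =
     (let E = place_ext C p t x; \<iota> = place_emb C p t x in
      THE c. c ^ p = 1 \<and>
        (\<exists>\<beta>\<in>carrier E. \<beta> [^]\<^bsub>E\<^esub> p = \<iota> l \<and> h \<beta> \<otimes>\<^bsub>E\<^esub> inv\<^bsub>E\<^esub> \<beta> = \<iota> (place_const C x c)))"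

end

theory Submission
  imports Defs
begin

text \<open>
  The powers of \<open>\<alpha>\<close> form an \<open>\<bbbA>\<^sub>X\<close>-basis and \<open>\<alpha>\<^sup>p\<close> is fixed by \<open>G\<close>, so \<open>\<alpha>\<^sup>p = s\<close> is an
  adele. It is a unit: modulo \<open>s\<close> the algebra would be generated by the nilpotent element
  \<open>\<alpha>\<close>, while the \<open>p\<close>-th root of the unit \<open>\<^bold>t\<close> makes it unramified.

  At a place \<open>x\<close>, both \<open>\<alpha>\<close> and \<open>t\<^sup>1\<^sup>/\<^sup>p\<close> induce power bases of \<open>K\<^sub>x{t\<^sub>x\<^sup>1\<^sup>/\<^sup>p}\<close>. If the \<open>p\<close>-th power
  of one of them is a \<open>p\<close>-th power in \<open>K\<^sub>x\<close>, the algebra has a \<open>K\<^sub>x\<close>-valued point, hence so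
  is the \<open>p\<close>-th power of the other one. By Hensel's lemma \<open>p\<close>-th powers are detected by the
  valuation modulo \<open>p\<close>, so \<open>p\<close> divides \<open>\<upsilon>\<^sub>x(s)\<close> if and only if it divides \<open>\<upsilon>\<^sub>x(t)\<close>.

  At a ramified place choose \<open>m\<close> with \<open>m \<upsilon>\<^sub>x(s) \<equiv> 1\<close> modulo \<open>p\<close>. Then \<open>z\<^sub>x = s\<^sub>x\<^sup>m d\<^sup>-\<^sup>p\<close> for some
  \<open>d\<close>, and the \<open>p\<close>-th root \<open>\<alpha>\<^sup>m / d\<close> of \<open>z\<^sub>x\<close> is multiplied by \<open>\<chi>(g)\<^sup>m\<close> under \<open>g\<^sub>x\<close>. Any other
  \<open>p\<close>-th root of \<open>z\<^sub>x\<close> that is an eigenvector of \<open>g\<^sub>x\<close> is a multiple of a power of \<open>\<alpha>\<close>, and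
  comparing valuations gives the same eigenvalue. So the Kummer pairing is \<open>\<chi>(g)\<^sup>m\<close>.
\<close>

section \<open>Fraction fields\<close>

text \<open>An adele with nonzero components need not be an idele, so invertibility of
  \<open>s\<close> cannot be checked place by place. It is proved once over an arbitrary commutative
  base ring, inside the quotient of the algebra by the ideal of \<open>s\<close>. The two points to
  be separated there need a root of unity \<open>\<omega>\<close> with \<open>\<omega> - 1\<close>
  invertible; a value of \<open>\<chi>\<close> other than 1 supplies it, because a nonzero constant
  is invertible at every place. The algebra over a place field is never shown to be a field.
  Elements are tested on the vector (T^p - c^p)/(T - c) belonging to the point T = c, and p-th roots
  of \<open>z\<close> are inverted through their p-th powers. All this uses only that the powers of
  a generator form a basis, a property shared by \<open>\<alpha>\<close> and the adjoined root, so
  both can play either role. Valuations modulo p decide p-th powers because the residue field is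
  algebraically closed and p is invertible in it: every unit of the completion then has a p-th root,
  and only the exponent of the uniformizer is left.\<close>

lemma UN_pairs_const:
  assumes "\<And>a b c d. (a, b) \<in> P \<Longrightarrow> (c, d) \<in> Q \<Longrightarrow> f a b c d = T"
    and "(a, b) \<in> P" "(c, d) \<in> Q"
  shows "(\<Union>(a, b)\<in>P. \<Union>(c, d)\<in>Q. f a b c d) = T"
proof -
  have "(\<Union>(a, b)\<in>P. \<Union>(c, d)\<in>Q. f a b c d) = (\<Union>x\<in>P. \<Union>y\<in>Q. T)"
    using assms(1) by (intro SUP_cong refl) auto
  then show ?thesis using assms(2,3) by auto
qed

context "domain"
begin

lemma fraction_self:
  "a \<in> carrier R \<Longrightarrow> b \<in> carrier R - {\<zero>} \<Longrightarrow> (a, b) \<in> fraction R a b"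
  by (simp add: fraction_def)

text \<open>The middle denominator \<open>b\<close> is nonzero and can be cancelled in a domain.
  This makes cross-multiplication an equivalence relation, so fractions can be handled as
  classes.\<close>

lemma fraction_trans:
  assumes "a \<in> carrier R" "b \<in> carrier R - {\<zero>}" "c \<in> carrier R" "d \<in> carrier R"
    "e \<in> carrier R" "f \<in> carrier R"
    and "a \<otimes> d = c \<otimes> b" "a \<otimes> f = e \<otimes> b"
  shows "c \<otimes> f = e \<otimes> d"
proof -
  have "b \<otimes> (c \<otimes> f) = (c \<otimes> b) \<otimes> f" using assms(1-6) by (simp add: m_ac)
  also have "\<dots> = (a \<otimes> f) \<otimes> d" unfolding assms(7)[symmetric] using assms(1-6) by (simp add: m_ac)
  also have "\<dots> = b \<otimes> (e \<otimes> d)" unfolding assms(8) using assms(1-6) by (simp add: m_ac)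
  finally show ?thesis using assms(1-6) by (simp add: m_lcancel)
qed

lemma fraction_eq_iff:
  assumes "a \<in> carrier R" "b \<in> carrier R - {\<zero>}" "c \<in> carrier R" "d \<in> carrier R - {\<zero>}"
  shows "fraction R a b = fraction R c d \<longleftrightarrow> a \<otimes> d = c \<otimes> b"
proof
  assume "fraction R a b = fraction R c d"
  with fraction_self[of a b] assms have "(a, b) \<in> fraction R c d" by simp
  then show "a \<otimes> d = c \<otimes> b" by (simp add: fraction_def)
next
  assume eq: "a \<otimes> d = c \<otimes> b"
  have "a \<otimes> f = e \<otimes> b \<longleftrightarrow> c \<otimes> f = e \<otimes> d"
    if "e \<in> carrier R" "f \<in> carrier R" for e f
    using fraction_trans[of a b c d e f] fraction_trans[of c d a b e f] eq assms that by auto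
  then show "fraction R a b = fraction R c d"
    unfolding fraction_def by auto
qed

lemma mem_fractionD:
  assumes "a \<in> carrier R" "b \<in> carrier R - {\<zero>}" "(c, d) \<in> fraction R a b"
  shows "c \<in> carrier R" "d \<in> carrier R - {\<zero>}" "fraction R c d = fraction R a b"
    "a \<otimes> d = c \<otimes> b"
  using assms fraction_eq_iff[of c d a b] by (auto simp: fraction_def)

lemma fraction_field_mult:
  assumes "a \<in> carrier R" "b \<in> carrier R - {\<zero>}" "c \<in> carrier R" "d \<in> carrier R - {\<zero>}"
  shows "fraction R a b \<otimes>\<^bsub>fraction_field R\<^esub> fraction R c d = fraction R (a \<otimes> c) (b \<otimes> d)"
proof -
  \<comment> \<open>Independence of the representatives: the union defining the product runs over
    all pairs of representatives and therefore collapses to a single class.\<close>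
  have "fraction R (a' \<otimes> c') (b' \<otimes> d') = fraction R (a \<otimes> c) (b \<otimes> d)"
    if m: "(a', b') \<in> fraction R a b" "(c', d') \<in> fraction R c d" for a' b' c' d'
  proof -
    note A = mem_fractionD[OF assms(1,2) m(1)] and C = mem_fractionD[OF assms(3,4) m(2)]
    have "a' \<otimes> c' \<otimes> (b \<otimes> d) = (a' \<otimes> b) \<otimes> (c' \<otimes> d)"
      using A C assms by (simp add: m_ac)
    also have "\<dots> = (a \<otimes> b') \<otimes> (c \<otimes> d')" unfolding A(4) C(4) ..
    also have "\<dots> = a \<otimes> c \<otimes> (b' \<otimes> d')" using A(1,2) C(1,2) assms by (simp add: m_ac)
    finally show ?thesis
      using A(1,2) C(1,2) assms by (subst fraction_eq_iff) (simp_all add: integral_iff)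
  qed
  then show ?thesis
    unfolding fraction_field_def monoid.simps ring.simps
    by (rule UN_pairs_const[OF _ fraction_self fraction_self]) (use assms in auto)
qed

lemma fraction_field_add:
  assumes "a \<in> carrier R" "b \<in> carrier R - {\<zero>}" "c \<in> carrier R" "d \<in> carrier R - {\<zero>}"
  shows "fraction R a b \<oplus>\<^bsub>fraction_field R\<^esub> fraction R c d =
    fraction R (a \<otimes> d \<oplus> c \<otimes> b) (b \<otimes> d)"
proof -
  have "fraction R (a' \<otimes> d' \<oplus> c' \<otimes> b') (b' \<otimes> d') = fraction R (a \<otimes> d \<oplus> c \<otimes> b) (b \<otimes> d)"
    if m: "(a', b') \<in> fraction R a b" "(c', d') \<in> fraction R c d" for a' b' c' d'
  proof -
    note A = mem_fractionD[OF assms(1,2) m(1)] and C = mem_fractionD[OF assms(3,4) m(2)]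
    have "(a' \<otimes> d' \<oplus> c' \<otimes> b') \<otimes> (b \<otimes> d) = (a' \<otimes> b) \<otimes> (d \<otimes> d') \<oplus> (c' \<otimes> d) \<otimes> (b \<otimes> b')"
      using A C assms by (simp add: m_ac l_distr r_distr)
    also have "\<dots> = (a \<otimes> b') \<otimes> (d \<otimes> d') \<oplus> (c \<otimes> d') \<otimes> (b \<otimes> b')" unfolding A(4) C(4) ..
    also have "\<dots> = (a \<otimes> d \<oplus> c \<otimes> b) \<otimes> (b' \<otimes> d')" using A(1,2) C(1,2) assms by (simp add: m_ac l_distr r_distr)
    finally show ?thesis
      using A(1,2) C(1,2) assms by (subst fraction_eq_iff) (simp_all add: integral_iff)
  qed
  then show ?thesis
    unfolding fraction_field_def monoid.simps ring.simps
    by (rule UN_pairs_const[OF _ fraction_self fraction_self]) (use assms in auto)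
qed

lemma fraction_field_carrier:
  "carrier (fraction_field R) = {fraction R a b | a b. a \<in> carrier R \<and> b \<in> carrier R - {\<zero>}}"
  "\<one>\<^bsub>fraction_field R\<^esub> = fraction R \<one> \<one>" "\<zero>\<^bsub>fraction_field R\<^esub> = fraction R \<zero> \<one>"
  by (simp_all add: fraction_field_def)

lemma fraction_closed:
  "a \<in> carrier R \<Longrightarrow> b \<in> carrier R - {\<zero>} \<Longrightarrow> fraction R a b \<in> carrier (fraction_field R)"
  by (auto simp: fraction_field_carrier)

lemma fraction_fieldE:
  assumes "q \<in> carrier (fraction_field R)"
  obtains a b where "a \<in> carrier R" "b \<in> carrier R" "b \<noteq> \<zero>" "q = fraction R a b"
  using assms by (auto simp: fraction_field_carrier)

lemmas fraction_rules = fraction_field_mult fraction_field_add fraction_eq_iff integral_iff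

lemma cring_fraction_field: "cring (fraction_field R)"
proof (rule cringI)
  show "abelian_group (fraction_field R)"
  proof (rule abelian_groupI)
    fix x y z assume xyz: "x \<in> carrier (fraction_field R)" "y \<in> carrier (fraction_field R)"
      "z \<in> carrier (fraction_field R)"
    obtain a b where x: "a \<in> carrier R" "b \<in> carrier R" "b \<noteq> \<zero>" "x = fraction R a b"
      using xyz by (auto elim: fraction_fieldE)
    obtain c d where y: "c \<in> carrier R" "d \<in> carrier R" "d \<noteq> \<zero>" "y = fraction R c d"
      using xyz by (auto elim: fraction_fieldE)
    obtain e f where z: "e \<in> carrier R" "f \<in> carrier R" "f \<noteq> \<zero>" "z = fraction R e f"
      using xyz by (auto elim: fraction_fieldE)
    show "x \<oplus>\<^bsub>fraction_field R\<^esub> y \<oplus>\<^bsub>fraction_field R\<^esub> z = x \<oplus>\<^bsub>fraction_field R\<^esub> (y \<oplus>\<^bsub>fraction_field R\<^esub> z)"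
      using x y z by (simp add: fraction_rules) (simp add: m_ac l_distr r_distr a_ac)
  next
    fix x y assume xyz: "x \<in> carrier (fraction_field R)" "y \<in> carrier (fraction_field R)"
    obtain a b where x: "a \<in> carrier R" "b \<in> carrier R" "b \<noteq> \<zero>" "x = fraction R a b"
      using xyz by (auto elim: fraction_fieldE)
    obtain c d where y: "c \<in> carrier R" "d \<in> carrier R" "d \<noteq> \<zero>" "y = fraction R c d"
      using xyz by (auto elim: fraction_fieldE)
    show "x \<oplus>\<^bsub>fraction_field R\<^esub> y \<in> carrier (fraction_field R)"
      using x y by (auto simp add: fraction_rules intro!: fraction_closed)
    show "x \<oplus>\<^bsub>fraction_field R\<^esub> y = y \<oplus>\<^bsub>fraction_field R\<^esub> x"
      using x y by (simp add: fraction_rules) (simp add: m_ac l_distr r_distr a_ac)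
  next
    fix x assume xyz: "x \<in> carrier (fraction_field R)"
    obtain a b where x: "a \<in> carrier R" "b \<in> carrier R" "b \<noteq> \<zero>" "x = fraction R a b"
      using xyz by (auto elim: fraction_fieldE)
    show "\<zero>\<^bsub>fraction_field R\<^esub> \<oplus>\<^bsub>fraction_field R\<^esub> x = x"
      using x by (simp add: fraction_rules fraction_field_carrier)
    show "\<exists>y\<in>carrier (fraction_field R). y \<oplus>\<^bsub>fraction_field R\<^esub> x = \<zero>\<^bsub>fraction_field R\<^esub>"
    proof (rule bexI)
      have "\<ominus> a \<otimes> b \<oplus> a \<otimes> b = \<zero>" using x by (simp add: l_minus l_neg)
      then show "fraction R (\<ominus> a) b \<oplus>\<^bsub>fraction_field R\<^esub> x = \<zero>\<^bsub>fraction_field R\<^esub>"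
        using x by (simp add: fraction_rules fraction_field_carrier)
    qed (use x in \<open>auto intro: fraction_closed\<close>)
  next
    show "\<zero>\<^bsub>fraction_field R\<^esub> \<in> carrier (fraction_field R)"
      by (auto simp: fraction_field_carrier(3) intro!: fraction_closed)
  qed
  show "Group.comm_monoid (fraction_field R)"
  proof (rule comm_monoidI)
    fix x y z assume xyz: "x \<in> carrier (fraction_field R)" "y \<in> carrier (fraction_field R)"
      "z \<in> carrier (fraction_field R)"
    obtain a b where x: "a \<in> carrier R" "b \<in> carrier R" "b \<noteq> \<zero>" "x = fraction R a b"
      using xyz by (auto elim: fraction_fieldE)
    obtain c d where y: "c \<in> carrier R" "d \<in> carrier R" "d \<noteq> \<zero>" "y = fraction R c d"
      using xyz by (auto elim: fraction_fieldE)
    obtain e f where z: "e \<in> carrier R" "f \<in> carrier R" "f \<noteq> \<zero>" "z = fraction R e f"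
      using xyz by (auto elim: fraction_fieldE)
    show "x \<otimes>\<^bsub>fraction_field R\<^esub> y \<otimes>\<^bsub>fraction_field R\<^esub> z = x \<otimes>\<^bsub>fraction_field R\<^esub> (y \<otimes>\<^bsub>fraction_field R\<^esub> z)"
      using x y z by (simp add: fraction_rules) (simp add: m_ac)
  next
    fix x y assume xyz: "x \<in> carrier (fraction_field R)" "y \<in> carrier (fraction_field R)"
    obtain a b where x: "a \<in> carrier R" "b \<in> carrier R" "b \<noteq> \<zero>" "x = fraction R a b"
      using xyz by (auto elim: fraction_fieldE)
    obtain c d where y: "c \<in> carrier R" "d \<in> carrier R" "d \<noteq> \<zero>" "y = fraction R c d"
      using xyz by (auto elim: fraction_fieldE)
    show "x \<otimes>\<^bsub>fraction_field R\<^esub> y \<in> carrier (fraction_field R)"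
      using x y by (auto simp add: fraction_rules intro!: fraction_closed)
    show "x \<otimes>\<^bsub>fraction_field R\<^esub> y = y \<otimes>\<^bsub>fraction_field R\<^esub> x"
      using x y by (simp add: fraction_rules) (simp add: m_ac)
  next
    fix x assume xyz: "x \<in> carrier (fraction_field R)"
    obtain a b where x: "a \<in> carrier R" "b \<in> carrier R" "b \<noteq> \<zero>" "x = fraction R a b"
      using xyz by (auto elim: fraction_fieldE)
    show "\<one>\<^bsub>fraction_field R\<^esub> \<otimes>\<^bsub>fraction_field R\<^esub> x = x"
      using x by (simp add: fraction_rules fraction_field_carrier)
  next
    show "\<one>\<^bsub>fraction_field R\<^esub> \<in> carrier (fraction_field R)"
      by (auto simp: fraction_field_carrier(2) intro!: fraction_closed)
  qed
next
  fix x y z assume xyz: "x \<in> carrier (fraction_field R)" "y \<in> carrier (fraction_field R)"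
    "z \<in> carrier (fraction_field R)"
  obtain a b where x: "a \<in> carrier R" "b \<in> carrier R" "b \<noteq> \<zero>" "x = fraction R a b"
    using xyz by (auto elim: fraction_fieldE)
  obtain c d where y: "c \<in> carrier R" "d \<in> carrier R" "d \<noteq> \<zero>" "y = fraction R c d"
    using xyz by (auto elim: fraction_fieldE)
  obtain e f where z: "e \<in> carrier R" "f \<in> carrier R" "f \<noteq> \<zero>" "z = fraction R e f"
    using xyz by (auto elim: fraction_fieldE)
  show "(x \<oplus>\<^bsub>fraction_field R\<^esub> y) \<otimes>\<^bsub>fraction_field R\<^esub> z =
    x \<otimes>\<^bsub>fraction_field R\<^esub> z \<oplus>\<^bsub>fraction_field R\<^esub> y \<otimes>\<^bsub>fraction_field R\<^esub> z"
    using x y z by (simp add: fraction_rules) (simp add: m_ac l_distr r_distr)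
qed

lemma fraction_eq_zero_iff:
  "a \<in> carrier R \<Longrightarrow> b \<in> carrier R - {\<zero>} \<Longrightarrow>
     fraction R a b = \<zero>\<^bsub>fraction_field R\<^esub> \<longleftrightarrow> a = \<zero>"
  by (auto simp: fraction_field_carrier fraction_rules)

lemma field_fraction_field: "field (fraction_field R)"
proof (rule cring.cring_fieldI2[OF cring_fraction_field])
  show "\<zero>\<^bsub>fraction_field R\<^esub> \<noteq> \<one>\<^bsub>fraction_field R\<^esub>"
    by (simp add: fraction_field_carrier fraction_rules)
next
  fix x assume x: "x \<in> carrier (fraction_field R)" "x \<noteq> \<zero>\<^bsub>fraction_field R\<^esub>"
  obtain a b where ab: "a \<in> carrier R" "b \<in> carrier R" "b \<noteq> \<zero>" "x = fraction R a b"
    using x(1) by (elim fraction_fieldE)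
  then have a: "a \<noteq> \<zero>" using x(2) fraction_eq_zero_iff[of a b] by auto
  show "\<exists>y\<in>carrier (fraction_field R). x \<otimes>\<^bsub>fraction_field R\<^esub> y = \<one>\<^bsub>fraction_field R\<^esub>"
    using a ab by (intro bexI[of _ "fraction R b a"] fraction_closed)
      (auto simp: fraction_field_carrier fraction_rules m_comm)
qed

lemma fraction_ring_hom: "(\<lambda>a. fraction R a \<one>) \<in> ring_hom R (fraction_field R)"
  by (rule ring_hom_memI) (auto simp: fraction_field_carrier(2) fraction_rules intro: fraction_closed)

end

section \<open>Discrete valuation rings\<close>

text \<open>Products of principal ideals are again principal. Membership in the abstractly defined
  \<open>ideal_power\<close> thereby becomes divisibility by \<open>\<pi> [^] n\<close>.\<close>

lemma (in cring) ideal_power_principal: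
  assumes "\<pi> \<in> carrier R"
  shows "ideal_power R (PIdl \<pi>) n = PIdl (\<pi> [^] n)"
proof (induction n)
  case 0
  show ?case using assms by (auto simp: cgenideal_def intro: r_one[symmetric])
next
  case (Suc n)
  have "ideal_power R (PIdl \<pi>) (Suc n) = Idl ((PIdl \<pi>) <#> (PIdl (\<pi> [^] n)))"
    using Suc assms by (simp add: ideal_prod_eq_genideal cgenideal_ideal)
  also have "\<dots> = Idl (PIdl (\<pi> [^] Suc n))"
    using assms by (simp add: cgenideal_prod m_comm)
  also have "\<dots> = PIdl (\<pi> [^] Suc n)"
    using assms cgenideal_ideal[of "\<pi> [^] Suc n"] genideal_self[of "PIdl (\<pi> [^] Suc n)"]
    by (intro equalityI genideal_minimal) (auto dest: ideal.Icarr)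
  finally show ?case .
qed

text \<open>The factorization into a power of \<open>\<pi>\<close> and a unit serves as the
  description of a discrete valuation ring: it is what the completion delivers directly, and all
  that is needed to compute valuations.\<close>

locale discrete_valuation_domain = "domain" +
  fixes \<pi>
  assumes unif_closed [simp, intro]: "\<pi> \<in> carrier R"
    and unif_nonunit: "\<pi> \<notin> Units R"
    and unif_nonzero: "\<pi> \<noteq> \<zero>"
    and unif_factor: "\<And>a. a \<in> carrier R \<Longrightarrow> a \<noteq> \<zero> \<Longrightarrow> \<exists>n. \<exists>u\<in>Units R. a = \<pi> [^] (n::nat) \<otimes> u"
begin

lemma unif_pow_nonzero: "\<pi> [^] (n::nat) \<noteq> \<zero>"
  by (induction n) (auto simp: unif_nonzero integral_iff)

lemma unit_imp_unif_pow_zero: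
  assumes "r \<in> carrier R" "r \<otimes> \<pi> [^] (k::nat) \<in> Units R"
  shows "k = 0"
proof (cases k)
  case (Suc m)
  have "\<pi> \<otimes> (r \<otimes> \<pi> [^] m) \<in> Units R" using assms Suc by (simp add: m_ac)
  then have "\<pi> \<in> Units R" by (rule unit_factor) (use assms(1) in auto)
  then show ?thesis using unif_nonunit by simp
qed simp

text \<open>A nonunit has positive exponent in its factorization and so is a multiple of
  \<open>\<pi>\<close>. This connects the locale parameter with \<open>nonunits\<close>, on which
  \<open>dvr_ord\<close> is built.\<close>

lemma nonunits_eq: "nonunits R = PIdl \<pi>"
proof (intro equalityI subsetI)
  fix a assume a: "a \<in> nonunits R"
  then have aR: "a \<in> carrier R" "a \<notin> Units R" by (auto simp: nonunits_def)
  show "a \<in> PIdl \<pi>"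
  proof (cases "a = \<zero>")
    case True
    then show ?thesis by (auto simp: cgenideal_def intro!: exI[of _ \<zero>])
  next
    case False
    then obtain n u where u: "u \<in> Units R" "a = \<pi> [^] (n::nat) \<otimes> u" using unif_factor aR by blast
    with aR have "n \<noteq> 0" by (metis Units_closed l_one nat_pow_0)
    then obtain m where "n = Suc m" by (cases n) auto
    then have "a = (\<pi> [^] m \<otimes> u) \<otimes> \<pi>" using u by (simp add: m_ac Units_closed)
    then show ?thesis using u unfolding cgenideal_def by (blast intro: m_closed nat_pow_closed Units_closed)
  qed
next
  fix a assume "a \<in> PIdl \<pi>"
  then obtain r where r: "r \<in> carrier R" "a = r \<otimes> \<pi>" by (auto simp: cgenideal_def)
  have "a \<notin> Units R" using unit_imp_unif_pow_zero[of r 1] r by auto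
  then show "a \<in> nonunits R" using r by (auto simp: nonunits_def)
qed

text \<open>Membership in the k-th power of the maximal ideal is divisibility by
  \<open>\<pi> [^] k\<close>. For k > n, cancelling \<open>\<pi> [^] n\<close> would leave a unit
  divisible by \<open>\<pi>\<close>, so n is the greatest such exponent.\<close>

lemma dvr_ord_eq:
  assumes "u \<in> Units R"
  shows "dvr_ord R (\<pi> [^] (n::nat) \<otimes> u) = n"
  unfolding dvr_ord_def nonunits_eq ideal_power_principal[OF unif_closed]
proof (rule Greatest_equality)
  show "\<pi> [^] n \<otimes> u \<in> PIdl (\<pi> [^] n)"
    using assms by (auto simp: cgenideal_def m_comm intro!: exI[of _ u] Units_closed)
next
  fix k :: nat assume "\<pi> [^] n \<otimes> u \<in> PIdl (\<pi> [^] k)"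
  then obtain r where r: "r \<in> carrier R" "\<pi> [^] n \<otimes> u = r \<otimes> \<pi> [^] k" by (auto simp: cgenideal_def)
  show "k \<le> n"
  proof (rule ccontr)
    assume "\<not> k \<le> n"
    then obtain j where k: "k = n + j" "j > 0" by (metis less_imp_add_positive not_le)
    have "\<pi> [^] n \<otimes> u = \<pi> [^] n \<otimes> (r \<otimes> \<pi> [^] j)"
      using r by (simp add: k nat_pow_mult[symmetric] m_ac)
    then have "r \<otimes> \<pi> [^] j \<in> Units R"
      using assms r by (simp add: m_lcancel unif_pow_nonzero Units_closed)
    then show False using unit_imp_unif_pow_zero r k by blast
  qed
qed

lemma dvr_ord_mult:
  assumes "a \<in> carrier R - {\<zero>}" "b \<in> carrier R - {\<zero>}"
  shows "dvr_ord R (a \<otimes> b) = dvr_ord R a + dvr_ord R b"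
proof -
  obtain n u where u: "u \<in> Units R" "a = \<pi> [^] (n::nat) \<otimes> u" using unif_factor assms(1) by blast
  obtain m v where v: "v \<in> Units R" "b = \<pi> [^] (m::nat) \<otimes> v" using unif_factor assms(2) by blast
  have "a \<otimes> b = \<pi> [^] (n + m) \<otimes> (u \<otimes> v)"
    using u v by (simp add: nat_pow_mult[symmetric] m_ac Units_closed)
  then show ?thesis using u v by (simp add: dvr_ord_eq Units_m_closed)
qed

text \<open>Two representations of a fraction are related by cross-multiplication, and
  \<open>dvr_ord\<close> is additive, so the difference of orders is the same for both; this
  justifies the definite description in \<open>dvr_val\<close>.\<close>

lemma dvr_val_fraction:
  assumes "a \<in> carrier R - {\<zero>}" "b \<in> carrier R - {\<zero>}"
  shows "dvr_val R (fraction R a b) = int (dvr_ord R a) - int (dvr_ord R b)"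
  unfolding dvr_val_def
proof (rule the_equality)
  fix v assume "\<exists>c\<in>carrier R - {\<zero>}. \<exists>d\<in>carrier R - {\<zero>}.
    fraction R a b = fraction R c d \<and> v = int (dvr_ord R c) - int (dvr_ord R d)"
  then obtain c d where cd: "c \<in> carrier R - {\<zero>}" "d \<in> carrier R - {\<zero>}"
    "fraction R a b = fraction R c d" "v = int (dvr_ord R c) - int (dvr_ord R d)" by blast
  then have "dvr_ord R (a \<otimes> d) = dvr_ord R (c \<otimes> b)" using assms by (simp add: fraction_eq_iff)
  then show "v = int (dvr_ord R a) - int (dvr_ord R b)"
    using assms cd by (simp add: dvr_ord_mult)
qed (use assms in blast)

lemma fraction_field_nonzeroE:
  assumes "q \<in> carrier (fraction_field R) - {\<zero>\<^bsub>fraction_field R\<^esub>}"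
  obtains a b where "a \<in> carrier R - {\<zero>}" "b \<in> carrier R - {\<zero>}" "q = fraction R a b"
proof -
  have "q \<in> carrier (fraction_field R)" using assms by simp
  then obtain a b where ab: "a \<in> carrier R" "b \<in> carrier R" "b \<noteq> \<zero>" "q = fraction R a b"
    by (elim fraction_fieldE)
  then have "a \<noteq> \<zero>" using assms fraction_eq_zero_iff[of a b] by simp
  with ab show thesis by (intro that[of a b]) auto
qed

lemma dvr_val_mult:
  assumes "q \<in> carrier (fraction_field R) - {\<zero>\<^bsub>fraction_field R\<^esub>}"
    "r \<in> carrier (fraction_field R) - {\<zero>\<^bsub>fraction_field R\<^esub>}"
  shows "dvr_val R (q \<otimes>\<^bsub>fraction_field R\<^esub> r) = dvr_val R q + dvr_val R r"
proof -
  obtain a b where ab: "a \<in> carrier R - {\<zero>}" "b \<in> carrier R - {\<zero>}" "q = fraction R a b"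
    using assms(1) by (elim fraction_field_nonzeroE)
  obtain c d where cd: "c \<in> carrier R - {\<zero>}" "d \<in> carrier R - {\<zero>}" "r = fraction R c d"
    using assms(2) by (elim fraction_field_nonzeroE)
  show ?thesis
    using ab cd by (simp add: fraction_field_mult dvr_val_fraction integral_iff dvr_ord_mult)
qed

lemma fraction_pow:
  assumes "a \<in> carrier R" "b \<in> carrier R - {\<zero>}"
  shows "fraction R a b [^]\<^bsub>fraction_field R\<^esub> (n::nat) = fraction R (a [^] n) (b [^] n)"
proof (induction n)
  case 0
  show ?case by (simp add: fraction_field_carrier)
next
  case (Suc n)
  have "b [^] n \<noteq> \<zero>" using assms by (induction n) (auto simp: integral_iff)
  with Suc assms show ?case by (simp add: fraction_field_mult)
qed

text \<open>A nonzero fraction is a power of \<open>\<pi>\<close> times a unit quotient. The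
  quotient has a p-th root by hypothesis, and the exponent of \<open>\<pi>\<close> is a multiple of
  p.\<close>

lemma dvr_val_root:
  assumes root: "\<And>u. u \<in> Units R \<Longrightarrow> \<exists>w\<in>carrier R. w [^] (p::nat) = u" and "p > 0"
    and q: "q \<in> carrier (fraction_field R) - {\<zero>\<^bsub>fraction_field R\<^esub>}" and dvd: "int p dvd dvr_val R q"
  shows "\<exists>r\<in>carrier (fraction_field R). q = r [^]\<^bsub>fraction_field R\<^esub> p"
proof -
  obtain a b where ab: "a \<in> carrier R - {\<zero>}" "b \<in> carrier R - {\<zero>}" "q = fraction R a b"
    using q by (elim fraction_field_nonzeroE)
  obtain n u where u: "u \<in> Units R" "a = \<pi> [^] (n::nat) \<otimes> u" using unif_factor ab by blast
  obtain m v where v: "v \<in> Units R" "b = \<pi> [^] (m::nat) \<otimes> v" using unif_factor ab by blast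
  obtain w where w: "w \<in> carrier R" "w [^] p = u \<otimes> inv v" using root[of "u \<otimes> inv v"] u v by auto
  obtain k where k: "int n - int m = int p * k"
    using dvd ab u v by (auto simp: dvr_val_fraction dvr_ord_eq)
  \<comment> \<open>The exponent \<open>k\<close> may be negative while powers take natural
    exponents, so its positive part goes to the numerator and its negative part to the
    denominator.\<close>
  define k1 k2 where "k1 = nat k" and "k2 = nat (- k)"
  have kk: "p * k1 + m = n + p * k2"
  proof -
    have "k = int k1 - int k2" by (simp add: k1_def k2_def)
    then have "int p * int k1 - int p * int k2 = int n - int m"
      using k by (simp add: right_diff_distrib)
    then have "int (p * k1 + m) = int (n + p * k2)" by simp
    then show ?thesis by linarith
  qed
  have uv: "w [^] p \<otimes> v = u" using w u v by (simp add: m_assoc Units_closed)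
  have wp: "(\<pi> [^] k1 \<otimes> w) [^] p = \<pi> [^] (p * k1) \<otimes> w [^] p"
    using w by (simp add: nat_pow_distrib nat_pow_pow mult.commute)
  have "\<pi> [^] n \<otimes> u \<otimes> \<pi> [^] (p * k2) = \<pi> [^] (n + p * k2) \<otimes> u"
    using u by (simp add: nat_pow_mult[symmetric] m_ac Units_closed)
  also have "\<dots> = \<pi> [^] (p * k1) \<otimes> w [^] p \<otimes> (\<pi> [^] m \<otimes> v)"
    unfolding kk[symmetric] uv[symmetric] using v(1) w(1) by (simp add: nat_pow_mult[symmetric] m_ac Units_closed)
  finally have "a \<otimes> (\<pi> [^] k2) [^] p = (\<pi> [^] k1 \<otimes> w) [^] p \<otimes> b"
    using u v wp by (simp add: nat_pow_pow mult.commute)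
  then have "q = fraction R (\<pi> [^] k1 \<otimes> w) (\<pi> [^] k2) [^]\<^bsub>fraction_field R\<^esub> p"
    using ab w by (simp add: fraction_pow fraction_eq_iff unif_pow_nonzero nat_pow_pow)
  moreover have "fraction R (\<pi> [^] k1 \<otimes> w) (\<pi> [^] k2) \<in> carrier (fraction_field R)"
    using w by (auto intro!: fraction_closed simp: unif_pow_nonzero)
  ultimately show ?thesis by blast
qed

end

section \<open>Adic completion of a local domain with principal maximal ideal\<close>

text \<open>First-order Taylor expansion of the power function, for the Newton step below. The
  remainder only has to be a multiple of h squared, so its cofactor \<open>q\<close> stays
  unspecified; the exponent \<open>Suc n\<close> keeps the derivative free of truncated
  subtraction.\<close>

lemma (in cring) binomial_expansion_first_order:
  assumes [simp]: "w \<in> carrier R" "h \<in> carrier R"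
  shows "\<exists>q\<in>carrier R. (w \<oplus> h) [^] Suc n =
    w [^] Suc n \<oplus> add_pow R (Suc n) \<one> \<otimes> w [^] n \<otimes> h \<oplus> h \<otimes> h \<otimes> q"
proof (induction n)
  case 0
  show ?case by (rule bexI[of _ \<zero>]) auto
next
  case (Suc n)
  then obtain q where q: "q \<in> carrier R" "(w \<oplus> h) [^] Suc n =
    w [^] Suc n \<oplus> add_pow R (Suc n) \<one> \<otimes> w [^] n \<otimes> h \<oplus> h \<otimes> h \<otimes> q" by blast
  define N v where "N = add_pow R (Suc n) \<one>" and "v = w [^] n"
  have c: "N \<in> carrier R" "v \<in> carrier R" by (auto simp: N_def v_def)
  have v: "w [^] Suc n = v \<otimes> w" "w [^] Suc (Suc n) = v \<otimes> w \<otimes> w" by (simp_all add: v_def)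
  have N: "add_pow R (Suc (Suc n)) \<one> = N \<oplus> \<one>" by (simp add: N_def)
  have "(w \<oplus> h) [^] Suc (Suc n) = (v \<otimes> w \<oplus> N \<otimes> v \<otimes> h \<oplus> h \<otimes> h \<otimes> q) \<otimes> (w \<oplus> h)"
    using q(2) unfolding N_def v_def by simp
  also have "\<dots> = v \<otimes> w \<otimes> w \<oplus> (N \<oplus> \<one>) \<otimes> (v \<otimes> w) \<otimes> h \<oplus> h \<otimes> h \<otimes> (N \<otimes> v \<oplus> q \<otimes> w \<oplus> q \<otimes> h)"
    using c q(1) assms by algebra
  finally have "(w \<oplus> h) [^] Suc (Suc n) =
    w [^] Suc (Suc n) \<oplus> add_pow R (Suc (Suc n)) \<one> \<otimes> w [^] Suc n \<otimes> h \<oplus> h \<otimes> h \<otimes> (N \<otimes> v \<oplus> q \<otimes> w \<oplus> q \<otimes> h)"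
    unfolding v N .
  moreover have "N \<otimes> v \<oplus> q \<otimes> w \<oplus> q \<otimes> h \<in> carrier R" using c q(1) by simp
  ultimately show ?case by blast
qed

text \<open>That the nonunits form an ideal is the locality of the ring. Factorization into a power
  of \<open>\<pi>\<close> and a unit is not assumed here; it is proved for the completion, where an
  element vanishing at every level is zero by construction.\<close>

locale principal_local_domain = "domain" +
  fixes \<pi>
  assumes gen_closed [simp, intro]: "\<pi> \<in> carrier R"
    and gen_nonzero: "\<pi> \<noteq> \<zero>"
    and nonunits_principal: "nonunits R = PIdl \<pi>"
begin

abbreviation I :: "nat \<Rightarrow> 'a set" where "I n \<equiv> PIdl (\<pi> [^] n)"

abbreviation (input) A :: "(nat \<Rightarrow> 'a set) ring" where "A \<equiv> adic_completion R (nonunits R)"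

text \<open>Elements of the completion are computed through sequences of representatives in R
  instead of sequences of cosets. As \<open>I 0\<close> is the whole ring, the term
  \<open>x 0\<close> carries no information.\<close>

definition coherent :: "(nat \<Rightarrow> 'a) \<Rightarrow> bool" where
  "coherent x \<longleftrightarrow> (\<forall>n. x n \<in> carrier R \<and> x (Suc n) \<ominus> x n \<in> I n)"

definition adic_lim :: "(nat \<Rightarrow> 'a) \<Rightarrow> nat \<Rightarrow> 'a set" where
  "adic_lim x = (\<lambda>n. I n +> x n)"

section \<open>Congruences modulo powers of the generator\<close>

lemma ideal_I: "ideal (I n) R"
  by (rule cgenideal_ideal) simp

lemma ideal_power_nonunits: "ideal_power R (nonunits R) n = I n"
  by (simp add: nonunits_principal ideal_power_principal)

lemma I_mem: "a \<in> I n \<longleftrightarrow> (\<exists>r\<in>carrier R. a = r \<otimes> \<pi> [^] n)"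
  unfolding cgenideal_def by blast

lemma I_carrier: "a \<in> I n \<Longrightarrow> a \<in> carrier R"
  by (rule ideal.Icarr[OF ideal_I])

lemma I_add: "a \<in> I n \<Longrightarrow> b \<in> I n \<Longrightarrow> a \<oplus> b \<in> I n"
  using additive_subgroup.a_closed[OF ideal.axioms(1)[OF ideal_I]] .

lemma I_minus: "a \<in> I n \<Longrightarrow> \<ominus> a \<in> I n"
  using additive_subgroup.a_inv_closed[OF ideal.axioms(1)[OF ideal_I]] .

lemma I_diff: "a \<in> I n \<Longrightarrow> b \<in> I n \<Longrightarrow> a \<ominus> b \<in> I n"
  by (simp add: minus_eq I_add I_minus)

lemma I_zero: "\<zero> \<in> I n"
  using additive_subgroup.zero_closed[OF ideal.axioms(1)[OF ideal_I]] .

lemma I_mult: "a \<in> I n \<Longrightarrow> b \<in> carrier R \<Longrightarrow> b \<otimes> a \<in> I n"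
  by (rule ideal.I_l_closed[OF ideal_I])

lemma I_0: "I 0 = carrier R"
proof (intro equalityI subsetI)
  fix a assume "a \<in> carrier R"
  then show "a \<in> I 0" unfolding I_mem by (intro bexI[of _ a]) auto
qed (rule I_carrier)

lemma I_refl: "a \<in> carrier R \<Longrightarrow> a \<ominus> a \<in> I n"
  by (simp add: minus_eq r_neg I_zero)

lemma I_mono: "m \<le> n \<Longrightarrow> a \<in> I n \<Longrightarrow> a \<in> I m"
proof -
  assume "m \<le> n" "a \<in> I n"
  then obtain r where r: "r \<in> carrier R" "a = r \<otimes> \<pi> [^] n" by (auto simp: I_mem)
  have "\<pi> [^] n = \<pi> [^] (n - m) \<otimes> \<pi> [^] m" using \<open>m \<le> n\<close> by (simp add: nat_pow_mult)
  then have "a = (r \<otimes> \<pi> [^] (n - m)) \<otimes> \<pi> [^] m" using r by (simp add: m_assoc)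
  then show ?thesis using r by (auto simp only: I_mem intro!: bexI[of _ "r \<otimes> \<pi> [^] (n - m)"] m_closed nat_pow_closed gen_closed)
qed

lemma I_trans:
  "a \<in> carrier R \<Longrightarrow> b \<in> carrier R \<Longrightarrow> c \<in> carrier R \<Longrightarrow> a \<ominus> b \<in> I n \<Longrightarrow> b \<ominus> c \<in> I n \<Longrightarrow> a \<ominus> c \<in> I n"
proof -
  assume c: "a \<in> carrier R" "b \<in> carrier R" "c \<in> carrier R" and d: "a \<ominus> b \<in> I n" "b \<ominus> c \<in> I n"
  have "a \<ominus> c = (a \<ominus> b) \<oplus> (b \<ominus> c)" using c by algebra
  then show ?thesis using I_add[OF d] by simp
qed

lemma I_sym: "a \<in> carrier R \<Longrightarrow> b \<in> carrier R \<Longrightarrow> a \<ominus> b \<in> I n \<Longrightarrow> b \<ominus> a \<in> I n"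
proof -
  assume c: "a \<in> carrier R" "b \<in> carrier R" and d: "a \<ominus> b \<in> I n"
  have "b \<ominus> a = \<ominus> (a \<ominus> b)" using c by algebra
  then show ?thesis using I_minus[OF d] by simp
qed

lemma I_diff_mult:
  assumes "a \<in> carrier R" "a' \<in> carrier R" "b \<in> carrier R" "b' \<in> carrier R" "a \<ominus> a' \<in> I n" "b \<ominus> b' \<in> I n"
  shows "a \<otimes> b \<ominus> a' \<otimes> b' \<in> I n"
proof -
  have "a \<otimes> b \<ominus> a' \<otimes> b' = b \<otimes> (a \<ominus> a') \<oplus> a' \<otimes> (b \<ominus> b')" using assms(1-4) by algebra
  then show ?thesis using assms by (simp add: I_add I_mult)
qed

lemma gen_pow_nonzero: "\<pi> [^] (n::nat) \<noteq> \<zero>"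
  by (induction n) (auto simp: gen_nonzero integral_iff)

text \<open>The factor \<open>\<pi> [^] n\<close> is nonzero in a domain and can be cancelled.
  Dividing by it costs exactly n levels of precision.\<close>

lemma I_cancel:
  assumes "a \<in> carrier R" "\<pi> [^] n \<otimes> a \<in> I (n + k)"
  shows "a \<in> I k"
proof -
  obtain r where r: "r \<in> carrier R" "\<pi> [^] n \<otimes> a = r \<otimes> \<pi> [^] (n + k)" using assms(2) by (auto simp: I_mem)
  then have "\<pi> [^] n \<otimes> a = \<pi> [^] n \<otimes> (r \<otimes> \<pi> [^] k)" by (simp add: nat_pow_mult[symmetric] m_lcomm)
  then have "a = r \<otimes> \<pi> [^] k" using assms(1) r(1) by (simp add: m_lcancel gen_pow_nonzero)
  with r(1) show ?thesis unfolding I_mem by blast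
qed

lemma unit_iff: "a \<in> carrier R \<Longrightarrow> a \<in> Units R \<longleftrightarrow> a \<notin> I 1"
  using nonunits_principal by (auto simp: nonunits_def)

lemma coset_eq_iff:
  "a \<in> carrier R \<Longrightarrow> b \<in> carrier R \<Longrightarrow> I n +> a = I n +> b \<longleftrightarrow> a \<ominus> b \<in> I n"
  using quotient_eq_iff_same_a_r_cos[OF ideal_I] by blast

lemma adic_lim_eq_iff:
  "coherent x \<Longrightarrow> coherent y \<Longrightarrow> adic_lim x = adic_lim y \<longleftrightarrow> (\<forall>n. x n \<ominus> y n \<in> I n)"
  by (simp add: adic_lim_def fun_eq_iff coset_eq_iff coherent_def)

lemma coherentI: "(\<And>n. x n \<in> carrier R) \<Longrightarrow> (\<And>n. x (Suc n) \<ominus> x n \<in> I n) \<Longrightarrow> coherent x"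
  by (simp add: coherent_def)

lemma coherentD: "coherent x \<Longrightarrow> x n \<in> carrier R" "coherent x \<Longrightarrow> x (Suc n) \<ominus> x n \<in> I n"
  by (simp_all add: coherent_def)

lemma coherent_le:
  assumes "coherent x" "n \<le> m"
  shows "x m \<ominus> x n \<in> I n"
  using assms(2)
proof (induction m rule: dec_induct)
  case base
  show ?case by (rule I_refl[OF coherentD(1)[OF assms(1)]])
next
  case (step m)
  have "x (Suc m) \<ominus> x m \<in> I n" using coherentD(2)[OF assms(1), of m] I_mono step by blast
  then show ?case using I_trans step coherentD(1)[OF assms(1)] by blast
qed

text \<open>Choose a representative of every coset. Nestedness puts \<open>x (Suc n)\<close> into
  the coset of \<open>x n\<close>, which is precisely coherence; conversely, congruent
  representatives give nested cosets because the ideals decrease.\<close>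

lemma adic_completion_carrier: "carrier A = adic_lim ` Collect coherent"
proof (intro equalityI subsetI)
  fix s assume s: "s \<in> carrier A"
  then have "\<forall>n. \<exists>a\<in>carrier R. s n = I n +> a"
    unfolding adic_completion_def FactRing_def A_RCOSETS_def' ideal_power_nonunits by auto
  then obtain x where x: "\<And>n. x n \<in> carrier R" "\<And>n. s n = I n +> x n" by metis
  have sub: "s (Suc n) \<subseteq> s n" for n using s by (simp add: adic_completion_def)
  have "x (Suc n) \<ominus> x n \<in> I n" for n
  proof -
    have "x (Suc n) \<in> s (Suc n)" unfolding x(2) using abelian_subgroup.a_rcos_self[OF _ x(1)] ideal_I
      by (meson abelian_group_axioms abelian_subgroupI3 ideal.axioms(1))
    then have "x (Suc n) \<in> I n +> x n" using sub x(2) by blast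
    then obtain i where i: "i \<in> I n" "x (Suc n) = i \<oplus> x n" by (auto simp: a_r_coset_def')
    have "i \<in> carrier R" using i(1) by (rule I_carrier)
    then have "x (Suc n) \<ominus> x n = i" unfolding i(2) using x(1) by algebra
    with i(1) show ?thesis by simp
  qed
  then have "coherent x" using x(1) by (intro coherentI)
  moreover have "s = adic_lim x" using x(2) by (auto simp: adic_lim_def)
  ultimately show "s \<in> adic_lim ` Collect coherent" by blast
next
  fix s assume "s \<in> adic_lim ` Collect coherent"
  then obtain x where x: "coherent x" "s = adic_lim x" by blast
  have "I (Suc n) +> x (Suc n) \<subseteq> I n +> x n" for n
  proof -
    have "I n +> x (Suc n) = I n +> x n" using x(1) by (simp add: coset_eq_iff coherentD)
    moreover have "I (Suc n) +> x (Suc n) \<subseteq> I n +> x (Suc n)"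
      using I_mono[of n "Suc n"] by (auto simp: a_r_coset_def')
    ultimately show ?thesis by simp
  qed
  then show "s \<in> carrier A"
    using x coherentD(1)[OF x(1)]
    unfolding adic_completion_def FactRing_def A_RCOSETS_def' ideal_power_nonunits adic_lim_def by auto
qed

section \<open>Ring structure of the completion\<close>

lemma coherent_add: "coherent x \<Longrightarrow> coherent y \<Longrightarrow> coherent (\<lambda>n. x n \<oplus> y n)"
proof (rule coherentI)
  fix n assume c: "coherent x" "coherent y"
  note xy = coherentD[OF c(1)] coherentD[OF c(2)]
  show "x n \<oplus> y n \<in> carrier R" using xy by simp
  have "x (Suc n) \<oplus> y (Suc n) \<ominus> (x n \<oplus> y n) = (x (Suc n) \<ominus> x n) \<oplus> (y (Suc n) \<ominus> y n)"
    using xy(1)[of n] xy(1)[of "Suc n"] xy(3)[of n] xy(3)[of "Suc n"] by algebra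
  then show "x (Suc n) \<oplus> y (Suc n) \<ominus> (x n \<oplus> y n) \<in> I n"
    using xy(2,4)[of n] by (simp add: I_add)
qed

lemma coherent_mult: "coherent x \<Longrightarrow> coherent y \<Longrightarrow> coherent (\<lambda>n. x n \<otimes> y n)"
  by (intro coherentI I_diff_mult) (auto simp: coherentD)

lemma coherent_minus: "coherent x \<Longrightarrow> coherent (\<lambda>n. \<ominus> x n)"
proof (rule coherentI)
  fix n assume c: "coherent x"
  note x = coherentD[OF c]
  show "\<ominus> x n \<in> carrier R" using x by simp
  have "\<ominus> x (Suc n) \<ominus> (\<ominus> x n) = \<ominus> (x (Suc n) \<ominus> x n)"
    using x(1)[of n] x(1)[of "Suc n"] by algebra
  then show "\<ominus> x (Suc n) \<ominus> (\<ominus> x n) \<in> I n" using x(2) by (simp add: I_minus)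
qed

lemma coherent_const: "a \<in> carrier R \<Longrightarrow> coherent (\<lambda>n. a)"
  by (rule coherentI) (auto simp: I_refl)

lemma adic_mult:
  "coherent x \<Longrightarrow> coherent y \<Longrightarrow> adic_lim x \<otimes>\<^bsub>A\<^esub> adic_lim y = adic_lim (\<lambda>n. x n \<otimes> y n)"
  using ring_hom_mult[OF ideal.rcos_ring_hom[OF ideal_I]]
  by (simp add: adic_completion_def adic_lim_def ideal_power_nonunits coherentD)

lemma adic_add:
  "coherent x \<Longrightarrow> coherent y \<Longrightarrow> adic_lim x \<oplus>\<^bsub>A\<^esub> adic_lim y = adic_lim (\<lambda>n. x n \<oplus> y n)"
  using ring_hom_add[OF ideal.rcos_ring_hom[OF ideal_I]]
  by (simp add: adic_completion_def adic_lim_def ideal_power_nonunits coherentD)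

lemma adic_one: "\<one>\<^bsub>A\<^esub> = adic_lim (\<lambda>n. \<one>)"
  using ring_hom_one[OF ideal.rcos_ring_hom[OF ideal_I]]
  by (simp add: adic_completion_def adic_lim_def ideal_power_nonunits)

lemma adic_zero: "\<zero>\<^bsub>A\<^esub> = adic_lim (\<lambda>n. \<zero>)"
  using a_rcos_zero[OF ideal_I I_zero]
  by (simp add: adic_completion_def adic_lim_def ideal_power_nonunits FactRing_def)

lemma adic_closed: "coherent x \<Longrightarrow> adic_lim x \<in> carrier A"
  by (simp add: adic_completion_carrier)

lemma adicE:
  assumes "s \<in> carrier A" obtains x where "coherent x" "s = adic_lim x"
  using assms by (auto simp: adic_completion_carrier)

lemma adic_lim_cong: "(\<And>n. x n = y n) \<Longrightarrow> adic_lim x = adic_lim y"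
  by presburger

lemmas adic_rules = adic_mult adic_add adic_one adic_zero coherent_mult coherent_add coherent_const adic_closed

lemma cring_adic_completion: "cring A"
proof (rule cringI)
  show "abelian_group A"
  proof (rule abelian_groupI)
    fix s t assume "s \<in> carrier A" "t \<in> carrier A"
    then obtain x y where xy: "coherent x" "s = adic_lim x" "coherent y" "t = adic_lim y"
      by (auto elim!: adicE)
    show "s \<oplus>\<^bsub>A\<^esub> t \<in> carrier A" using xy by (simp add: adic_rules)
    show "s \<oplus>\<^bsub>A\<^esub> t = t \<oplus>\<^bsub>A\<^esub> s"
      using xy by (simp add: adic_rules) (intro adic_lim_cong a_comm coherentD)
    fix u assume "u \<in> carrier A"
    then obtain z where z: "coherent z" "u = adic_lim z" by (elim adicE)
    show "s \<oplus>\<^bsub>A\<^esub> t \<oplus>\<^bsub>A\<^esub> u = s \<oplus>\<^bsub>A\<^esub> (t \<oplus>\<^bsub>A\<^esub> u)"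
      using xy z by (simp add: adic_rules) (intro adic_lim_cong a_assoc coherentD)
  next
    show "\<zero>\<^bsub>A\<^esub> \<in> carrier A" by (simp add: adic_rules)
  next
    fix s assume "s \<in> carrier A"
    then obtain x where x: "coherent x" "s = adic_lim x" by (elim adicE)
    show "\<zero>\<^bsub>A\<^esub> \<oplus>\<^bsub>A\<^esub> s = s"
      using x by (simp add: adic_rules) (intro adic_lim_cong l_zero coherentD)
    have "adic_lim (\<lambda>n. \<ominus> x n) \<oplus>\<^bsub>A\<^esub> s = \<zero>\<^bsub>A\<^esub>"
      using x by (simp add: adic_rules coherent_minus) (intro adic_lim_cong l_neg coherentD)
    then show "\<exists>t\<in>carrier A. t \<oplus>\<^bsub>A\<^esub> s = \<zero>\<^bsub>A\<^esub>" using x by (blast intro: adic_closed coherent_minus)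
  qed
  show "Group.comm_monoid A"
  proof (rule comm_monoidI)
    fix s t assume "s \<in> carrier A" "t \<in> carrier A"
    then obtain x y where xy: "coherent x" "s = adic_lim x" "coherent y" "t = adic_lim y"
      by (auto elim!: adicE)
    show "s \<otimes>\<^bsub>A\<^esub> t \<in> carrier A" using xy by (simp add: adic_rules)
    show "s \<otimes>\<^bsub>A\<^esub> t = t \<otimes>\<^bsub>A\<^esub> s"
      using xy by (simp add: adic_rules) (intro adic_lim_cong m_comm coherentD)
    fix u assume "u \<in> carrier A"
    then obtain z where z: "coherent z" "u = adic_lim z" by (elim adicE)
    show "s \<otimes>\<^bsub>A\<^esub> t \<otimes>\<^bsub>A\<^esub> u = s \<otimes>\<^bsub>A\<^esub> (t \<otimes>\<^bsub>A\<^esub> u)"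
      using xy z by (simp add: adic_rules) (intro adic_lim_cong m_assoc coherentD)
  next
    show "\<one>\<^bsub>A\<^esub> \<in> carrier A" by (simp add: adic_rules)
  next
    fix s assume "s \<in> carrier A"
    then obtain x where x: "coherent x" "s = adic_lim x" by (elim adicE)
    show "\<one>\<^bsub>A\<^esub> \<otimes>\<^bsub>A\<^esub> s = s"
      using x by (simp add: adic_rules) (intro adic_lim_cong l_one coherentD)
  qed
next
  fix s t u assume "s \<in> carrier A" "t \<in> carrier A" "u \<in> carrier A"
  then obtain x y z where xyz: "coherent x" "s = adic_lim x" "coherent y" "t = adic_lim y"
    "coherent z" "u = adic_lim z" by (auto elim!: adicE)
  show "(s \<oplus>\<^bsub>A\<^esub> t) \<otimes>\<^bsub>A\<^esub> u = s \<otimes>\<^bsub>A\<^esub> u \<oplus>\<^bsub>A\<^esub> t \<otimes>\<^bsub>A\<^esub> u"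
    using xyz by (simp add: adic_rules) (intro adic_lim_cong l_distr coherentD)
qed

section \<open>The completion as a discrete valuation ring\<close>

definition adic_emb :: "'a \<Rightarrow> nat \<Rightarrow> 'a set" where
  "adic_emb a = adic_lim (\<lambda>n. a)"

lemma adic_emb_hom: "ring_hom_cring R A adic_emb"
  by (intro ring_hom_cringI is_cring cring_adic_completion ring_hom_memI)
    (auto simp: adic_emb_def adic_rules)

text \<open>The inverse is formed term by term; what must be checked is that the inverses are again
  coherent.\<close>

lemma unit_adic_lim:
  assumes "coherent x" "\<And>n. x n \<in> Units R"
  shows "adic_lim x \<in> Units A"
proof -
  define y where "y n = inv (x n)" for n
  have y: "y n \<in> carrier R" "y n \<otimes> x n = \<one>" "x n \<otimes> y n = \<one>" for n
    using assms(2) by (auto simp: y_def)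
  have "coherent y"
  proof (rule coherentI)
    fix n
    define xx xx' yy yy' where "xx = x n" and "xx' = x (Suc n)" and "yy = y n" and "yy' = y (Suc n)"
    have c: "xx \<in> carrier R" "xx' \<in> carrier R" "yy \<in> carrier R" "yy' \<in> carrier R"
      "yy \<otimes> xx = \<one>" "yy' \<otimes> xx' = \<one>"
      using y coherentD(1)[OF assms(1)] by (auto simp: xx_def xx'_def yy_def yy'_def)
    \<comment> \<open>The identity 1/x' - 1/x = (x - x')/(x x') transfers the congruence from the
      terms to their inverses.\<close>
    have "yy' \<ominus> yy = yy' \<otimes> (yy \<otimes> xx) \<ominus> (yy' \<otimes> xx') \<otimes> yy" using c by simp
    also have "\<dots> = (yy \<otimes> yy') \<otimes> (xx \<ominus> xx')" using c(1-4) by algebra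
    also have "xx \<ominus> xx' \<in> I n" unfolding xx_def xx'_def
      using coherentD[OF assms(1)] by (blast intro: I_sym)
    then have "(yy \<otimes> yy') \<otimes> (xx \<ominus> xx') \<in> I n" using c by (intro I_mult) auto
    finally show "y (Suc n) \<ominus> y n \<in> I n" by (simp add: yy_def yy'_def)
  qed (rule y)
  then have "adic_lim y \<in> carrier A" "adic_lim y \<otimes>\<^bsub>A\<^esub> adic_lim x = \<one>\<^bsub>A\<^esub>" "adic_lim x \<otimes>\<^bsub>A\<^esub> adic_lim y = \<one>\<^bsub>A\<^esub>"
    using assms(1) by (auto simp: adic_rules y)
  then show ?thesis using adic_closed[OF assms(1)] unfolding Units_def by blast
qed

text \<open>If \<open>x n\<close> were in the maximal ideal, an inverse modulo \<open>I n\<close>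
  would put 1 there as well. This fails to say anything at level 0, where the quotient is trivial,
  whence n > 0.\<close>

lemma adic_unit_coeff:
  assumes "coherent x" "adic_lim x \<in> Units A" "n > 0"
  shows "x n \<in> Units R"
proof -
  obtain t where t: "t \<in> carrier A" "t \<otimes>\<^bsub>A\<^esub> adic_lim x = \<one>\<^bsub>A\<^esub>" using assms(2) by (auto simp: Units_def)
  then obtain y where y: "coherent y" "t = adic_lim y" by (elim adicE)
  have "adic_lim (\<lambda>n. y n \<otimes> x n) = adic_lim (\<lambda>n. \<one>)" using t y assms(1) by (simp add: adic_rules)
  then have "y n \<otimes> x n \<ominus> \<one> \<in> I n"
    using y assms(1) by (subst (asm) adic_lim_eq_iff) (auto simp: adic_rules)
  then have d: "y n \<otimes> x n \<ominus> \<one> \<in> I 1" using assms(3) I_mono[of 1 n] by simp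
  show ?thesis
  proof (rule ccontr)
    note c = coherentD(1)[OF assms(1), of n] coherentD(1)[OF y(1), of n]
    assume "x n \<notin> Units R"
    then have "x n \<in> I 1" using unit_iff[OF c(1)] by simp
    then have "y n \<otimes> x n \<in> I 1" using c by (intro I_mult)
    from I_diff[OF this d] have diff: "y n \<otimes> x n \<ominus> (y n \<otimes> x n \<ominus> \<one>) \<in> I 1" .
    have "y n \<otimes> x n \<ominus> (y n \<otimes> x n \<ominus> \<one>) = \<one>" using c by algebra
    from diff[unfolded this] show False using unit_iff[of \<one>] by blast
  qed
qed

text \<open>If \<open>N\<close> is the first level at which the element is nonzero, all terms from
  \<open>x N\<close> on are divisible by \<open>\<pi> [^] (N - 1)\<close> but not by
  \<open>\<pi> [^] N\<close>. Dividing out leaves units, and these form the unit factor.\<close>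

lemma adic_factor:
  assumes "s \<in> carrier A" "s \<noteq> \<zero>\<^bsub>A\<^esub>"
  shows "\<exists>n. \<exists>u\<in>Units A. s = adic_emb \<pi> [^]\<^bsub>A\<^esub> (n::nat) \<otimes>\<^bsub>A\<^esub> u"
proof -
  interpret e: ring_hom_cring R A adic_emb by (rule adic_emb_hom)
  obtain x where x: "coherent x" "s = adic_lim x" using assms(1) by (elim adicE)
  note xR = coherentD(1)[OF x(1)]
  have "\<exists>n. x n \<notin> I n"
  proof (rule ccontr)
    assume "\<nexists>n. x n \<notin> I n"
    then have "adic_lim x = adic_lim (\<lambda>n. \<zero>)"
      using x xR by (subst adic_lim_eq_iff) (auto simp: coherent_const minus_eq)
    then show False using assms(2) x by (simp add: adic_zero)
  qed
  define N where "N = (LEAST n. x n \<notin> I n)"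
  have N: "x N \<notin> I N" "\<And>m. m < N \<Longrightarrow> x m \<in> I m"
    using LeastI_ex[OF \<open>\<exists>n. x n \<notin> I n\<close>] not_less_Least[of _ "\<lambda>n. x n \<notin> I n"] unfolding N_def by blast+
  have "N \<noteq> 0" using N(1) xR I_0 by metis
  \<comment> \<open>The order of the element is one less than the first nonzero level, because
    \<open>I 0\<close> is the whole ring.\<close>
  then obtain n where n: "N = Suc n" by (cases N) auto
  have "x (N + k) \<in> I n" "x (N + k) \<notin> I N" for k
  proof -
    have d: "x (N + k) \<ominus> x n \<in> I n" "x (N + k) \<ominus> x N \<in> I N"
      by (rule coherent_le[OF x(1)]; simp add: n)+
    have "x (N + k) = (x (N + k) \<ominus> x n) \<oplus> x n" using xR[of "N + k"] xR[of n] by algebra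
    then show "x (N + k) \<in> I n" using I_add[OF d(1) N(2)[of n]] n by simp
    have "x N = x (N + k) \<ominus> (x (N + k) \<ominus> x N)" using xR[of "N + k"] xR[of N] by algebra
    then show "x (N + k) \<notin> I N" using I_diff[OF _ d(2)] N(1) by metis
  qed
  note xN = this
  have "\<forall>k. \<exists>r\<in>carrier R. x (N + k) = \<pi> [^] n \<otimes> r"
    using xN(1) unfolding I_mem by (metis m_comm nat_pow_closed gen_closed)
  then obtain y where y: "\<And>k. y k \<in> carrier R" "\<And>k. x (N + k) = \<pi> [^] n \<otimes> y k" by metis
  have "y k \<in> Units R" for k
  proof (rule ccontr)
    assume "y k \<notin> Units R"
    then have "y k \<in> I 1" using unit_iff y(1) by blast
    then obtain r where "r \<in> carrier R" "y k = r \<otimes> \<pi> [^] (1::nat)" unfolding I_mem by blast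
    then have r: "r \<in> carrier R" "y k = r \<otimes> \<pi>" by auto
    have "x (N + k) = r \<otimes> \<pi> [^] N" using y(2)[of k] r by (simp add: n m_ac)
    then show False using xN(2)[of k] r(1) unfolding I_mem by blast
  qed
  \<comment> \<open>The quotients are taken from the sequence shifted by \<open>N\<close>: the
    division loses n levels of precision, and the shift makes up for them.\<close>
  moreover have coh: "coherent y"
  proof (rule coherentI)
    fix k
    have "\<pi> [^] n \<otimes> (y (Suc k) \<ominus> y k) = x (N + Suc k) \<ominus> x (N + k)"
      unfolding y(2) using y(1)[of k] y(1)[of "Suc k"] by (simp add: minus_eq r_distr r_minus)
    also have "\<dots> \<in> I (n + k)"
      using coherentD(2)[OF x(1), of "N + k"] I_mono[of "n + k" "N + k"] n by simp
    finally have m: "\<pi> [^] n \<otimes> (y (Suc k) \<ominus> y k) \<in> I (n + k)" .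
    show "y (Suc k) \<ominus> y k \<in> I k" by (rule I_cancel[OF _ m]) (use y(1) in simp)
  qed (rule y)
  ultimately have "adic_lim y \<in> Units A" by (rule unit_adic_lim[rotated])
  moreover have "s = adic_emb \<pi> [^]\<^bsub>A\<^esub> n \<otimes>\<^bsub>A\<^esub> adic_lim y"
  proof -
    have "adic_emb \<pi> [^]\<^bsub>A\<^esub> n \<otimes>\<^bsub>A\<^esub> adic_lim y = adic_emb (\<pi> [^] n) \<otimes>\<^bsub>A\<^esub> adic_lim y" by simp
    also have "\<dots> = adic_lim (\<lambda>k. \<pi> [^] n \<otimes> y k)" using coh by (simp add: adic_emb_def adic_rules)
    also have "\<dots> = adic_lim (\<lambda>k. x (N + k))" by (simp add: y(2))
    also have "\<dots> = s" unfolding x(2)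
    proof (subst adic_lim_eq_iff)
      show "coherent (\<lambda>k. x (N + k))"
      proof (rule coherentI)
        fix k show "x (N + Suc k) \<ominus> x (N + k) \<in> I k"
          using coherentD(2)[OF x(1), of "N + k"] I_mono[of k "N + k"] by simp
      qed (rule xR)
      show "\<forall>k. x (N + k) \<ominus> x k \<in> I k" using coherent_le[OF x(1)] by simp
    qed (rule x)
    finally show ?thesis ..
  qed
  ultimately show ?thesis by blast
qed

text \<open>Otherwise \<open>\<pi> [^] n\<close> would lie in \<open>I (n + 1)\<close>, and
  cancelling it would make 1 a nonunit. Together with \<open>adic_factor\<close> this shows that
  every nonzero element has a form whose products are again nonzero.\<close>

lemma adic_emb_gen_pow_unit:
  assumes "u \<in> Units A"
  shows "adic_emb \<pi> [^]\<^bsub>A\<^esub> (n::nat) \<otimes>\<^bsub>A\<^esub> u \<noteq> \<zero>\<^bsub>A\<^esub>"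
proof
  interpret e: ring_hom_cring R A adic_emb by (rule adic_emb_hom)
  assume z: "adic_emb \<pi> [^]\<^bsub>A\<^esub> n \<otimes>\<^bsub>A\<^esub> u = \<zero>\<^bsub>A\<^esub>"
  have "adic_emb \<pi> [^]\<^bsub>A\<^esub> n = adic_emb \<pi> [^]\<^bsub>A\<^esub> n \<otimes>\<^bsub>A\<^esub> u \<otimes>\<^bsub>A\<^esub> inv\<^bsub>A\<^esub> u"
    using assms by (simp add: e.S.m_assoc e.S.Units_closed)
  also have "\<dots> = \<zero>\<^bsub>A\<^esub>" unfolding z using assms by simp
  finally have "adic_emb (\<pi> [^] n) = \<zero>\<^bsub>A\<^esub>" by simp
  then have "\<forall>m. \<pi> [^] n \<ominus> \<zero> \<in> I m"
    unfolding adic_emb_def adic_zero by (subst (asm) adic_lim_eq_iff) (auto simp: coherent_const)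
  then have "\<pi> [^] n \<ominus> \<zero> \<in> I (n + 1)" by blast
  then have "\<pi> [^] n \<otimes> \<one> \<in> I (n + 1)" by (simp add: minus_eq)
  from I_cancel[OF one_closed this] have "\<one> \<in> I 1" .
  then show False using unit_iff[of \<one>] by blast
qed

lemma discrete_valuation_adic_completion: "discrete_valuation_domain A (adic_emb \<pi>)"
proof -
  interpret e: ring_hom_cring R A adic_emb by (rule adic_emb_hom)
  have one: "\<one>\<^bsub>A\<^esub> \<noteq> \<zero>\<^bsub>A\<^esub>" using adic_emb_gen_pow_unit[of "\<one>\<^bsub>A\<^esub>" 0] by simp
  have "domain A"
  proof (unfold_locales)
    show "\<one>\<^bsub>A\<^esub> \<noteq> \<zero>\<^bsub>A\<^esub>" by (rule one)
    fix s t assume st: "s \<otimes>\<^bsub>A\<^esub> t = \<zero>\<^bsub>A\<^esub>" "s \<in> carrier A" "t \<in> carrier A"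
    show "s = \<zero>\<^bsub>A\<^esub> \<or> t = \<zero>\<^bsub>A\<^esub>"
    proof (rule ccontr)
      assume "\<not> (s = \<zero>\<^bsub>A\<^esub> \<or> t = \<zero>\<^bsub>A\<^esub>)"
      then obtain n u m v where nm: "u \<in> Units A" "s = adic_emb \<pi> [^]\<^bsub>A\<^esub> (n::nat) \<otimes>\<^bsub>A\<^esub> u"
        "v \<in> Units A" "t = adic_emb \<pi> [^]\<^bsub>A\<^esub> (m::nat) \<otimes>\<^bsub>A\<^esub> v"
        using adic_factor st by metis
      have "s \<otimes>\<^bsub>A\<^esub> t = adic_emb \<pi> [^]\<^bsub>A\<^esub> (n + m) \<otimes>\<^bsub>A\<^esub> (u \<otimes>\<^bsub>A\<^esub> v)"
        using nm by (simp add: e.S.nat_pow_mult[symmetric] e.S.m_ac e.S.Units_closed del: e.hom_pow)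
      then show False using adic_emb_gen_pow_unit[of "u \<otimes>\<^bsub>A\<^esub> v" "n + m"] nm st(1) by simp
    qed
  qed
  then interpret A: "domain" A .
  show ?thesis
  proof unfold_locales
    show "adic_emb \<pi> \<in> carrier A" by simp
    show "adic_emb \<pi> \<notin> Units A"
    proof
      assume "adic_emb \<pi> \<in> Units A"
      then have "\<pi> \<in> Units R" unfolding adic_emb_def
        using adic_unit_coeff[of "\<lambda>n. \<pi>" 1] by (simp add: coherent_const)
      moreover have "\<pi> \<in> I 1" using cgenideal_self[OF gen_closed] by simp
      ultimately show False using unit_iff gen_closed by blast
    qed
    show "adic_emb \<pi> \<noteq> \<zero>\<^bsub>A\<^esub>" using adic_emb_gen_pow_unit[of "\<one>\<^bsub>A\<^esub>" 1] by simp
  qed (rule adic_factor)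
qed

text \<open>Newton iteration, as in the proof of Hensel's lemma.\<close>

lemma adic_root:
  assumes p: "p > 0" and pu: "add_pow R (p::nat) \<one> \<in> Units R"
    and res: "\<And>u. u \<in> Units R \<Longrightarrow> \<exists>w\<in>carrier R. w [^] p \<ominus> u \<in> I 1"
    and s: "s \<in> Units A"
  shows "\<exists>t\<in>carrier A. t [^]\<^bsub>A\<^esub> p = s"
proof -
  interpret cA: cring A by (rule cring_adic_completion)
  obtain x where x: "coherent x" "s = adic_lim x" using s by (auto elim: adicE)
  note xR = coherentD(1)[OF x(1)]
  have xU: "x (Suc n) \<in> Units R" for n using adic_unit_coeff x s by blast
  obtain m where m: "p = Suc m" using p by (cases p) auto
  \<comment> \<open>The index is shifted by one: \<open>w n\<close> is a root modulo
    \<open>I (Suc n)\<close>. Level 0 is empty, and the residue hypothesis starts the iteration at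
    level 1.\<close>
  have "\<exists>w. \<forall>n. (w n \<in> carrier R \<and> w n [^] p \<ominus> x (Suc n) \<in> I (Suc n)) \<and> w (Suc n) \<ominus> w n \<in> I (Suc n)"
  proof (rule dependent_nat_choice)
    show "\<exists>w. w \<in> carrier R \<and> w [^] p \<ominus> x (Suc 0) \<in> I (Suc 0)" using res[OF xU[of 0]] unfolding One_nat_def by blast
  next
    fix w n assume w: "w \<in> carrier R \<and> w [^] p \<ominus> x (Suc n) \<in> I (Suc n)"
    have wp: "w [^] p \<in> carrier R" using w by simp
    \<comment> \<open>The p-th power of \<open>w\<close> agrees with a unit modulo the maximal
      ideal. Hence the derivative p w^(p-1) is invertible and the Newton step can be formed.\<close>
    have "w \<in> Units R"
    proof (rule ccontr)
      assume "w \<notin> Units R"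
      then have "w \<in> I 1" using unit_iff w by blast
      then have "w [^] m \<otimes> w \<in> I 1" using w by (intro I_mult) auto
      then have "w [^] p \<in> I 1" by (simp add: m)
      moreover have "w [^] p \<ominus> x (Suc n) \<in> I 1" by (rule I_mono[of 1 "Suc n"], simp, rule conjunct2[OF w])
      ultimately have "w [^] p \<ominus> (w [^] p \<ominus> x (Suc n)) \<in> I 1" by (rule I_diff)
      moreover have "w [^] p \<ominus> (w [^] p \<ominus> x (Suc n)) = x (Suc n)" using wp xR[of "Suc n"] by algebra
      ultimately show False using unit_iff xU xR by metis
    qed
    define P v where "P = add_pow R p \<one>" and "v = w [^] m"
    have Pv: "P \<otimes> v \<in> Units R" unfolding P_def v_def
      using pu \<open>w \<in> Units R\<close> by (intro Units_m_closed Units_pow_closed)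
    have Pvc: "P \<in> carrier R" "v \<in> carrier R" using w by (auto simp: P_def v_def)
    have "x (Suc n) \<ominus> x (Suc (Suc n)) \<in> I (Suc n)"
      using coherentD(2)[OF x(1), of "Suc n"] xR I_sym by blast
    then have "w [^] p \<ominus> x (Suc (Suc n)) \<in> I (Suc n)" using w wp xR I_trans by blast
    then obtain e where e: "e \<in> carrier R" "w [^] p \<ominus> x (Suc (Suc n)) = e \<otimes> \<pi> [^] Suc n"
      unfolding I_mem by blast
    define V pn where "V = inv (P \<otimes> v)" and "pn = \<pi> [^] Suc n"
    have V: "V \<in> carrier R" "P \<otimes> v \<otimes> V = \<one>" "pn \<in> carrier R" using Pv by (auto simp: V_def pn_def)
    \<comment> \<open>The Newton correction -f(w)/f'(w) for f = X^p -
      \<open>x (Suc (Suc n))\<close>. It cancels the linear term of the expansion, so only the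
      multiple of h squared remains.\<close>
    define h where "h = \<ominus> (V \<otimes> e \<otimes> pn)"
    have hR: "h \<in> carrier R" using V e by (simp add: h_def)
    have "V \<otimes> e \<in> carrier R" using V e by simp
    then have hI: "h \<in> I (Suc n)" unfolding h_def pn_def by (intro I_minus) (unfold I_mem, blast)
    have "P \<otimes> v \<otimes> h = \<ominus> ((P \<otimes> v \<otimes> V) \<otimes> (e \<otimes> pn))"
      unfolding h_def using V(1,3) e(1) Pvc by algebra
    also have "\<dots> = \<ominus> (w [^] p \<ominus> x (Suc (Suc n)))"
      using V(1,3) e(1) unfolding V(2) e(2) pn_def by simp
    finally have Ph: "P \<otimes> v \<otimes> h = \<ominus> (w [^] p \<ominus> x (Suc (Suc n)))" .
    obtain q where q: "q \<in> carrier R" "(w \<oplus> h) [^] p = w [^] p \<oplus> P \<otimes> v \<otimes> h \<oplus> h \<otimes> h \<otimes> q"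
      using binomial_expansion_first_order[of w h m] w hR unfolding m P_def v_def by blast
    have "h \<otimes> h \<otimes> q \<in> I (Suc (Suc n))"
    proof -
      obtain r where r: "r \<in> carrier R" "h = r \<otimes> \<pi> [^] Suc n" using hI unfolding I_mem by blast
      \<comment> \<open>The square of an element of \<open>I (Suc n)\<close> carries exponent 2n +
        2, which is at least the required n + 2.\<close>
      have "h \<otimes> h \<otimes> q = (r \<otimes> r \<otimes> q \<otimes> \<pi> [^] n) \<otimes> \<pi> [^] Suc (Suc n)"
        unfolding r(2) using r(1) q(1) by (simp add: m_ac)
      then show ?thesis using r(1) q(1) unfolding I_mem by blast
    qed
    moreover have "(w \<oplus> h) [^] p \<ominus> x (Suc (Suc n)) = h \<otimes> h \<otimes> q"
    proof -
      have c: "h \<otimes> h \<otimes> q \<in> carrier R" "x (Suc (Suc n)) \<in> carrier R" using hR q xR by auto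
      show ?thesis unfolding q(2) Ph using wp c by algebra
    qed
    moreover have "w \<oplus> h \<ominus> w = h" using w hR by algebra
    ultimately show "\<exists>w'. (w' \<in> carrier R \<and> w' [^] p \<ominus> x (Suc (Suc n)) \<in> I (Suc (Suc n))) \<and> w' \<ominus> w \<in> I (Suc n)"
      using w hR hI by (intro exI[of _ "w \<oplus> h"]) auto
  qed
  then obtain w where w: "\<And>n. w n \<in> carrier R" "\<And>n. w n [^] p \<ominus> x (Suc n) \<in> I (Suc n)"
    "\<And>n. w (Suc n) \<ominus> w n \<in> I (Suc n)" by blast
  have coh: "coherent w" 
    by (rule coherentI, rule w(1), rule I_mono[OF le_SucI[OF order_refl] w(3)])
  have pow: "adic_lim w [^]\<^bsub>A\<^esub> k = adic_lim (\<lambda>n. w n [^] k) \<and> coherent (\<lambda>n. w n [^] k)" for k :: nat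
    by (induction k) (use coh in \<open>auto simp: adic_rules\<close>)
  have "adic_lim (\<lambda>n. w n [^] p) = adic_lim x"
  proof (subst adic_lim_eq_iff)
    show "\<forall>n. w n [^] p \<ominus> x n \<in> I n"
    proof
      fix n
      have "w n [^] p \<ominus> x (Suc n) \<in> I n" by (rule I_mono[OF le_SucI[OF order_refl] w(2)])
      then show "w n [^] p \<ominus> x n \<in> I n"
        using I_trans[OF _ _ _ _ coherentD(2)[OF x(1), of n]] w(1) xR by simp
    qed
  qed (use pow x in auto)
  then show ?thesis using pow x(2) adic_closed[OF coh] by metis
qed

end

section \<open>Power bases\<close>

text \<open>The basis clause of \<open>primitive_element\<close>, stated for any algebra so that
  \<open>\<alpha>\<close> and the adjoined root, over the adeles or over a place field, can be
  treated alike. Extensional coefficient families make uniqueness meaningful outside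
  \<open>{..<p}\<close>.\<close>

definition power_basis ::
  "('a, 'm) ring_scheme \<Rightarrow> ('b, 'l) ring_scheme \<Rightarrow> ('a \<Rightarrow> 'b) \<Rightarrow> nat \<Rightarrow> 'b \<Rightarrow> bool" where
  "power_basis R E \<iota> p x \<longleftrightarrow> x \<in> carrier E \<and>
     (\<forall>\<beta>\<in>carrier E. \<exists>!a. a \<in> {..<p} \<rightarrow>\<^sub>E carrier R \<and>
        \<beta> = (\<Oplus>\<^bsub>E\<^esub>i\<in>{..<p}. \<iota> (a i) \<otimes>\<^bsub>E\<^esub> x [^]\<^bsub>E\<^esub> i))"

context ring_hom_cring
begin

abbreviation lin_comb :: "nat \<Rightarrow> 'c \<Rightarrow> (nat \<Rightarrow> 'a) \<Rightarrow> 'c" where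
  "lin_comb p x a \<equiv> (\<Oplus>\<^bsub>S\<^esub>i\<in>{..<p}. h (a i) \<otimes>\<^bsub>S\<^esub> x [^]\<^bsub>S\<^esub> i)"

lemma lin_comb_closed: "x \<in> carrier S \<Longrightarrow> a \<in> {..<p} \<rightarrow> carrier R \<Longrightarrow> lin_comb p x a \<in> carrier S"
  by (auto intro!: S.finsum_closed)

lemma lin_comb_cong:
  assumes "x \<in> carrier S" "b \<in> {..<p} \<rightarrow> carrier R" "\<And>i. i < p \<Longrightarrow> a i = b i"
  shows "lin_comb p x a = lin_comb p x b"
  using assms by (intro S.finsum_cong') auto

lemma power_basis_closed: "power_basis R S h p x \<Longrightarrow> x \<in> carrier S"
  by (simp add: power_basis_def)

lemma power_basis_gen:
  assumes "power_basis R S h p x" "\<beta> \<in> carrier S"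
  obtains a where "a \<in> {..<p} \<rightarrow> carrier R" "\<beta> = lin_comb p x a"
proof -
  have "\<exists>!a. a \<in> {..<p} \<rightarrow>\<^sub>E carrier R \<and> \<beta> = lin_comb p x a"
    using assms by (simp add: power_basis_def)
  then obtain a where "a \<in> {..<p} \<rightarrow>\<^sub>E carrier R" "\<beta> = lin_comb p x a" by blast
  then show thesis by (intro that[of a]) auto
qed

lemma power_basis_indep:
  assumes "power_basis R S h p x" "a \<in> {..<p} \<rightarrow> carrier R" "b \<in> {..<p} \<rightarrow> carrier R"
    and "lin_comb p x a = lin_comb p x b" "i < p"
  shows "a i = b i"
proof -
  have x: "x \<in> carrier S" using assms(1) by (rule power_basis_closed)
  define a' b' where "a' = restrict a {..<p}" and "b' = restrict b {..<p}"
  have "a' \<in> {..<p} \<rightarrow>\<^sub>E carrier R" "b' \<in> {..<p} \<rightarrow>\<^sub>E carrier R"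
    using assms(2,3) by (auto simp: a'_def b'_def)
  moreover have "lin_comb p x a' = lin_comb p x a" "lin_comb p x b' = lin_comb p x b"
    using assms(2,3) x by (auto simp: a'_def b'_def intro!: lin_comb_cong)
  moreover have "\<exists>!c. c \<in> {..<p} \<rightarrow>\<^sub>E carrier R \<and> lin_comb p x a = lin_comb p x c"
    using assms(1) lin_comb_closed[OF x assms(2)] by (simp add: power_basis_def)
  ultimately have "a' = b'" using assms(4) by (metis (no_types, lifting))
  then show ?thesis using assms(5) by (auto simp: a'_def b'_def fun_eq_iff split: if_splits dest!: fun_cong[of _ _ i])
qed

lemma power_basisI:
  assumes x: "x \<in> carrier S"
    and gen: "\<And>\<beta>. \<beta> \<in> carrier S \<Longrightarrow> \<exists>a\<in>{..<p} \<rightarrow> carrier R. \<beta> = lin_comb p x a"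
    and indep: "\<And>a b i. a \<in> {..<p} \<rightarrow> carrier R \<Longrightarrow> b \<in> {..<p} \<rightarrow> carrier R \<Longrightarrow>
      lin_comb p x a = lin_comb p x b \<Longrightarrow> i < p \<Longrightarrow> a i = b i"
  shows "power_basis R S h p x"
  unfolding power_basis_def
proof (intro conjI ballI)
  fix \<beta> assume "\<beta> \<in> carrier S"
  then obtain a where a: "a \<in> {..<p} \<rightarrow> carrier R" "\<beta> = lin_comb p x a" using gen by blast
  show "\<exists>!a. a \<in> {..<p} \<rightarrow>\<^sub>E carrier R \<and> \<beta> = lin_comb p x a"
  proof (rule ex1I[of _ "restrict a {..<p}"])
    show "restrict a {..<p} \<in> {..<p} \<rightarrow>\<^sub>E carrier R \<and> \<beta> = lin_comb p x (restrict a {..<p})"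
      using a x by (auto intro!: lin_comb_cong[symmetric])
  next
    fix b assume b: "b \<in> {..<p} \<rightarrow>\<^sub>E carrier R \<and> \<beta> = lin_comb p x b"
    then have "b i = a i" if "i < p" for i using indep[of b a i] a that by (auto simp: PiE_def)
    then show "b = restrict a {..<p}" using b by (auto simp: PiE_def extensional_def fun_eq_iff)
  qed
qed (rule x)

section \<open>Eigenvectors and evaluation at points\<close>

lemma lin_comb_smult:
  assumes "x \<in> carrier S" "a \<in> {..<p} \<rightarrow> carrier R" "c \<in> carrier R"
  shows "h c \<otimes>\<^bsub>S\<^esub> lin_comb p x a = lin_comb p x (\<lambda>i. c \<otimes> a i)"
proof -
  have "h c \<otimes>\<^bsub>S\<^esub> lin_comb p x a = (\<Oplus>\<^bsub>S\<^esub>i\<in>{..<p}. h c \<otimes>\<^bsub>S\<^esub> (h (a i) \<otimes>\<^bsub>S\<^esub> x [^]\<^bsub>S\<^esub> i))"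
    using assms by (intro S.finsum_rdistr) auto
  also have "\<dots> = lin_comb p x (\<lambda>i. c \<otimes> a i)"
    using assms by (intro S.finsum_cong') (auto simp: Pi_iff S.m_assoc)
  finally show ?thesis .
qed

lemma lin_comb_single:
  assumes "x \<in> carrier S" "c \<in> carrier R" "j < p"
  shows "lin_comb p x (\<lambda>i. if i = j then c else \<zero>) = h c \<otimes>\<^bsub>S\<^esub> x [^]\<^bsub>S\<^esub> j"
proof -
  have "lin_comb p x (\<lambda>i. if i = j then c else \<zero>) =
    (\<Oplus>\<^bsub>S\<^esub>i\<in>{..<p}. if j = i then h c \<otimes>\<^bsub>S\<^esub> x [^]\<^bsub>S\<^esub> i else \<zero>\<^bsub>S\<^esub>)"
    using assms by (intro S.finsum_cong') auto
  also have "\<dots> = h c \<otimes>\<^bsub>S\<^esub> x [^]\<^bsub>S\<^esub> j"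
    using assms by (intro S.finsum_singleton) auto
  finally show ?thesis .
qed

lemma power_basis_inj:
  assumes "power_basis R S h p x" "p > 0" "a \<in> carrier R" "b \<in> carrier R" "h a = h b"
  shows "a = b"
proof -
  have x: "x \<in> carrier S" using assms(1) by (rule power_basis_closed)
  have "lin_comb p x (\<lambda>i. if i = 0 then a else \<zero>) = lin_comb p x (\<lambda>i. if i = 0 then b else \<zero>)"
    using assms x by (simp add: lin_comb_single del: S.nat_pow_0)
  from power_basis_indep[OF assms(1) _ _ this, of 0] show ?thesis using assms by auto
qed

text \<open>Compare the coefficients at \<open>j\<close>: on one side it is \<open>a\<close> itself,
  on the other a multiple of \<open>d\<close>. With d = 0 this says that \<open>e\<close> has no
  annihilator in R; with general d it is independence modulo \<open>d\<close>.\<close>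

lemma power_basis_dvd:
  assumes "power_basis R S h p x" "e = lin_comb p x b" "b \<in> {..<p} \<rightarrow> carrier R" "j < p" "b j = \<one>"
    and "a \<in> carrier R" "d \<in> carrier R" "h a \<otimes>\<^bsub>S\<^esub> e \<in> PIdl\<^bsub>S\<^esub> (h d)"
  shows "a \<in> PIdl d"
proof -
  have x: "x \<in> carrier S" using assms(1) by (rule power_basis_closed)
  obtain \<gamma> where \<gamma>: "\<gamma> \<in> carrier S" "h a \<otimes>\<^bsub>S\<^esub> e = \<gamma> \<otimes>\<^bsub>S\<^esub> h d"
    using assms(8) by (auto simp: cgenideal_def)
  obtain g where g: "g \<in> {..<p} \<rightarrow> carrier R" "\<gamma> = lin_comb p x g"
    using power_basis_gen[OF assms(1) \<gamma>(1)] by blast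
  have "lin_comb p x (\<lambda>i. a \<otimes> b i) = lin_comb p x (\<lambda>i. d \<otimes> g i)"
    using \<gamma> g assms(2,3,6,7) x by (simp add: lin_comb_smult[symmetric] S.m_comm)
  then have "a \<otimes> b j = d \<otimes> g j"
    using assms g by (intro power_basis_indep[OF assms(1)]) auto
  then have "a = g j \<otimes> d" "g j \<in> carrier R" using assms g by (auto simp: R.m_comm Pi_iff)
  then show ?thesis by (auto simp: cgenideal_def)
qed

lemma eigen_pow:
  assumes "u \<in> carrier S" "w \<in> carrier S" "e \<in> carrier S" "u \<otimes>\<^bsub>S\<^esub> e = w \<otimes>\<^bsub>S\<^esub> e"
  shows "u [^]\<^bsub>S\<^esub> (n::nat) \<otimes>\<^bsub>S\<^esub> e = w [^]\<^bsub>S\<^esub> n \<otimes>\<^bsub>S\<^esub> e"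
proof (induction n)
  case (Suc n)
  have "u [^]\<^bsub>S\<^esub> Suc n \<otimes>\<^bsub>S\<^esub> e = u [^]\<^bsub>S\<^esub> n \<otimes>\<^bsub>S\<^esub> (u \<otimes>\<^bsub>S\<^esub> e)"
    using assms(1-3) by (simp add: S.m_assoc)
  also have "\<dots> = w \<otimes>\<^bsub>S\<^esub> (u [^]\<^bsub>S\<^esub> n \<otimes>\<^bsub>S\<^esub> e)"
    unfolding assms(4) using assms(1-3) by (simp add: S.m_lcomm)
  also have "\<dots> = w [^]\<^bsub>S\<^esub> Suc n \<otimes>\<^bsub>S\<^esub> e"
    unfolding Suc using assms(1-3) by (simp add: S.m_ac)
  finally show ?case .
qed (use assms in simp)

text \<open>On an eigenvector of \<open>x\<close> every polynomial in \<open>x\<close> acts by its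
  value at the eigenvalue \<open>c\<close>. So \<open>e\<close> represents the point x = c of the
  algebra.\<close>

lemma lin_comb_eigen:
  assumes "x \<in> carrier S" "e \<in> carrier S" "c \<in> carrier R" "x \<otimes>\<^bsub>S\<^esub> e = h c \<otimes>\<^bsub>S\<^esub> e"
    and "a \<in> {..<p} \<rightarrow> carrier R"
  shows "\<exists>\<kappa>\<in>carrier R. lin_comb p x a \<otimes>\<^bsub>S\<^esub> e = h \<kappa> \<otimes>\<^bsub>S\<^esub> e"
proof -
  have pow: "x [^]\<^bsub>S\<^esub> i \<otimes>\<^bsub>S\<^esub> e = h (c [^] i) \<otimes>\<^bsub>S\<^esub> e" for i :: nat
    using eigen_pow[of x "h c" e i] assms by simp
  have "lin_comb p x a \<otimes>\<^bsub>S\<^esub> e = (\<Oplus>\<^bsub>S\<^esub>i\<in>{..<p}. h (a i) \<otimes>\<^bsub>S\<^esub> x [^]\<^bsub>S\<^esub> i \<otimes>\<^bsub>S\<^esub> e)"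
    using assms by (intro S.finsum_ldistr) auto
  also have "\<dots> = (\<Oplus>\<^bsub>S\<^esub>i\<in>{..<p}. h (a i \<otimes> c [^] i) \<otimes>\<^bsub>S\<^esub> e)"
    using assms by (intro S.finsum_cong') (auto simp: Pi_iff S.m_assoc pow simp del: hom_pow)
  also have "\<dots> = (\<Oplus>\<^bsub>S\<^esub>i\<in>{..<p}. h (a i \<otimes> c [^] i)) \<otimes>\<^bsub>S\<^esub> e"
    using assms by (intro S.finsum_ldistr[symmetric]) auto
  also have "(\<Oplus>\<^bsub>S\<^esub>i\<in>{..<p}. h (a i \<otimes> c [^] i)) = h (\<Oplus>i\<in>{..<p}. a i \<otimes> c [^] i)"
    using assms by (subst hom_finsum) (auto simp: comp_def Pi_iff)
  finally have "lin_comb p x a \<otimes>\<^bsub>S\<^esub> e = h (\<Oplus>i\<in>{..<p}. a i \<otimes> c [^] i) \<otimes>\<^bsub>S\<^esub> e" .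
  moreover have "(\<Oplus>i\<in>{..<p}. a i \<otimes> c [^] i) \<in> carrier R"
    using assms by (intro R.finsum_closed) auto
  ultimately show ?thesis by blast
qed

text \<open>
  The linear combination is \<open>(x\<^sup>n - c\<^sup>n) / (x - c)\<close>; it is an eigenvector of \<open>x\<close> for the
  eigenvalue \<open>c\<close> as soon as \<open>x\<^sup>n = c\<^sup>n\<close>.
\<close>

lemma lin_comb_eigen_vector:
  assumes x: "x \<in> carrier S" and c: "c \<in> carrier R"
  shows "x \<otimes>\<^bsub>S\<^esub> lin_comb n x (\<lambda>i. c [^] (n - Suc i)) \<oplus>\<^bsub>S\<^esub> h (c [^] n) =
    h c \<otimes>\<^bsub>S\<^esub> lin_comb n x (\<lambda>i. c [^] (n - Suc i)) \<oplus>\<^bsub>S\<^esub> x [^]\<^bsub>S\<^esub> n"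
proof (induction n)
  case 0
  show ?case using assms by simp
next
  case (Suc n)
  define e where "e m = lin_comb m x (\<lambda>i. c [^] (m - Suc i))" for m
  have e_closed: "e m \<in> carrier S" for m
    unfolding e_def using assms by (intro lin_comb_closed) auto
  \<comment> \<open>The recursion for the quotient (x^n - c^n)/(x - c): passing to n + 1 multiplies
    by c and adds the new top power of x.\<close>
  have e_Suc: "e (Suc n) = h c \<otimes>\<^bsub>S\<^esub> e n \<oplus>\<^bsub>S\<^esub> x [^]\<^bsub>S\<^esub> n"
  proof -
    have "h c \<otimes>\<^bsub>S\<^esub> e n = lin_comb n x (\<lambda>i. c \<otimes> c [^] (n - Suc i))"
      unfolding e_def using assms by (intro lin_comb_smult) auto
    also have "\<dots> = lin_comb n x (\<lambda>i. c [^] (Suc n - Suc i))"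
    proof (rule lin_comb_cong)
      fix i assume "i < n"
      then have "Suc n - Suc i = Suc (n - Suc i)" by simp
      then show "c \<otimes> c [^] (n - Suc i) = c [^] (Suc n - Suc i)"
        using assms by (simp add: R.m_comm)
    qed (use assms in auto)
    finally have ce: "h c \<otimes>\<^bsub>S\<^esub> e n = lin_comb n x (\<lambda>i. c [^] (Suc n - Suc i))" .
    show ?thesis unfolding ce unfolding e_def lessThan_Suc
      using assms by (subst S.finsum_insert) (auto simp: S.a_comm S.finsum_closed)
  qed
  have IH: "x \<otimes>\<^bsub>S\<^esub> e n \<oplus>\<^bsub>S\<^esub> h (c [^] n) = h c \<otimes>\<^bsub>S\<^esub> e n \<oplus>\<^bsub>S\<^esub> x [^]\<^bsub>S\<^esub> n"
    using Suc by (simp add: e_def)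
  have "x \<otimes>\<^bsub>S\<^esub> e (Suc n) \<oplus>\<^bsub>S\<^esub> h (c [^] Suc n) =
    h c \<otimes>\<^bsub>S\<^esub> (x \<otimes>\<^bsub>S\<^esub> e n \<oplus>\<^bsub>S\<^esub> h (c [^] n)) \<oplus>\<^bsub>S\<^esub> x [^]\<^bsub>S\<^esub> Suc n"
    unfolding e_Suc using assms e_closed by (simp add: S.r_distr S.m_ac S.a_ac del: hom_pow)
  also have "\<dots> = h c \<otimes>\<^bsub>S\<^esub> e (Suc n) \<oplus>\<^bsub>S\<^esub> x [^]\<^bsub>S\<^esub> Suc n"
    unfolding IH e_Suc ..
  finally show ?case by (simp add: e_def)
qed

text \<open>All terms except the constant one contain a factor \<open>x\<close>. With a nilpotent
  \<open>x\<close> this exhibits the constant coefficient as the value at the point x = 0.\<close>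

lemma lin_comb_split:
  assumes "x \<in> carrier S" "a \<in> {..<p} \<rightarrow> carrier R" "p > 0"
  shows "\<exists>y\<in>carrier S. lin_comb p x a = h (a 0) \<oplus>\<^bsub>S\<^esub> x \<otimes>\<^bsub>S\<^esub> y"
proof -
  obtain n where p: "p = Suc n" using assms(3) by (cases p) auto
  have "{..<p} = insert 0 (Suc ` {..<n})" by (simp add: p lessThan_Suc_eq_insert_0)
  then have "lin_comb p x a = h (a 0) \<oplus>\<^bsub>S\<^esub> (\<Oplus>\<^bsub>S\<^esub>i\<in>Suc ` {..<n}. h (a i) \<otimes>\<^bsub>S\<^esub> x [^]\<^bsub>S\<^esub> i)"
    using assms by (simp add: Pi_iff)
  also have "(\<Oplus>\<^bsub>S\<^esub>i\<in>Suc ` {..<n}. h (a i) \<otimes>\<^bsub>S\<^esub> x [^]\<^bsub>S\<^esub> i) =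
    (\<Oplus>\<^bsub>S\<^esub>i\<in>{..<n}. h (a (Suc i)) \<otimes>\<^bsub>S\<^esub> x [^]\<^bsub>S\<^esub> Suc i)"
    using assms p by (intro S.finsum_reindex) auto
  also have "\<dots> = (\<Oplus>\<^bsub>S\<^esub>i\<in>{..<n}. x \<otimes>\<^bsub>S\<^esub> (h (a (Suc i)) \<otimes>\<^bsub>S\<^esub> x [^]\<^bsub>S\<^esub> i))"
    using assms p by (intro S.finsum_cong') (auto simp: Pi_iff S.m_ac)
  also have "\<dots> = x \<otimes>\<^bsub>S\<^esub> lin_comb n x (\<lambda>i. a (Suc i))"
    using assms p by (intro S.finsum_rdistr[symmetric]) auto
  finally show ?thesis
    using assms p by (intro bexI[of _ "lin_comb n x (\<lambda>i. a (Suc i))"] lin_comb_closed) auto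
qed

lemma root_eigen_vector:
  assumes x: "x \<in> carrier S" and c: "c \<in> carrier R" and root: "x [^]\<^bsub>S\<^esub> p = h (c [^] p)"
  defines "e \<equiv> lin_comb p x (\<lambda>i. c [^] (p - Suc i))"
  shows "e \<in> carrier S" "x \<otimes>\<^bsub>S\<^esub> e = h c \<otimes>\<^bsub>S\<^esub> e"
proof -
  show e: "e \<in> carrier S" unfolding e_def using x c by (intro lin_comb_closed) auto
  show "x \<otimes>\<^bsub>S\<^esub> e = h c \<otimes>\<^bsub>S\<^esub> e"
    using lin_comb_eigen_vector[OF x c, of p] x c e unfolding e_def[symmetric] root
    by (simp add: S.add.right_cancel)
qed

text \<open>The vector \<open>e\<close> is the point x = c. There \<open>y\<close> acts by a scalar
  \<open>\<kappa>\<close> of R, so \<open>y\<close> to the p acts both by \<open>s\<close> and by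
  the p-th power of \<open>\<kappa>\<close>; since \<open>e\<close> has no annihilator in R, the two
  scalars agree.\<close>

lemma power_basis_root:
  assumes x: "power_basis R S h p x" "p > 0" and c: "c \<in> carrier R" "x [^]\<^bsub>S\<^esub> p = h (c [^] p)"
    and y: "y \<in> carrier S" "y [^]\<^bsub>S\<^esub> p = h s" and s: "s \<in> carrier R"
  shows "\<exists>\<kappa>\<in>carrier R. s = \<kappa> [^] p"
proof -
  have xS: "x \<in> carrier S" using x(1) by (rule power_basis_closed)
  define e where "e = lin_comb p x (\<lambda>i. c [^] (p - Suc i))"
  note e = root_eigen_vector[OF xS c, folded e_def]
  obtain a where a: "a \<in> {..<p} \<rightarrow> carrier R" "y = lin_comb p x a" using power_basis_gen[OF x(1) y(1)] .
  obtain \<kappa> where \<kappa>: "\<kappa> \<in> carrier R" "y \<otimes>\<^bsub>S\<^esub> e = h \<kappa> \<otimes>\<^bsub>S\<^esub> e"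
    using lin_comb_eigen[OF xS e(1) c(1) e(2) a(1)] a(2) by auto
  have "h s \<otimes>\<^bsub>S\<^esub> e = h (\<kappa> [^] p) \<otimes>\<^bsub>S\<^esub> e"
    using eigen_pow[OF y(1) _ e(1) \<kappa>(2), of p] \<kappa>(1) by (simp add: y(2))
  then have "h (s \<ominus> \<kappa> [^] p) \<otimes>\<^bsub>S\<^esub> e = \<zero>\<^bsub>S\<^esub>"
    using s \<kappa>(1) e(1) by (simp add: R.minus_eq S.l_distr S.l_minus S.r_neg)
  \<comment> \<open>The coefficient of the top power p - 1 in \<open>e\<close> is c to the power 0,
    that is 1.\<close>
  then have "s \<ominus> \<kappa> [^] p \<in> PIdl \<zero>"
    using x(2) c(1) s \<kappa>(1)
    by (intro power_basis_dvd[OF x(1) e_def, of "p - 1"]) (auto simp: cgenideal_def intro: exI[of _ "\<zero>\<^bsub>S\<^esub>"])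
  then have "s \<ominus> \<kappa> [^] p = \<zero>" by (auto simp: cgenideal_def)
  then have "s = \<kappa> [^] p" using s \<kappa>(1) by (simp add: R.r_right_minus_eq)
  with \<kappa>(1) show ?thesis by blast
qed

text \<open>An algebra that is unramified via \<open>x\<close> has no nilpotent generator \<open>y\<close>: the two points
  \<open>x = \<omega> a\<^sub>0\<close> and \<open>x = a\<^sub>0\<close> are separated, but \<open>y\<close> cannot separate them.\<close>

lemma nilpotent_generator_trivial:
  assumes p: "p > 0" and x: "x \<in> carrier S" "x [^]\<^bsub>S\<^esub> p = h t" and y: "y \<in> carrier S" "y [^]\<^bsub>S\<^esub> p = \<zero>\<^bsub>S\<^esub>"
    and gen_x: "\<And>\<beta>. \<beta> \<in> carrier S \<Longrightarrow> \<exists>a\<in>{..<p} \<rightarrow> carrier R. \<beta> = lin_comb p x a"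
    and gen_y: "\<And>\<beta>. \<beta> \<in> carrier S \<Longrightarrow> \<exists>a\<in>{..<p} \<rightarrow> carrier R. \<beta> = lin_comb p y a"
    and indep_x: "\<And>a c. a \<in> carrier R \<Longrightarrow> c \<in> carrier R \<Longrightarrow>
      h a \<otimes>\<^bsub>S\<^esub> lin_comb p x (\<lambda>i. c [^] (p - Suc i)) = \<zero>\<^bsub>S\<^esub> \<Longrightarrow> h a = \<zero>\<^bsub>S\<^esub>"
    and indep_y: "\<And>a. a \<in> carrier R \<Longrightarrow> h a \<otimes>\<^bsub>S\<^esub> y [^]\<^bsub>S\<^esub> (p - 1) = \<zero>\<^bsub>S\<^esub> \<Longrightarrow> h a = \<zero>\<^bsub>S\<^esub>"
    and t: "t \<in> Units R"
    and \<omega>: "\<omega> \<in> carrier R" "\<omega> [^] p = \<one>" "\<omega> \<ominus> \<one> \<in> Units R"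
  shows "\<one>\<^bsub>S\<^esub> = \<zero>\<^bsub>S\<^esub>"
proof -
  have tR: "t \<in> carrier R" using t by (rule R.Units_closed)
  obtain a where a: "a \<in> {..<p} \<rightarrow> carrier R" "x = lin_comb p y a" using gen_y x(1) by blast
  define a0 where "a0 = a 0"
  have a0: "a0 \<in> carrier R" using a p by (auto simp: a0_def)
  obtain z where z: "z \<in> carrier S" "x = h a0 \<oplus>\<^bsub>S\<^esub> y \<otimes>\<^bsub>S\<^esub> z"
    using lin_comb_split[OF y(1) a(1) p] a(2) unfolding a0_def by metis
  have diff_zero: "h (b \<ominus> c) = \<zero>\<^bsub>S\<^esub> \<Longrightarrow> h b = h c" if "b \<in> carrier R" "c \<in> carrier R" for b c
    using that by (simp add: R.minus_eq S.minus_eq[symmetric])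
  \<comment> \<open>The top power of the nilpotent \<open>y\<close> is killed by \<open>y\<close>,
    so it represents the point y = 0. There \<open>x\<close> acts by its constant coefficient
    \<open>a0\<close>, which forces the images of \<open>t\<close> and the p-th power of
    \<open>a0\<close> to agree.\<close>
  define e1 where "e1 = y [^]\<^bsub>S\<^esub> (p - 1)"
  have e1: "e1 \<in> carrier S" using y by (simp add: e1_def)
  have "y \<otimes>\<^bsub>S\<^esub> e1 = y [^]\<^bsub>S\<^esub> Suc (p - 1)" using y by (simp add: e1_def S.m_comm)
  then have ye1: "y \<otimes>\<^bsub>S\<^esub> e1 = \<zero>\<^bsub>S\<^esub>" using p y by simp
  have "x \<otimes>\<^bsub>S\<^esub> e1 = h a0 \<otimes>\<^bsub>S\<^esub> e1 \<oplus>\<^bsub>S\<^esub> z \<otimes>\<^bsub>S\<^esub> (y \<otimes>\<^bsub>S\<^esub> e1)"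
    unfolding z(2) using z(1) a0 y(1) e1 by (simp add: S.l_distr S.r_distr S.m_ac)
  then have "x \<otimes>\<^bsub>S\<^esub> e1 = h a0 \<otimes>\<^bsub>S\<^esub> e1" unfolding ye1 using z(1) a0 e1 by simp
  from eigen_pow[OF x(1) _ e1 this, of p] a0
  have "h t \<otimes>\<^bsub>S\<^esub> e1 = h (a0 [^] p) \<otimes>\<^bsub>S\<^esub> e1" by (simp add: x(2))
  then have "h (t \<ominus> a0 [^] p) \<otimes>\<^bsub>S\<^esub> e1 = \<zero>\<^bsub>S\<^esub>"
    using tR a0 e1 by (simp add: R.minus_eq S.l_distr S.l_minus S.r_neg)
  then have ta0: "h t = h (a0 [^] p)"
    unfolding e1_def using tR a0 by (intro diff_zero indep_y) auto
  \<comment> \<open>A second p-th root of \<open>t\<close>. The vector \<open>e\<close> built from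
    it is the point x = c, at which \<open>y\<close> acts by some \<open>\<kappa>\<close> whose
    image is nilpotent.\<close>
  define c where "c = \<omega> \<otimes> a0"
  have c: "c \<in> carrier R" using \<omega> a0 by (simp add: c_def)
  have "c [^] p = a0 [^] p" using \<omega> a0 by (simp add: c_def R.nat_pow_distrib)
  then have xc: "x [^]\<^bsub>S\<^esub> p = h (c [^] p)" using x(2) ta0 by metis
  define e where "e = lin_comb p x (\<lambda>i. c [^] (p - Suc i))"
  note e = root_eigen_vector[OF x(1) c xc, folded e_def]
  obtain b where b: "b \<in> {..<p} \<rightarrow> carrier R" "y = lin_comb p x b" using gen_x y(1) by blast
  obtain \<kappa> where \<kappa>: "\<kappa> \<in> carrier R" "y \<otimes>\<^bsub>S\<^esub> e = h \<kappa> \<otimes>\<^bsub>S\<^esub> e"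
    using lin_comb_eigen[OF x(1) e(1) c e(2) b(1)] b(2) by auto
  have "h (\<kappa> [^] p) \<otimes>\<^bsub>S\<^esub> e = \<zero>\<^bsub>S\<^esub>"
    using eigen_pow[OF y(1) _ e(1) \<kappa>(2), of p] \<kappa>(1) e(1) by (simp add: y(2))
  then have \<kappa>p: "h \<kappa> [^]\<^bsub>S\<^esub> p = \<zero>\<^bsub>S\<^esub>"
    using indep_x[of "\<kappa> [^] p" c] \<kappa>(1) c by (simp add: e_def)
  \<comment> \<open>At the point x = c the relation x = a0 + yz becomes c - a0 = z
    \<open>\<kappa>\<close> on \<open>e\<close>. Taking p-th powers removes the right-hand
    side.\<close>
  define u w where "u = h (c \<ominus> a0)" and "w = z \<otimes>\<^bsub>S\<^esub> h \<kappa>"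
  have uw: "u \<in> carrier S" "w \<in> carrier S" using c a0 z \<kappa> by (auto simp: u_def w_def)
  have "h c \<otimes>\<^bsub>S\<^esub> e = x \<otimes>\<^bsub>S\<^esub> e" using e(2) by simp
  also have "\<dots> = h a0 \<otimes>\<^bsub>S\<^esub> e \<oplus>\<^bsub>S\<^esub> z \<otimes>\<^bsub>S\<^esub> (y \<otimes>\<^bsub>S\<^esub> e)"
    using arg_cong[OF z(2), of "\<lambda>v. v \<otimes>\<^bsub>S\<^esub> e"] z(1) a0 y(1) e(1) by (simp add: S.l_distr S.r_distr S.m_ac)
  also have "z \<otimes>\<^bsub>S\<^esub> (y \<otimes>\<^bsub>S\<^esub> e) = w \<otimes>\<^bsub>S\<^esub> e"
    unfolding \<kappa>(2) w_def using z(1) \<kappa>(1) e(1) by (simp add: S.m_assoc)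
  finally have "u \<otimes>\<^bsub>S\<^esub> e = w \<otimes>\<^bsub>S\<^esub> e"
    unfolding u_def using c a0 e(1) uw
    by (simp add: R.minus_eq S.l_distr S.l_minus) (simp add: S.r_neg S.a_ac)
  from eigen_pow[OF uw e(1) this, of p]
  have "u [^]\<^bsub>S\<^esub> p \<otimes>\<^bsub>S\<^esub> e = z [^]\<^bsub>S\<^esub> p \<otimes>\<^bsub>S\<^esub> h \<kappa> [^]\<^bsub>S\<^esub> p \<otimes>\<^bsub>S\<^esub> e"
    using z(1) \<kappa>(1) by (simp add: w_def S.nat_pow_distrib)
  then have "h ((c \<ominus> a0) [^] p) \<otimes>\<^bsub>S\<^esub> e = \<zero>\<^bsub>S\<^esub>"
    unfolding \<kappa>p u_def using z(1) c a0 e(1) by simp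
  then have "h ((c \<ominus> a0) [^] p) = \<zero>\<^bsub>S\<^esub>"
    using indep_x[of "(c \<ominus> a0) [^] p" c] c a0 unfolding e_def by blast
  moreover have "c \<ominus> a0 = (\<omega> \<ominus> \<one>) \<otimes> a0"
    using \<omega> a0 by (simp add: c_def R.minus_eq R.l_distr R.l_minus)
  ultimately have "h ((\<omega> \<ominus> \<one>) [^] p) \<otimes>\<^bsub>S\<^esub> h (a0 [^] p) = \<zero>\<^bsub>S\<^esub>"
    using \<omega> a0 by (simp add: R.nat_pow_distrib S.nat_pow_distrib)
  then have hv: "h ((\<omega> \<ominus> \<one>) [^] p \<otimes> t) = \<zero>\<^bsub>S\<^esub>"
    unfolding ta0[symmetric] using \<omega> tR by simp
  \<comment> \<open>The p-th power of c - a0 has the same image as this unit, because the p-th power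
    of \<open>a0\<close> has the same image as \<open>t\<close>. A unit mapping to zero makes the
    target trivial.\<close>
  define v where "v = (\<omega> \<ominus> \<one>) [^] p \<otimes> t"
  have v: "v \<in> Units R" using \<omega> t by (auto simp: v_def R.Units_pow_closed)
  have "\<one>\<^bsub>S\<^esub> = h (v \<otimes> inv v)" using v by simp
  also have "\<dots> = h v \<otimes>\<^bsub>S\<^esub> h (inv v)" using v by (intro hom_mult) auto
  also have "\<dots> = \<zero>\<^bsub>S\<^esub>" using hv v by (simp add: v_def)
  finally show ?thesis .
qed

text \<open>In the quotient of S by the ideal of \<open>d\<close> the generator \<open>y\<close>
  becomes nilpotent, while \<open>x\<close> still has a unit as its p-th power. The preceding lemma
  makes the quotient trivial, and reading a coefficient shows that \<open>d\<close> divides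
  1.\<close>

lemma power_basis_unit:
  assumes p: "p > 0" and x: "power_basis R S h p x" "x [^]\<^bsub>S\<^esub> p = h t"
    and y: "power_basis R S h p y" "y [^]\<^bsub>S\<^esub> p = h d"
    and t: "t \<in> Units R" and d: "d \<in> carrier R"
    and \<omega>: "\<omega> \<in> carrier R" "\<omega> [^] p = \<one>" "\<omega> \<ominus> \<one> \<in> Units R"
  shows "d \<in> Units R"
proof -
  have xS: "x \<in> carrier S" and yS: "y \<in> carrier S" using x y by (auto intro: power_basis_closed)
  define I where "I = PIdl\<^bsub>S\<^esub> (h d)"
  interpret I: ideal I S unfolding I_def using d by (intro S.cgenideal_ideal) auto
  define Q where "Q = S Quot I"
  define q where "q = (+>\<^bsub>S\<^esub>) I"
  interpret q: ring_hom_cring S Q q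
    unfolding Q_def q_def using I.rcos_ring_hom_cring S.is_cring by blast
  \<comment> \<open>This makes \<open>Q\<close> an R-algebra without forming R/(d). The map kills
    \<open>d\<close>, which is why independence in \<open>nilpotent_generator_trivial\<close>
    concerns images rather than elements of R.\<close>
  interpret k: ring_hom_cring R Q "q \<circ> h"
    by (rule ring_hom_cringI[OF R.is_cring q.S.is_cring]) (use homh q.homh in \<open>rule ring_hom_trans\<close>)
  have q_zero: "q b = \<zero>\<^bsub>Q\<^esub> \<longleftrightarrow> b \<in> I" if "b \<in> carrier S" for b
    using that I.rcos_const_imp_mem[of b] S.a_rcos_zero[OF I.is_ideal, of b]
    unfolding q_def Q_def FactRing_def by auto
  have q_surj: "\<exists>b\<in>carrier S. \<beta> = q b" if "\<beta> \<in> carrier Q" for \<beta>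
    using that unfolding q_def Q_def FactRing_def A_RCOSETS_def' by auto
  have q_lin: "q (lin_comb p b a) = k.lin_comb p (q b) a"
    if "b \<in> carrier S" "a \<in> {..<p} \<rightarrow> carrier R" for a b
  proof -
    have "q (lin_comb p b a) = finsum Q (q \<circ> (\<lambda>i. h (a i) \<otimes>\<^bsub>S\<^esub> b [^]\<^bsub>S\<^esub> i)) {..<p}"
      using that by (intro q.hom_finsum) auto
    also have "\<dots> = k.lin_comb p (q b) a"
      using that by (intro q.S.finsum_cong') (auto simp: Pi_iff)
    finally show ?thesis .
  qed
  have gen: "\<exists>a\<in>{..<p} \<rightarrow> carrier R. \<beta> = k.lin_comb p (q b) a"
    if b: "power_basis R S h p b" and \<beta>: "\<beta> \<in> carrier Q" for b \<beta>
  proof -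
    obtain \<gamma> where \<gamma>: "\<gamma> \<in> carrier S" "\<beta> = q \<gamma>" using q_surj[OF \<beta>] by blast
    obtain a where "a \<in> {..<p} \<rightarrow> carrier R" "\<gamma> = lin_comb p b a"
      using power_basis_gen[OF b \<gamma>(1)] .
    with \<gamma> b show ?thesis using q_lin power_basis_closed by blast
  qed
  \<comment> \<open>Bases of S stay independent in \<open>Q\<close> up to multiples of
    \<open>d\<close>: vanishing in \<open>Q\<close> is divisibility by \<open>h d\<close> in S, and
    a coefficient equal to 1 passes that divisibility on to \<open>a\<close>.\<close>
  have indep: "a \<in> PIdl d"
    if "power_basis R S h p b" "c \<in> {..<p} \<rightarrow> carrier R" "j < p" "c j = \<one>" "a \<in> carrier R"
      "(q \<circ> h) a \<otimes>\<^bsub>Q\<^esub> k.lin_comb p (q b) c = \<zero>\<^bsub>Q\<^esub>" for a b c j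
  proof -
    have b: "b \<in> carrier S" using that(1) by (rule power_basis_closed)
    have "q (h a \<otimes>\<^bsub>S\<^esub> lin_comb p b c) = q (h a) \<otimes>\<^bsub>Q\<^esub> q (lin_comb p b c)"
      using that(5) lin_comb_closed[OF b that(2)] by (intro q.hom_mult) auto
    also have "\<dots> = (q \<circ> h) a \<otimes>\<^bsub>Q\<^esub> k.lin_comb p (q b) c"
      using q_lin[OF b that(2)] by (simp only: comp_apply)
    also have "\<dots> = \<zero>\<^bsub>Q\<^esub>" by (rule that(6))
    finally have z: "q (h a \<otimes>\<^bsub>S\<^esub> lin_comb p b c) = \<zero>\<^bsub>Q\<^esub>" .
    have "h a \<otimes>\<^bsub>S\<^esub> lin_comb p b c \<in> carrier S"
      using that(5) lin_comb_closed[OF b that(2)] by simp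
    from q_zero[THEN iffD1, OF this z]
    have "h a \<otimes>\<^bsub>S\<^esub> lin_comb p b c \<in> PIdl\<^bsub>S\<^esub> (h d)" by (simp only: I_def)
    then show ?thesis using power_basis_dvd[OF that(1) refl that(2-4) that(5) d] by blast
  qed
  have PIdl_zero: "(q \<circ> h) a = \<zero>\<^bsub>Q\<^esub>" if "a \<in> PIdl d" for a
  proof -
    obtain r where r: "r \<in> carrier R" "a = r \<otimes> d"
      using \<open>a \<in> PIdl d\<close> unfolding cgenideal_def by blast
    then have "h a = h r \<otimes>\<^bsub>S\<^esub> h d" using d by simp
    then have "h a \<in> I" unfolding I_def cgenideal_def using r(1) by blast
    then show ?thesis using q_zero[of "h a"] by simp
  qed
  let ?top = "\<lambda>i. if i = p - 1 then \<one> else \<zero>"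
  have "\<one>\<^bsub>Q\<^esub> = \<zero>\<^bsub>Q\<^esub>"
  proof (rule k.nilpotent_generator_trivial[OF p _ _ _ _ gen[OF x(1)] gen[OF y(1)] _ _ t \<omega>])
    show "q x \<in> carrier Q" "q y \<in> carrier Q" using xS yS by auto
    show "q x [^]\<^bsub>Q\<^esub> p = (q \<circ> h) t" using xS x(2) by (simp flip: q.hom_pow)
    have "h d \<in> I" using d by (simp add: I_def S.cgenideal_self)
    then show "q y [^]\<^bsub>Q\<^esub> p = \<zero>\<^bsub>Q\<^esub>" using yS y(2) q_zero[of "h d"] d by (simp flip: q.hom_pow)
  next
    fix a c assume "a \<in> carrier R" "c \<in> carrier R"
      "(q \<circ> h) a \<otimes>\<^bsub>Q\<^esub> k.lin_comb p (q x) (\<lambda>i. c [^] (p - Suc i)) = \<zero>\<^bsub>Q\<^esub>"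
    then show "(q \<circ> h) a = \<zero>\<^bsub>Q\<^esub>"
      using p by (intro PIdl_zero indep[OF x(1), of "\<lambda>i. c [^] (p - Suc i)" "p - 1"]) auto
  next
    fix a assume "a \<in> carrier R" "(q \<circ> h) a \<otimes>\<^bsub>Q\<^esub> q y [^]\<^bsub>Q\<^esub> (p - 1) = \<zero>\<^bsub>Q\<^esub>"
    then show "(q \<circ> h) a = \<zero>\<^bsub>Q\<^esub>"
      using p yS k.lin_comb_single[of "q y" "\<one>" "p - 1" p]
      by (intro PIdl_zero indep[OF y(1), of ?top "p - 1"]) auto
  qed
  \<comment> \<open>In the trivial ring even the top power of \<open>y\<close> vanishes; applied to
    it, \<open>indep\<close> returns 1 as a multiple of \<open>d\<close>.\<close>
  then have "(q \<circ> h) \<one> \<otimes>\<^bsub>Q\<^esub> k.lin_comb p (q y) ?top = \<zero>\<^bsub>Q\<^esub>"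
    using p yS k.lin_comb_single[of "q y" "\<one>" "p - 1" p] by simp
  then have "\<one> \<in> PIdl d" using p by (intro indep[OF y(1), of ?top "p - 1"]) auto
  then obtain r where r: "r \<in> carrier R" "r \<otimes> d = \<one>" unfolding cgenideal_def by force
  then have "d \<otimes> r = \<one>" using d by (simp add: R.m_comm)
  with r d show ?thesis unfolding Units_def by blast
qed

text \<open>Being an eigenvector of \<open>g\<close>, \<open>\<beta>\<close> is a scalar multiple of a single power of \<open>y\<close>.\<close>

lemma power_basis_eigen_root:
  assumes dom: "domain R" and p: "p > 0" and y: "power_basis R S h p y" "y [^]\<^bsub>S\<^esub> p = h s" and s: "s \<in> carrier R"
    and g: "g \<in> ring_hom S S" "\<And>a. a \<in> carrier R \<Longrightarrow> g (h a) = h a" "g y = h \<omega> \<otimes>\<^bsub>S\<^esub> y" and \<omega>: "\<omega> \<in> carrier R"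
      "\<And>i j. i < p \<Longrightarrow> j < p \<Longrightarrow> \<omega> [^] i = \<omega> [^] j \<Longrightarrow> i = (j::nat)"
    and \<beta>: "\<beta> \<in> carrier S" "g \<beta> = h c \<otimes>\<^bsub>S\<^esub> \<beta>" "\<beta> [^]\<^bsub>S\<^esub> p = h z"
    and c: "c \<in> carrier R" and z: "z \<in> carrier R" "z \<noteq> \<zero>"
  shows "\<exists>i<p. \<exists>b\<in>carrier R. c = \<omega> [^] i \<and> z = b [^] p \<otimes> s [^] i"
proof -
  interpret D: "domain" R by fact
  interpret g: ring_hom_cring S S g by (rule ring_hom_cringI[OF S.is_cring S.is_cring g(1)])
  have yS: "y \<in> carrier S" using y(1) by (rule power_basis_closed)
  obtain b where b: "b \<in> {..<p} \<rightarrow> carrier R" "\<beta> = lin_comb p y b" using power_basis_gen[OF y(1) \<beta>(1)] .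
  have "g \<beta> = (\<Oplus>\<^bsub>S\<^esub>i\<in>{..<p}. g (h (b i) \<otimes>\<^bsub>S\<^esub> y [^]\<^bsub>S\<^esub> i))"
    unfolding b(2) using b(1) yS by (subst g.hom_finsum) (auto simp: comp_def)
  also have "\<dots> = lin_comb p y (\<lambda>i. \<omega> [^] i \<otimes> b i)"
    using b(1) yS \<omega>(1) g(2,3)
    by (intro S.finsum_cong') (auto simp: Pi_iff S.nat_pow_distrib S.m_ac)
  finally have "lin_comb p y (\<lambda>i. \<omega> [^] i \<otimes> b i) = lin_comb p y (\<lambda>i. c \<otimes> b i)"
    using \<beta>(2) b c yS by (simp add: lin_comb_smult)
  \<comment> \<open>Comparing coefficients in the basis of powers of \<open>y\<close>: a nonzero
    coefficient at \<open>i\<close> forces the eigenvalue to be the i-th power of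
    \<open>\<omega>\<close>, and distinct exponents below p give distinct eigenvalues.\<close>
  then have eq: "\<omega> [^] i \<otimes> b i = c \<otimes> b i" if "i < p" for i
    using that b(1) \<omega>(1) c
    by (intro power_basis_indep[OF y(1), of "\<lambda>i. \<omega> [^] i \<otimes> b i" "\<lambda>i. c \<otimes> b i"]) auto
  have h_inj: "h a = \<zero>\<^bsub>S\<^esub> \<Longrightarrow> a = \<zero>" if "a \<in> carrier R" for a
    using power_basis_inj[OF y(1) p that R.zero_closed] by simp
  have "\<exists>i<p. b i \<noteq> \<zero>"
  proof (rule ccontr)
    assume "\<not> (\<exists>i<p. b i \<noteq> \<zero>)"
    then have "\<beta> = lin_comb p y (\<lambda>i. if i = 0 then \<zero> else \<zero>)"
      unfolding b(2) using yS by (intro lin_comb_cong) auto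
    then have "\<beta> = \<zero>\<^bsub>S\<^esub>" using lin_comb_single[OF yS R.zero_closed p] yS by simp
    then have "h z = \<zero>\<^bsub>S\<^esub>" using \<beta>(3) p by (simp add: S.nat_pow_zero)
    then show False using h_inj z by blast
  qed
  then obtain i where i: "i < p" "b i \<noteq> \<zero>" by blast
  have bi: "b i \<in> carrier R" using i b(1) by auto
  have ci: "c = \<omega> [^] i" using eq[OF i(1)] i(2) bi \<omega>(1) c by (simp add: D.m_rcancel)
  have "b j = \<zero>" if "j < p" "j \<noteq> i" for j
  proof (rule ccontr)
    assume "b j \<noteq> \<zero>"
    then have "\<omega> [^] j = c" using eq[OF that(1)] that(1) b(1) \<omega>(1) c by (simp add: D.m_rcancel Pi_iff)
    then show False using \<omega>(2)[of j i] that i ci by auto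
  qed
  then have "\<beta> = lin_comb p y (\<lambda>j. if j = i then b i else \<zero>)"
    unfolding b(2) using yS bi by (intro lin_comb_cong) auto
  then have "\<beta> = h (b i) \<otimes>\<^bsub>S\<^esub> y [^]\<^bsub>S\<^esub> i" using lin_comb_single[OF yS bi i(1)] by simp
  then have "h z = h (b i) [^]\<^bsub>S\<^esub> p \<otimes>\<^bsub>S\<^esub> (y [^]\<^bsub>S\<^esub> p) [^]\<^bsub>S\<^esub> i"
    using \<beta>(3) yS bi by (simp add: S.nat_pow_distrib S.nat_pow_pow mult.commute)
  then have "h z = h (b i [^] p \<otimes> s [^] i)" using y(2) bi s by simp
  then have "z = b i [^] p \<otimes> s [^] i"
    using bi s z(1) by (intro power_basis_inj[OF y(1) p]) auto
  with i(1) bi ci show ?thesis by blast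
qed

end

section \<open>Adjoining a root\<close>

context cring
begin

lemma cring_UP: "cring (UP R)"
  by (rule UP_cring.UP_cring) (simp add: UP_cring_def is_cring)

lemma root_polynomial_closed:
  "a \<in> carrier R \<Longrightarrow> up_ring.monom (UP R) \<one> p \<ominus>\<^bsub>UP R\<^esub> up_ring.monom (UP R) a 0 \<in> carrier (UP R)"
proof -
  interpret U: UP_cring R "UP R" by (simp_all add: UP_cring_def is_cring)
  show "a \<in> carrier R \<Longrightarrow> ?thesis" by simp
qed

lemma ideal_root_ideal: "a \<in> carrier R \<Longrightarrow> ideal (root_ideal R p a) (UP R)"
  unfolding root_ideal_def by (intro cring.cgenideal_ideal cring_UP root_polynomial_closed)

lemma root_ext_proj_hom:
  "a \<in> carrier R \<Longrightarrow> ring_hom_cring (UP R) (root_ext R p a) ((+>\<^bsub>UP R\<^esub>) (root_ideal R p a))"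
  unfolding root_ext_def by (intro ideal.rcos_ring_hom_cring ideal_root_ideal cring_UP)

lemma root_ext_emb_hom:
  assumes a: "a \<in> carrier R"
  shows "ring_hom_cring R (root_ext R p a) (root_ext_emb R p a)"
proof -
  interpret U: UP_cring R "UP R" by (simp_all add: UP_cring_def is_cring)
  interpret q: ring_hom_cring "UP R" "root_ext R p a" "(+>\<^bsub>UP R\<^esub>) (root_ideal R p a)"
    by (rule root_ext_proj_hom[OF a])
  have "(\<lambda>c. up_ring.monom (UP R) c 0) \<in> ring_hom R (UP R)"
    by (rule U.const_ring_hom)
  from ring_hom_trans[OF this q.homh] show ?thesis
    by (intro ring_hom_cringI is_cring q.S.is_cring) (simp add: comp_def root_ext_emb_def[abs_def])
qed

lemma root_ext_coset:
  assumes "a \<in> carrier R" "\<beta> \<in> carrier (root_ext R p a)"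
  obtains f where "f \<in> carrier (UP R)" "\<beta> = root_ideal R p a +>\<^bsub>UP R\<^esub> f"
  using assms(2) unfolding root_ext_def FactRing_def A_RCOSETS_def' by auto

definition root_gen :: "nat \<Rightarrow> 'a \<Rightarrow> (nat \<Rightarrow> 'a) set" where
  "root_gen p a = root_ideal R p a +>\<^bsub>UP R\<^esub> up_ring.monom (UP R) \<one> 1"

lemma root_ext_lin_comb:
  assumes a: "a \<in> carrier R" and b: "b \<in> {..<n} \<rightarrow> carrier R"
  shows "(\<Oplus>\<^bsub>root_ext R p a\<^esub>i\<in>{..<n}. root_ext_emb R p a (b i) \<otimes>\<^bsub>root_ext R p a\<^esub>
      root_gen p a [^]\<^bsub>root_ext R p a\<^esub> i) =
    root_ideal R p a +>\<^bsub>UP R\<^esub> (\<Oplus>\<^bsub>UP R\<^esub>i\<in>{..<n}. up_ring.monom (UP R) (b i) i)"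
proof -
  interpret U: UP_cring R "UP R" by (simp_all add: UP_cring_def is_cring)
  let ?q = "(+>\<^bsub>UP R\<^esub>) (root_ideal R p a)"
  interpret q: ring_hom_cring "UP R" "root_ext R p a" ?q by (rule root_ext_proj_hom[OF a])
  have "?q (\<Oplus>\<^bsub>UP R\<^esub>i\<in>{..<n}. up_ring.monom (UP R) (b i) i) =
    finsum (root_ext R p a) (?q \<circ> (\<lambda>i. up_ring.monom (UP R) (b i) i)) {..<n}"
    using b by (intro q.hom_finsum) (auto simp: Pi_iff)
  also have "\<dots> = (\<Oplus>\<^bsub>root_ext R p a\<^esub>i\<in>{..<n}. root_ext_emb R p a (b i) \<otimes>\<^bsub>root_ext R p a\<^esub>
      root_gen p a [^]\<^bsub>root_ext R p a\<^esub> i)"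
  proof (rule q.S.finsum_cong'[OF refl])
    fix i assume "i \<in> {..<n}"
    then have bi: "b i \<in> carrier R" using b by auto
    have "up_ring.monom (UP R) (b i) i = up_ring.monom (UP R) (b i) 0 \<otimes>\<^bsub>UP R\<^esub> up_ring.monom (UP R) \<one> i"
      using bi U.monom_mult[of "b i" \<one> 0 i] by simp
    also have "up_ring.monom (UP R) \<one> i = up_ring.monom (UP R) \<one> 1 [^]\<^bsub>UP R\<^esub> i"
      using U.monom_pow[of \<one> 1 i] by simp
    finally show "(?q \<circ> (\<lambda>i. up_ring.monom (UP R) (b i) i)) i =
      root_ext_emb R p a (b i) \<otimes>\<^bsub>root_ext R p a\<^esub> root_gen p a [^]\<^bsub>root_ext R p a\<^esub> i"
      using bi by (simp add: root_ext_emb_def root_gen_def)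
  next
    interpret e: ring_hom_cring R "root_ext R p a" "root_ext_emb R p a" by (rule root_ext_emb_hom[OF a])
    show "(\<lambda>i. root_ext_emb R p a (b i) \<otimes>\<^bsub>root_ext R p a\<^esub> root_gen p a [^]\<^bsub>root_ext R p a\<^esub> i)
      \<in> {..<n} \<rightarrow> carrier (root_ext R p a)"
      using b by (auto simp: root_gen_def intro!: q.S.m_closed e.hom_closed q.S.nat_pow_closed q.hom_closed)
  qed
  finally show ?thesis ..
qed

lemma root_gen_pow:
  assumes a: "a \<in> carrier R"
  shows "root_gen p a [^]\<^bsub>root_ext R p a\<^esub> p = root_ext_emb R p a a"
proof -
  interpret U: UP_cring R "UP R" by (simp_all add: UP_cring_def is_cring)
  let ?q = "(+>\<^bsub>UP R\<^esub>) (root_ideal R p a)"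
  interpret I: ideal "root_ideal R p a" "UP R" by (rule ideal_root_ideal[OF a])
  interpret q: ring_hom_cring "UP R" "root_ext R p a" ?q by (rule root_ext_proj_hom[OF a])
  have "root_gen p a [^]\<^bsub>root_ext R p a\<^esub> p = ?q (up_ring.monom (UP R) \<one> p)"
    using U.monom_pow[of \<one> 1 p] by (simp add: root_gen_def flip: q.hom_pow)
  also have "\<dots> = ?q (up_ring.monom (UP R) a 0)"
    using a root_polynomial_closed[OF a, of p]
    by (intro U.quotient_eq_iff_same_a_r_cos[THEN iffD1, OF I.is_ideal])
      (auto simp: root_ideal_def U.cgenideal_self)
  finally show ?thesis by (simp add: root_ext_emb_def)
qed

text \<open>Multiplication by T^p - a is a shift by p minus a scaling. This one formula drives both
  the division with remainder and its uniqueness.\<close>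

lemma coeff_root_polynomial_mult:
  assumes "a \<in> carrier R" "f \<in> carrier (UP R)" "p > 0"
  shows "up_ring.coeff (UP R) (f \<otimes>\<^bsub>UP R\<^esub> (up_ring.monom (UP R) \<one> p \<ominus>\<^bsub>UP R\<^esub> up_ring.monom (UP R) a 0)) (n + p) =
    up_ring.coeff (UP R) f n \<ominus> a \<otimes> up_ring.coeff (UP R) f (n + p)"
proof -
  interpret U: UP_cring R "UP R" by (simp_all add: UP_cring_def is_cring)
  let ?X = "up_ring.monom (UP R) \<one> p" and ?a = "up_ring.monom (UP R) a 0"
  have "f \<otimes>\<^bsub>UP R\<^esub> (?X \<ominus>\<^bsub>UP R\<^esub> ?a) = ?X \<otimes>\<^bsub>UP R\<^esub> f \<ominus>\<^bsub>UP R\<^esub> ?a \<otimes>\<^bsub>UP R\<^esub> f"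
    using assms by (simp add: U.P.minus_eq U.P.r_distr U.P.r_minus U.P.m_comm)
  then show ?thesis
    using assms U.coeff_monom_mult[of \<one> f p n] U.coeff_monom_mult[of a f 0 "n + p"] by simp
qed

text \<open>The polynomial T^p - a is monic, so division with remainder by it works over any
  commutative ring; the remainders of degree below p represent the classes uniquely.\<close>

lemma power_basis_root_gen:
  assumes a: "a \<in> carrier R" and p: "p > 0"
  shows "power_basis R (root_ext R p a) (root_ext_emb R p a) p (root_gen p a)"
proof -
  interpret U: UP_cring R "UP R" by (simp_all add: UP_cring_def is_cring)
  let ?I = "root_ideal R p a" and ?P = "UP R"
  let ?g = "up_ring.monom ?P \<one> p \<ominus>\<^bsub>?P\<^esub> up_ring.monom ?P a 0"
  let ?q = "(+>\<^bsub>?P\<^esub>) ?I"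
  let ?s = "\<lambda>b. \<Oplus>\<^bsub>?P\<^esub>i\<in>{..<p}. up_ring.monom ?P (b i) i"
  interpret I: ideal ?I ?P by (rule ideal_root_ideal[OF a])
  interpret q: ring_hom_cring ?P "root_ext R p a" ?q by (rule root_ext_proj_hom[OF a])
  interpret e: ring_hom_cring R "root_ext R p a" "root_ext_emb R p a" by (rule root_ext_emb_hom[OF a])
  have g: "?g \<in> carrier ?P" by (rule root_polynomial_closed[OF a])
  have s_closed: "?s b \<in> carrier ?P" if "b \<in> {..<p} \<rightarrow> carrier R" for b
    using that by (intro U.P.finsum_closed) (auto simp: Pi_iff)
  have coeff_s: "up_ring.coeff ?P (?s b) k = (if k < p then b k else \<zero>)" if b: "b \<in> {..<p} \<rightarrow> carrier R" for b k
  proof -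
    have "up_ring.coeff ?P (?s b) k = (\<Oplus>i\<in>{..<p}. up_ring.coeff ?P (up_ring.monom ?P (b i) i) k)"
      using b by (intro U.coeff_finsum) (auto simp: Pi_iff)
    also have "\<dots> = (\<Oplus>i\<in>{..<p}. if k = i then b i else \<zero>)"
      using b by (intro finsum_cong') (auto simp: Pi_iff)
    also have "\<dots> = (if k < p then b k else \<zero>)"
    proof (cases "k < p")
      case True
      then show ?thesis using b finsum_singleton[of k "{..<p}" b] by simp
    next
      case False
      then have "(\<Oplus>i\<in>{..<p}. if k = i then b i else \<zero>) = (\<Oplus>i\<in>{..<p}. \<zero>)"
        by (intro finsum_cong') auto
      then show ?thesis using False by simp
    qed
    finally show ?thesis .
  qed
  show ?thesis
  proof (rule e.power_basisI)
    show "root_gen p a \<in> carrier (root_ext R p a)" by (auto simp: root_gen_def)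
  next
    fix \<beta> assume "\<beta> \<in> carrier (root_ext R p a)"
    then obtain f where f: "f \<in> carrier ?P" "\<beta> = ?q f" by (rule root_ext_coset[OF a])
    \<comment> \<open>Here \<open>m\<close> bounds the degree of \<open>f\<close>. If it exceeds p,
      subtracting the top coefficient times T^n times the root polynomial kills the coefficient at n
      + p, disturbs at most the lower one at n, and decreases the bound.\<close>
    have reduce: "\<exists>r\<in>carrier ?P. ?q r = ?q f \<and> (\<forall>k\<ge>p. up_ring.coeff ?P r k = \<zero>)"
      if "f \<in> carrier ?P" "\<And>k. k \<ge> m \<Longrightarrow> up_ring.coeff ?P f k = \<zero>" for f m
      using that
    proof (induction m arbitrary: f rule: less_induct)
      case (less m)
      show ?case
      proof (cases "m \<le> p")
        case True
        then show ?thesis using less.prems by (intro bexI[of _ f]) auto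
      next
        case False
        then obtain n where n: "m = Suc (n + p)" by (metis add.commute add_Suc_right less_imp_Suc_add not_le)
        let ?c = "up_ring.coeff ?P f (n + p)"
        let ?h = "up_ring.monom ?P ?c n"
        let ?f = "f \<ominus>\<^bsub>?P\<^esub> ?h \<otimes>\<^bsub>?P\<^esub> ?g"
        have c: "?c \<in> carrier R" using less.prems by simp
        have fP: "?f \<in> carrier ?P" using less.prems g c by simp
        have hP: "?h \<in> carrier ?P" using c by simp
        have W: "?h \<otimes>\<^bsub>?P\<^esub> ?g \<in> ?I" unfolding root_ideal_def cgenideal_def using hP by blast
        have "F \<ominus>\<^bsub>?P\<^esub> (F \<ominus>\<^bsub>?P\<^esub> V) = V" if "F \<in> carrier ?P" "V \<in> carrier ?P" for F V
          using that by (simp add: U.P.minus_eq U.P.minus_add U.P.r_neg2 U.P.r_neg1)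
        then have "f \<ominus>\<^bsub>?P\<^esub> ?f \<in> ?I" using W I.Icarr[OF W] less.prems(1) by metis
        then have "?q f = ?q ?f"
          using less.prems(1) fP U.P.quotient_eq_iff_same_a_r_cos[OF I.is_ideal, of f ?f] by blast
        moreover have "up_ring.coeff ?P ?f k = \<zero>" if k: "k \<ge> n + p" for k
        proof -
          obtain j where j: "k = j + p" "j \<ge> n" using k by (metis add_le_cancel_right le_add_diff_inverse2 le_add2 order_trans)
          have "up_ring.coeff ?P (?h \<otimes>\<^bsub>?P\<^esub> ?g) k = up_ring.coeff ?P ?h j \<ominus> a \<otimes> up_ring.coeff ?P ?h (j + p)"
            unfolding j using c by (intro coeff_root_polynomial_mult a p) auto
          also have "\<dots> = up_ring.coeff ?P f k"
            using c a p j less.prems n by (auto simp: minus_eq)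
          finally show ?thesis using less.prems g c by (simp add: r_right_minus_eq)
        qed
        ultimately show ?thesis using less.IH[of "n + p" ?f] n fP by auto
      qed
    qed
    have "up_ring.coeff ?P f k = \<zero>" if "k \<ge> Suc (deg R f)" for k
      using that f by (intro U.deg_aboveD) auto
    from reduce[OF f(1) this] obtain r where r: "r \<in> carrier ?P" "?q r = ?q f" "\<And>k. k \<ge> p \<Longrightarrow> up_ring.coeff ?P r k = \<zero>"
      by blast
    have b: "up_ring.coeff ?P r \<in> {..<p} \<rightarrow> carrier R" using r by auto
    have "?s (up_ring.coeff ?P r) = r"
      using r by (intro U.up_eqI s_closed b) (auto simp: coeff_s[OF b])
    then have "\<beta> = e.lin_comb p (root_gen p a) (up_ring.coeff ?P r)"
      using root_ext_lin_comb[OF a b, of p] r f by simp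
    with b show "\<exists>b\<in>{..<p} \<rightarrow> carrier R. \<beta> = e.lin_comb p (root_gen p a) b" by blast
  next
    fix b c i assume bc: "b \<in> {..<p} \<rightarrow> carrier R" "c \<in> {..<p} \<rightarrow> carrier R"
      "e.lin_comb p (root_gen p a) b = e.lin_comb p (root_gen p a) c" and i: "i < p"
    then have "?q (?s b) = ?q (?s c)" by (simp add: root_ext_lin_comb a)
    then have "?s b \<ominus>\<^bsub>?P\<^esub> ?s c \<in> ?I"
      using s_closed bc by (intro U.P.quotient_eq_iff_same_a_r_cos[THEN iffD2, OF I.is_ideal]) auto
    then obtain f where f: "f \<in> carrier ?P" "?s b \<ominus>\<^bsub>?P\<^esub> ?s c = f \<otimes>\<^bsub>?P\<^esub> ?g"
      unfolding root_ideal_def cgenideal_def by blast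
    have zero: "up_ring.coeff ?P f n = a \<otimes> up_ring.coeff ?P f (n + p)" for n
    proof -
      have "up_ring.coeff ?P f n \<ominus> a \<otimes> up_ring.coeff ?P f (n + p) = up_ring.coeff ?P (?s b \<ominus>\<^bsub>?P\<^esub> ?s c) (n + p)"
        unfolding f(2) using coeff_root_polynomial_mult[OF a f(1) p, of n] by simp
      also have "\<dots> = \<zero>" using s_closed bc by (simp add: coeff_s r_right_minus_eq)
      finally show ?thesis using f a by (simp add: r_right_minus_eq)
    qed
    \<comment> \<open>Descending induction from above the degree: each coefficient is
      \<open>a\<close> times the one p places higher.\<close>
    have "up_ring.coeff ?P f n = \<zero>" for n
    proof (induction "Suc (deg R f) - n" arbitrary: n rule: less_induct)
      case less
      show ?case
      proof (cases "deg R f < n")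
        case True
        then show ?thesis using f by (intro U.deg_aboveD)
      next
        case False
        then have "up_ring.coeff ?P f (n + p) = \<zero>" using p by (intro less) simp
        then show ?thesis using zero[of n] a by simp
      qed
    qed
    then have "f = \<zero>\<^bsub>?P\<^esub>" using f by (intro U.up_eqI) auto
    then have "?s b \<ominus>\<^bsub>?P\<^esub> ?s c = \<zero>\<^bsub>?P\<^esub>" using f g by simp
    then have "?s b = ?s c" using s_closed bc by (simp add: U.P.r_right_minus_eq)
    then show "b i = c i" using coeff_s[OF bc(1), of i] coeff_s[OF bc(2), of i] i by simp
  qed
qed

end

section \<open>Functoriality and automorphisms\<close>

lemma UP_ops:
  "carrier (UP R) = up R"
  "f \<in> up R \<Longrightarrow> g \<in> up R \<Longrightarrow> f \<oplus>\<^bsub>UP R\<^esub> g = (\<lambda>n. f n \<oplus>\<^bsub>R\<^esub> g n)"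
  "f \<in> up R \<Longrightarrow> g \<in> up R \<Longrightarrow> f \<otimes>\<^bsub>UP R\<^esub> g = (\<lambda>n. \<Oplus>\<^bsub>R\<^esub>i\<in>{..n}. f i \<otimes>\<^bsub>R\<^esub> g (n - i))"
  "\<one>\<^bsub>UP R\<^esub> = (\<lambda>i. if i = 0 then \<one>\<^bsub>R\<^esub> else \<zero>\<^bsub>R\<^esub>)"
  "a \<in> carrier R \<Longrightarrow> up_ring.monom (UP R) a k = (\<lambda>i. if i = k then a else \<zero>\<^bsub>R\<^esub>)"
  by (simp_all add: UP_def)

lemma (in ring_hom_cring) UP_map_hom: "ring_hom_cring (UP R) (UP S) (\<lambda>f n. h (f n))"
proof -
  interpret P: UP_cring R "UP R" by (simp_all add: UP_cring_def R.is_cring)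
  interpret Q: UP_cring S "UP S" by (simp_all add: UP_cring_def S.is_cring)
  have closed: "(\<lambda>n. h (f n)) \<in> up S" if f: "f \<in> up R" for f
  proof -
    obtain n where n: "bound \<zero> n f" using f by (auto simp: up_def)
    have "bound \<zero>\<^bsub>S\<^esub> n (\<lambda>n. h (f n))" using bound.bound[OF n] by (auto intro!: bound.intro)
    then show ?thesis using f by (auto simp: up_def)
  qed
  show ?thesis
  proof (rule ring_hom_cringI[OF P.UP_cring Q.UP_cring], rule ring_hom_memI)
    fix f assume "f \<in> carrier (UP R)"
    then show "(\<lambda>n. h (f n)) \<in> carrier (UP S)" using closed unfolding UP_ops by blast
  next
    fix f g assume fg: "f \<in> carrier (UP R)" "g \<in> carrier (UP R)"
    then have up: "f \<in> up R" "g \<in> up R" by (simp_all only: UP_ops)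
    have c: "f i \<in> carrier R" "g i \<in> carrier R" for i using up by auto
    show "(\<lambda>n. h ((f \<oplus>\<^bsub>UP R\<^esub> g) n)) = (\<lambda>n. h (f n)) \<oplus>\<^bsub>UP S\<^esub> (\<lambda>n. h (g n))"
      unfolding UP_ops(2)[OF up] UP_ops(2)[OF closed[OF up(1)] closed[OF up(2)]] using c by simp
    have "h (\<Oplus>i\<in>{..n}. f i \<otimes> g (n - i)) = (\<Oplus>\<^bsub>S\<^esub>i\<in>{..n}. h (f i) \<otimes>\<^bsub>S\<^esub> h (g (n - i)))" for n
      using c by (subst hom_finsum) (auto simp: comp_def)
    then show "(\<lambda>n. h ((f \<otimes>\<^bsub>UP R\<^esub> g) n)) = (\<lambda>n. h (f n)) \<otimes>\<^bsub>UP S\<^esub> (\<lambda>n. h (g n))"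
      unfolding UP_ops(3)[OF up] UP_ops(3)[OF closed[OF up(1)] closed[OF up(2)]] by simp
  next
    show "(\<lambda>n. h (\<one>\<^bsub>UP R\<^esub> n)) = \<one>\<^bsub>UP S\<^esub>" unfolding UP_ops by auto
  qed
qed

lemma (in ring_hom_cring) UP_map_monom:
  "a \<in> carrier R \<Longrightarrow> (\<lambda>n. h (up_ring.monom (UP R) a k n)) = up_ring.monom (UP S) (h a) k"
  by (auto simp: UP_ops)

text \<open>Same shape as \<open>component_proj\<close>, but for an arbitrary homomorphism, so that
  functoriality can be proved for general rings and specialized by unfolding.\<close>

definition root_ext_map ::
  "('a, 'm) ring_scheme \<Rightarrow> ('b, 'l) ring_scheme \<Rightarrow> ('a \<Rightarrow> 'b) \<Rightarrow> nat \<Rightarrow> 'a \<Rightarrow> (nat \<Rightarrow> 'a) set \<Rightarrow> (nat \<Rightarrow> 'b) set"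
  where
  "root_ext_map R S h p a B =
     the_elem ((\<lambda>f. root_ideal S p (h a) +>\<^bsub>UP S\<^esub> (\<lambda>n. h (f n))) ` B)"

lemma root_ext_zero: "\<zero>\<^bsub>root_ext R p a\<^esub> = root_ideal R p a"
  by (simp add: root_ext_def FactRing_def)

context ring_hom_cring
begin

text \<open>Coefficientwise application of \<open>h\<close> sends T^p - a to T^p - h a and thus one
  ideal into the other. All members of a coset then give the same target coset, so the image is the
  singleton that \<open>the_elem\<close> expects.\<close>

lemma root_ext_map_coset:
  assumes a: "a \<in> carrier R" and f: "f \<in> carrier (UP R)"
  shows "root_ext_map R S h p a (root_ideal R p a +>\<^bsub>UP R\<^esub> f) =
    root_ideal S p (h a) +>\<^bsub>UP S\<^esub> (\<lambda>n. h (f n))"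
proof -
  interpret P: UP_cring R "UP R" by (simp_all add: UP_cring_def R.is_cring)
  interpret Q: UP_cring S "UP S" by (simp_all add: UP_cring_def S.is_cring)
  interpret m: ring_hom_cring "UP R" "UP S" "\<lambda>f n. h (f n)" by (rule UP_map_hom)
  have ha: "h a \<in> carrier S" using a by simp
  interpret I: ideal "root_ideal R p a" "UP R" by (rule R.ideal_root_ideal[OF a])
  interpret J: ideal "root_ideal S p (h a)" "UP S" by (rule S.ideal_root_ideal[OF ha])
  interpret q: ring_hom_cring "UP S" "root_ext S p (h a)" "(+>\<^bsub>UP S\<^esub>) (root_ideal S p (h a))"
    by (rule S.root_ext_proj_hom[OF ha])
  let ?gR = "up_ring.monom (UP R) \<one> p \<ominus>\<^bsub>UP R\<^esub> up_ring.monom (UP R) a 0"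
  let ?gS = "up_ring.monom (UP S) \<one>\<^bsub>S\<^esub> p \<ominus>\<^bsub>UP S\<^esub> up_ring.monom (UP S) (h a) 0"
  have gen: "(\<lambda>n. h (?gR n)) = ?gS"
  proof -
    have "(\<lambda>n. h (?gR n)) = (\<lambda>n. h (up_ring.monom (UP R) \<one> p n)) \<ominus>\<^bsub>UP S\<^esub> (\<lambda>n. h (up_ring.monom (UP R) a 0 n))"
      using a m.hom_add[of "up_ring.monom (UP R) \<one> p" "\<ominus>\<^bsub>UP R\<^esub> up_ring.monom (UP R) a 0"]
        m.hom_a_inv[of "up_ring.monom (UP R) a 0"]
      unfolding P.P.minus_eq Q.P.minus_eq by simp
    then show ?thesis using a by (simp add: UP_map_monom)
  qed
  have img: "(\<lambda>n. h (i n)) \<in> root_ideal S p (h a)" if i: "i \<in> root_ideal R p a" for i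
  proof -
    obtain r where r: "r \<in> carrier (UP R)" "i = r \<otimes>\<^bsub>UP R\<^esub> ?gR"
      using i unfolding root_ideal_def cgenideal_def by blast
    have "(\<lambda>n. h (i n)) = (\<lambda>n. h (r n)) \<otimes>\<^bsub>UP S\<^esub> ?gS"
      unfolding r(2) using m.hom_mult[OF r(1) R.root_polynomial_closed[OF a, of p]] unfolding gen .
    then show ?thesis using m.hom_closed[OF r(1)] unfolding root_ideal_def cgenideal_def by blast
  qed
  have "root_ideal S p (h a) +>\<^bsub>UP S\<^esub> (\<lambda>n. h (f' n)) = root_ideal S p (h a) +>\<^bsub>UP S\<^esub> (\<lambda>n. h (f n))"
    if "f' \<in> root_ideal R p a +>\<^bsub>UP R\<^esub> f" for f'
  proof -
    obtain i where i: "i \<in> root_ideal R p a" "f' = i \<oplus>\<^bsub>UP R\<^esub> f"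
      using \<open>f' \<in> root_ideal R p a +>\<^bsub>UP R\<^esub> f\<close> unfolding a_r_coset_def' by auto
    have iP: "i \<in> carrier (UP R)" by (rule I.Icarr[OF i(1)])
    let ?i = "\<lambda>n. h (i n)" and ?f = "\<lambda>n. h (f n)" and ?J = "root_ideal S p (h a)"
    have "(\<lambda>n. h (f' n)) = ?i \<oplus>\<^bsub>UP S\<^esub> ?f"
      unfolding i(2) by (rule m.hom_add[OF iP f])
    then have "?J +>\<^bsub>UP S\<^esub> (\<lambda>n. h (f' n)) = ?J +>\<^bsub>UP S\<^esub> (?i \<oplus>\<^bsub>UP S\<^esub> ?f)" by (rule arg_cong)
    also have "\<dots> = (?J +>\<^bsub>UP S\<^esub> ?i) \<oplus>\<^bsub>root_ext S p (h a)\<^esub> (?J +>\<^bsub>UP S\<^esub> ?f)"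
      by (rule q.hom_add[OF m.hom_closed[OF iP] m.hom_closed[OF f]])
    also have "?J +>\<^bsub>UP S\<^esub> ?i = \<zero>\<^bsub>root_ext S p (h a)\<^esub>"
      unfolding root_ext_zero by (rule Q.P.a_rcos_zero[OF J.is_ideal img[OF i(1)]])
    finally show ?thesis
      unfolding q.S.l_zero[OF q.hom_closed[OF m.hom_closed[OF f]]] .
  qed
  moreover have "f \<in> root_ideal R p a +>\<^bsub>UP R\<^esub> f" by (rule I.a_rcos_self[OF f])
  ultimately have "(\<lambda>f. root_ideal S p (h a) +>\<^bsub>UP S\<^esub> (\<lambda>n. h (f n))) ` (root_ideal R p a +>\<^bsub>UP R\<^esub> f) =
    {root_ideal S p (h a) +>\<^bsub>UP S\<^esub> (\<lambda>n. h (f n))}" by blast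
  then show ?thesis by (simp add: root_ext_map_def)
qed

lemma root_ext_map_hom:
  assumes a: "a \<in> carrier R"
  shows "ring_hom_cring (root_ext R p a) (root_ext S p (h a)) (root_ext_map R S h p a)"
proof -
  interpret P: UP_cring R "UP R" by (simp_all add: UP_cring_def R.is_cring)
  have ha: "h a \<in> carrier S" using a by simp
  interpret m: ring_hom_cring "UP R" "UP S" "\<lambda>f n. h (f n)" by (rule UP_map_hom)
  interpret r: ring_hom_cring "UP R" "root_ext R p a" "(+>\<^bsub>UP R\<^esub>) (root_ideal R p a)"
    by (rule R.root_ext_proj_hom[OF a])
  interpret q: ring_hom_cring "UP S" "root_ext S p (h a)" "(+>\<^bsub>UP S\<^esub>) (root_ideal S p (h a))"
    by (rule S.root_ext_proj_hom[OF ha])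
  note coset = root_ext_map_coset[OF a, of _ p]
  show ?thesis
  proof (rule ring_hom_cringI[OF r.S.is_cring q.S.is_cring], rule ring_hom_memI)
    fix \<beta> assume "\<beta> \<in> carrier (root_ext R p a)"
    then obtain f where f: "f \<in> carrier (UP R)" "\<beta> = root_ideal R p a +>\<^bsub>UP R\<^esub> f"
      by (rule R.root_ext_coset[OF a])
    show "root_ext_map R S h p a \<beta> \<in> carrier (root_ext S p (h a))"
      unfolding f(2) coset[OF f(1)] by (rule q.hom_closed[OF m.hom_closed[OF f(1)]])
    fix \<gamma> assume "\<gamma> \<in> carrier (root_ext R p a)"
    then obtain g where g: "g \<in> carrier (UP R)" "\<gamma> = root_ideal R p a +>\<^bsub>UP R\<^esub> g"
      by (rule R.root_ext_coset[OF a])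
    show "root_ext_map R S h p a (\<beta> \<otimes>\<^bsub>root_ext R p a\<^esub> \<gamma>) =
      root_ext_map R S h p a \<beta> \<otimes>\<^bsub>root_ext S p (h a)\<^esub> root_ext_map R S h p a \<gamma>"
      unfolding f(2) g(2) r.hom_mult[OF f(1) g(1), symmetric] coset[OF f(1)] coset[OF g(1)]
        coset[OF P.P.m_closed[OF f(1) g(1)]] m.hom_mult[OF f(1) g(1)]
      by (rule q.hom_mult[OF m.hom_closed[OF f(1)] m.hom_closed[OF g(1)]])
    show "root_ext_map R S h p a (\<beta> \<oplus>\<^bsub>root_ext R p a\<^esub> \<gamma>) =
      root_ext_map R S h p a \<beta> \<oplus>\<^bsub>root_ext S p (h a)\<^esub> root_ext_map R S h p a \<gamma>"
      unfolding f(2) g(2) r.hom_add[OF f(1) g(1), symmetric] coset[OF f(1)] coset[OF g(1)]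
        coset[OF P.P.a_closed[OF f(1) g(1)]] m.hom_add[OF f(1) g(1)]
      by (rule q.hom_add[OF m.hom_closed[OF f(1)] m.hom_closed[OF g(1)]])
  next
    show "root_ext_map R S h p a \<one>\<^bsub>root_ext R p a\<^esub> = \<one>\<^bsub>root_ext S p (h a)\<^esub>"
      unfolding r.hom_one[symmetric] coset[OF P.P.one_closed] m.hom_one by (rule q.hom_one)
  qed
qed

lemma root_ext_map_emb:
  "a \<in> carrier R \<Longrightarrow> c \<in> carrier R \<Longrightarrow>
    root_ext_map R S h p a (root_ext_emb R p a c) = root_ext_emb S p (h a) (h c)"
proof -
  interpret P: UP_cring R "UP R" by (simp_all add: UP_cring_def R.is_cring)
  show "a \<in> carrier R \<Longrightarrow> c \<in> carrier R \<Longrightarrow> ?thesis"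
    by (simp add: root_ext_emb_def root_ext_map_coset UP_map_monom)
qed

lemma root_ext_map_gen:
  "a \<in> carrier R \<Longrightarrow> root_ext_map R S h p a (R.root_gen p a) = S.root_gen p (h a)"
proof -
  interpret P: UP_cring R "UP R" by (simp_all add: UP_cring_def R.is_cring)
  show "a \<in> carrier R \<Longrightarrow> ?thesis"
    by (simp add: R.root_gen_def S.root_gen_def root_ext_map_coset UP_map_monom del: One_nat_def)
qed

end

section \<open>Automorphisms of the root extension\<close>

lemma root_ext_aut_carrier:
  "g \<in> carrier (root_ext_aut R p a) \<longleftrightarrow>
     g \<in> ring_hom (root_ext R p a) (root_ext R p a) \<and> g \<in> Bij (carrier (root_ext R p a)) \<and>
     (\<forall>c\<in>carrier R. g (root_ext_emb R p a c) = root_ext_emb R p a c)"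
  by (auto simp: root_ext_aut_def Let_def)

lemma (in cring) group_root_ext_aut:
  assumes a: "a \<in> carrier R"
  shows "group (root_ext_aut R p a)"
proof -
  let ?E = "root_ext R p a" and ?e = "root_ext_emb R p a"
  let ?H = "{g \<in> ring_hom ?E ?E \<inter> Bij (carrier ?E). \<forall>c\<in>carrier R. g (?e c) = ?e c}"
  interpret e: ring_hom_cring R ?E ?e by (rule root_ext_emb_hom[OF a])
  interpret B: group "BijGroup (carrier ?E)" by (rule group_BijGroup)
  have "subgroup ?H (BijGroup (carrier ?E))"
  proof (rule B.subgroupI)
    show "?H \<subseteq> carrier (BijGroup (carrier ?E))" by (auto simp: BijGroup_def)
    have "(\<lambda>x\<in>carrier ?E. x) \<in> ?H"
      by (auto simp: id_Bij intro!: ring_hom_memI)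
    then show "?H \<noteq> {}" by blast
  next
    fix g k assume gk: "g \<in> ?H" "k \<in> ?H"
    interpret g: ring_hom_cring ?E ?E g using gk(1) by (intro ring_hom_cringI e.S.is_cring) auto
    interpret k: ring_hom_cring ?E ?E k using gk(2) by (intro ring_hom_cringI e.S.is_cring) auto
    have "compose (carrier ?E) g k \<in> ?H"
      using gk compose_Bij[of g "carrier ?E" k]
      by (auto simp: compose_def intro!: ring_hom_memI)
    then show "g \<otimes>\<^bsub>BijGroup (carrier ?E)\<^esub> k \<in> ?H" using gk by (simp add: BijGroup_def)
  next
    fix g assume g: "g \<in> ?H"
    interpret g: ring_hom_cring ?E ?E g using g by (intro ring_hom_cringI e.S.is_cring) auto
    let ?i = "inv_into (carrier ?E) g"
    have bij: "bij_betw g (carrier ?E) (carrier ?E)" using g by (auto simp: Bij_def)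
    have i: "?i x \<in> carrier ?E" "g (?i x) = x" if "x \<in> carrier ?E" for x
      using that bij by (auto simp: bij_betw_def inv_into_into f_inv_into_f)
    have ig: "?i (g x) = x" if "x \<in> carrier ?E" for x
      using that bij by (simp add: bij_betw_def inv_into_f_f)
    have "(\<lambda>x\<in>carrier ?E. ?i x) \<in> ring_hom ?E ?E"
    proof (rule ring_hom_memI)
      fix x y assume xy: "x \<in> carrier ?E" "y \<in> carrier ?E"
      have "?i (x \<otimes>\<^bsub>?E\<^esub> y) = ?i (g (?i x \<otimes>\<^bsub>?E\<^esub> ?i y))" "?i (x \<oplus>\<^bsub>?E\<^esub> y) = ?i (g (?i x \<oplus>\<^bsub>?E\<^esub> ?i y))"
        using xy i by simp_all
      then have "?i (x \<otimes>\<^bsub>?E\<^esub> y) = ?i x \<otimes>\<^bsub>?E\<^esub> ?i y" "?i (x \<oplus>\<^bsub>?E\<^esub> y) = ?i x \<oplus>\<^bsub>?E\<^esub> ?i y"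
        using xy i ig[of "?i x \<otimes>\<^bsub>?E\<^esub> ?i y"] ig[of "?i x \<oplus>\<^bsub>?E\<^esub> ?i y"] by (simp_all del: g.hom_mult g.hom_add)
      then show "(\<lambda>x\<in>carrier ?E. ?i x) (x \<otimes>\<^bsub>?E\<^esub> y) = (\<lambda>x\<in>carrier ?E. ?i x) x \<otimes>\<^bsub>?E\<^esub> (\<lambda>x\<in>carrier ?E. ?i x) y"
        "(\<lambda>x\<in>carrier ?E. ?i x) (x \<oplus>\<^bsub>?E\<^esub> y) = (\<lambda>x\<in>carrier ?E. ?i x) x \<oplus>\<^bsub>?E\<^esub> (\<lambda>x\<in>carrier ?E. ?i x) y"
        using xy by simp_all
    next
      show "(\<lambda>x\<in>carrier ?E. ?i x) \<one>\<^bsub>?E\<^esub> = \<one>\<^bsub>?E\<^esub>" using ig[of "\<one>\<^bsub>?E\<^esub>"] by simp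
    qed (use i in auto)
    moreover have "(\<lambda>x\<in>carrier ?E. ?i x) (?e c) = ?e c" if "c \<in> carrier R" for c
      using g ig[of "?e c"] that by simp
    moreover have "g \<in> Bij (carrier ?E)" using g by blast
    ultimately show "inv\<^bsub>BijGroup (carrier ?E)\<^esub> g \<in> ?H"
      by (auto simp: inv_BijGroup restrict_inv_into_Bij)
  qed
  from B.subgroup_imp_group[OF this] show ?thesis by (simp add: root_ext_aut_def Let_def)
qed

text \<open>
  The model: \<open>R\<close> is the ring of adeles, \<open>S\<close> the field at one place, \<open>h\<close> the projection and \<open>\<delta>\<close>
  the adele that is \<open>1\<close> at this place and \<open>0\<close> elsewhere. Automorphisms fix \<open>\<delta>\<close>, so they
  descend along \<open>h\<close>.
\<close>

locale split_projection = ring_hom_cring +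
  fixes \<delta>
  assumes idem_closed: "\<delta> \<in> carrier R" and hom_idem: "h \<delta> = \<one>\<^bsub>S\<^esub>"
    and idem_kernel: "\<And>a. a \<in> carrier R \<Longrightarrow> h a = \<zero>\<^bsub>S\<^esub> \<Longrightarrow> \<delta> \<otimes> a = \<zero>"
    and idem_lift: "\<And>c. c \<in> carrier S \<Longrightarrow> \<exists>a\<in>carrier R. h a = c \<and> \<delta> \<otimes> a = a"
begin

lemma idem_lift_family:
  assumes "c \<in> {..<p::nat} \<rightarrow> carrier S"
  shows "\<exists>b. \<forall>i\<in>{..<p}. b i \<in> carrier R \<and> h (b i) = c i \<and> \<delta> \<otimes> b i = b i"
proof (rule bchoice)
  show "\<forall>i\<in>{..<p}. \<exists>b. b \<in> carrier R \<and> h b = c i \<and> \<delta> \<otimes> b = b"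
    using idem_lift assms by blast
qed

context
  fixes p :: nat and a
  assumes a: "a \<in> carrier R" and p: "p > 0"
begin

interpretation e: ring_hom_cring R "root_ext R p a" "root_ext_emb R p a"
  by (rule R.root_ext_emb_hom[OF a])

interpretation f: ring_hom_cring S "root_ext S p (h a)" "root_ext_emb S p (h a)"
  by (rule S.root_ext_emb_hom) (simp add: a)

interpretation pr: ring_hom_cring "root_ext R p a" "root_ext S p (h a)" "root_ext_map R S h p a"
  by (rule root_ext_map_hom[OF a])

lemma map_lin_comb:
  assumes "y \<in> carrier (root_ext R p a)" "b \<in> {..<p} \<rightarrow> carrier R"
  shows "root_ext_map R S h p a (e.lin_comb p y b) = f.lin_comb p (root_ext_map R S h p a y) (\<lambda>i. h (b i))"
proof -
  have "root_ext_map R S h p a (e.lin_comb p y b) =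
    finsum (root_ext S p (h a)) (root_ext_map R S h p a \<circ>
      (\<lambda>i. root_ext_emb R p a (b i) \<otimes>\<^bsub>root_ext R p a\<^esub> y [^]\<^bsub>root_ext R p a\<^esub> i)) {..<p}"
    using assms by (intro pr.hom_finsum) (auto simp: Pi_iff)
  also have "\<dots> = f.lin_comb p (root_ext_map R S h p a y) (\<lambda>i. h (b i))"
    using assms a by (intro f.S.finsum_cong') (auto simp: Pi_iff root_ext_map_emb)
  finally show ?thesis .
qed

lemma root_ext_map_surj:
  assumes "\<gamma> \<in> carrier (root_ext S p (h a))"
  shows "\<exists>\<beta>\<in>carrier (root_ext R p a). root_ext_map R S h p a \<beta> = \<gamma>"
proof -
  have y: "R.root_gen p a \<in> carrier (root_ext R p a)"
    using e.power_basis_closed[OF R.power_basis_root_gen[OF a p]] .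
  have ha: "h a \<in> carrier S" using a by simp
  obtain c where c: "c \<in> {..<p} \<rightarrow> carrier S" "\<gamma> = f.lin_comb p (S.root_gen p (h a)) c"
    using f.power_basis_gen[OF S.power_basis_root_gen[OF ha p] assms] .
  obtain b where lift: "\<forall>i\<in>{..<p}. b i \<in> carrier R \<and> h (b i) = c i \<and> \<delta> \<otimes> b i = b i"
    using idem_lift_family[OF c(1)] by (rule exE)
  have b: "b i \<in> carrier R" "h (b i) = c i" "\<delta> \<otimes> b i = b i" if "i < p" for i
    using lift that by auto
  have bR: "b \<in> {..<p} \<rightarrow> carrier R" using b by auto
  have "root_ext_map R S h p a (e.lin_comb p (R.root_gen p a) b) = f.lin_comb p (S.root_gen p (h a)) (\<lambda>i. h (b i))"
    unfolding map_lin_comb[OF y bR] root_ext_map_gen[OF a] ..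
  also have "\<dots> = \<gamma>"
    unfolding c(2) using b c(1) f.power_basis_closed[OF S.power_basis_root_gen[OF ha p]]
    by (intro f.lin_comb_cong) auto
  finally show ?thesis using e.lin_comb_closed[OF y bR] by blast
qed

text \<open>Both conditions are read on the coefficients in the basis of powers of the adjoined
  root, where they say that \<open>h\<close> kills the coefficient and that \<open>\<delta>\<close>
  does. The kernel is thus described inside the source algebra.\<close>

lemma root_ext_map_zero_iff:
  assumes "\<beta> \<in> carrier (root_ext R p a)"
  shows "root_ext_map R S h p a \<beta> = \<zero>\<^bsub>root_ext S p (h a)\<^esub> \<longleftrightarrow>
    root_ext_emb R p a \<delta> \<otimes>\<^bsub>root_ext R p a\<^esub> \<beta> = \<zero>\<^bsub>root_ext R p a\<^esub>"
proof
  assume z: "root_ext_emb R p a \<delta> \<otimes>\<^bsub>root_ext R p a\<^esub> \<beta> = \<zero>\<^bsub>root_ext R p a\<^esub>"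
  have "root_ext_map R S h p a \<beta> = root_ext_map R S h p a (root_ext_emb R p a \<delta> \<otimes>\<^bsub>root_ext R p a\<^esub> \<beta>)"
    using assms a idem_closed by (simp add: root_ext_map_emb hom_idem)
  then show "root_ext_map R S h p a \<beta> = \<zero>\<^bsub>root_ext S p (h a)\<^esub>" unfolding z by simp
next
  assume z: "root_ext_map R S h p a \<beta> = \<zero>\<^bsub>root_ext S p (h a)\<^esub>"
  have ha: "h a \<in> carrier S" using a by simp
  note bR = R.power_basis_root_gen[OF a p] and bS = S.power_basis_root_gen[OF ha p]
  have y: "R.root_gen p a \<in> carrier (root_ext R p a)" by (rule e.power_basis_closed[OF bR])
  have y': "S.root_gen p (h a) \<in> carrier (root_ext S p (h a))" by (rule f.power_basis_closed[OF bS])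
  obtain b where b: "b \<in> {..<p} \<rightarrow> carrier R" "\<beta> = e.lin_comb p (R.root_gen p a) b"
    using e.power_basis_gen[OF bR assms] .
  have zero: "f.lin_comb p (S.root_gen p (h a)) (\<lambda>i. \<zero>\<^bsub>S\<^esub>) = \<zero>\<^bsub>root_ext S p (h a)\<^esub>"
    using f.lin_comb_single[OF y' S.zero_closed p] y' by simp
  have zeroR: "e.lin_comb p (R.root_gen p a) (\<lambda>i. \<zero>) = \<zero>\<^bsub>root_ext R p a\<^esub>"
    using e.lin_comb_single[OF y R.zero_closed p] y by simp
  have "f.lin_comb p (S.root_gen p (h a)) (\<lambda>i. h (b i)) = f.lin_comb p (S.root_gen p (h a)) (\<lambda>i. \<zero>\<^bsub>S\<^esub>)"
    using z unfolding b(2) map_lin_comb[OF y b(1)] root_ext_map_gen[OF a] zero .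
  then have "h (b i) = \<zero>\<^bsub>S\<^esub>" if "i < p" for i
    using f.power_basis_indep[OF bS, of "\<lambda>i. h (b i)" "\<lambda>i. \<zero>\<^bsub>S\<^esub>" i] b(1) that by (auto simp: Pi_iff)
  then have "\<delta> \<otimes> b i = \<zero>" if "i < p" for i
    using idem_kernel[of "b i"] b(1) that by auto
  then have "e.lin_comb p (R.root_gen p a) (\<lambda>i. \<delta> \<otimes> b i) = e.lin_comb p (R.root_gen p a) (\<lambda>i. \<zero>)"
    by (intro e.lin_comb_cong y) auto
  then show "root_ext_emb R p a \<delta> \<otimes>\<^bsub>root_ext R p a\<^esub> \<beta> = \<zero>\<^bsub>root_ext R p a\<^esub>"
    unfolding b(2) e.lin_comb_smult[OF y b(1) idem_closed] zeroR .
qed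

lemma root_ext_map_eq_iff:
  assumes "\<beta> \<in> carrier (root_ext R p a)" "\<gamma> \<in> carrier (root_ext R p a)"
  shows "root_ext_map R S h p a \<beta> = root_ext_map R S h p a \<gamma> \<longleftrightarrow>
    root_ext_emb R p a \<delta> \<otimes>\<^bsub>root_ext R p a\<^esub> \<beta> = root_ext_emb R p a \<delta> \<otimes>\<^bsub>root_ext R p a\<^esub> \<gamma>"
proof -
  have d: "root_ext_emb R p a \<delta> \<in> carrier (root_ext R p a)" using idem_closed by simp
  have "root_ext_map R S h p a \<beta> = root_ext_map R S h p a \<gamma> \<longleftrightarrow>
    root_ext_map R S h p a (\<beta> \<ominus>\<^bsub>root_ext R p a\<^esub> \<gamma>) = \<zero>\<^bsub>root_ext S p (h a)\<^esub>"
    using assms f.S.r_right_minus_eq by (simp add: e.S.minus_eq f.S.minus_eq)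
  also have "\<dots> \<longleftrightarrow> root_ext_emb R p a \<delta> \<otimes>\<^bsub>root_ext R p a\<^esub> (\<beta> \<ominus>\<^bsub>root_ext R p a\<^esub> \<gamma>) = \<zero>\<^bsub>root_ext R p a\<^esub>"
    using assms by (intro root_ext_map_zero_iff) auto
  also have "\<dots> \<longleftrightarrow> root_ext_emb R p a \<delta> \<otimes>\<^bsub>root_ext R p a\<^esub> \<beta> = root_ext_emb R p a \<delta> \<otimes>\<^bsub>root_ext R p a\<^esub> \<gamma>"
    using assms d e.S.r_right_minus_eq[of "root_ext_emb R p a \<delta> \<otimes>\<^bsub>root_ext R p a\<^esub> \<beta>" "root_ext_emb R p a \<delta> \<otimes>\<^bsub>root_ext R p a\<^esub> \<gamma>"]
    by (simp add: e.S.minus_eq e.S.r_distr e.S.r_minus)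
  finally show ?thesis .
qed

text \<open>Generation follows from surjectivity. For independence, coefficients are lifted to
  elements fixed by \<open>\<delta>\<close>; equality after projection becomes equality after
  multiplication by \<open>\<delta>\<close>, which changes nothing on these lifts.\<close>

lemma power_basis_map:
  assumes y: "power_basis R (root_ext R p a) (root_ext_emb R p a) p y"
  shows "power_basis S (root_ext S p (h a)) (root_ext_emb S p (h a)) p (root_ext_map R S h p a y)"
proof (rule f.power_basisI)
  have yE: "y \<in> carrier (root_ext R p a)" by (rule e.power_basis_closed[OF y])
  then show yF: "root_ext_map R S h p a y \<in> carrier (root_ext S p (h a))" by simp
  {
    fix \<gamma> assume "\<gamma> \<in> carrier (root_ext S p (h a))"
    then obtain \<beta> where \<beta>: "\<beta> \<in> carrier (root_ext R p a)" "root_ext_map R S h p a \<beta> = \<gamma>"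
      using root_ext_map_surj by blast
    obtain b where b: "b \<in> {..<p} \<rightarrow> carrier R" "\<beta> = e.lin_comb p y b" using e.power_basis_gen[OF y \<beta>(1)] .
    have "\<gamma> = f.lin_comb p (root_ext_map R S h p a y) (\<lambda>i. h (b i))"
      using \<beta>(2) unfolding b(2) map_lin_comb[OF yE b(1)] by simp
    then show "\<exists>b\<in>{..<p} \<rightarrow> carrier S. \<gamma> = f.lin_comb p (root_ext_map R S h p a y) b"
      using b(1) by (intro bexI[of _ "\<lambda>i. h (b i)"]) auto
  }
  fix b c i assume bc: "b \<in> {..<p} \<rightarrow> carrier S" "c \<in> {..<p} \<rightarrow> carrier S"
    "f.lin_comb p (root_ext_map R S h p a y) b = f.lin_comb p (root_ext_map R S h p a y) c" and i: "i < p"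
  obtain b' where lift: "\<forall>i\<in>{..<p}. b' i \<in> carrier R \<and> h (b' i) = b i \<and> \<delta> \<otimes> b' i = b' i"
    using idem_lift_family[OF bc(1)] by (rule exE)
  have b': "b' i \<in> carrier R" "h (b' i) = b i" "\<delta> \<otimes> b' i = b' i" if "i < p" for i
    using lift that by auto
  obtain c' where lift: "\<forall>i\<in>{..<p}. c' i \<in> carrier R \<and> h (c' i) = c i \<and> \<delta> \<otimes> c' i = c' i"
    using idem_lift_family[OF bc(2)] by (rule exE)
  have c': "c' i \<in> carrier R" "h (c' i) = c i" "\<delta> \<otimes> c' i = c' i" if "i < p" for i
    using lift that by auto
  have R: "b' \<in> {..<p} \<rightarrow> carrier R" "c' \<in> {..<p} \<rightarrow> carrier R" using b' c' by auto
  have "f.lin_comb p (root_ext_map R S h p a y) (\<lambda>i. h (b' i)) = f.lin_comb p (root_ext_map R S h p a y) b"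
    using b' bc by (intro f.lin_comb_cong yF) auto
  moreover have "f.lin_comb p (root_ext_map R S h p a y) (\<lambda>i. h (c' i)) = f.lin_comb p (root_ext_map R S h p a y) c"
    using c' bc by (intro f.lin_comb_cong yF) auto
  ultimately have "root_ext_map R S h p a (e.lin_comb p y b') = root_ext_map R S h p a (e.lin_comb p y c')"
    unfolding map_lin_comb[OF yE R(1)] map_lin_comb[OF yE R(2)] using bc(3) by simp
  then have "e.lin_comb p y (\<lambda>i. \<delta> \<otimes> b' i) = e.lin_comb p y (\<lambda>i. \<delta> \<otimes> c' i)"
    unfolding root_ext_map_eq_iff[OF e.lin_comb_closed[OF yE R(1)] e.lin_comb_closed[OF yE R(2)]]
      e.lin_comb_smult[OF yE R(1) idem_closed] e.lin_comb_smult[OF yE R(2) idem_closed] .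
  then have "\<delta> \<otimes> b' i = \<delta> \<otimes> c' i"
    using R i idem_closed by (intro e.power_basis_indep[OF y, of "\<lambda>i. \<delta> \<otimes> b' i" "\<lambda>i. \<delta> \<otimes> c' i"]) auto
  then show "b i = c i" using b'[OF i] c'[OF i] by metis
qed

text \<open>Surjectivity of the projection and extensionality give uniqueness, as required by the
  definite description in \<open>component_aut\<close>. Existence rests on the relation of having
  equal projections being respected by \<open>g\<close> in both directions.\<close>

lemma component_automorphism:
  assumes g: "g \<in> carrier (root_ext_aut R p a)"
  shows "\<exists>!k. k \<in> carrier (root_ext_aut S p (h a)) \<and>
    (\<forall>\<beta>\<in>carrier (root_ext R p a). k (root_ext_map R S h p a \<beta>) = root_ext_map R S h p a (g \<beta>))"
proof -
  let ?E = "root_ext R p a" and ?F = "root_ext S p (h a)" and ?m = "root_ext_map R S h p a"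
    and ?d = "root_ext_emb R p a \<delta>"
  have g': "g \<in> ring_hom ?E ?E" "g \<in> Bij (carrier ?E)"
    "\<And>c. c \<in> carrier R \<Longrightarrow> g (root_ext_emb R p a c) = root_ext_emb R p a c"
    using g unfolding root_ext_aut_carrier by auto
  interpret g: ring_hom_cring ?E ?E g by (rule ring_hom_cringI[OF e.S.is_cring e.S.is_cring g'(1)])
  have bij: "inj_on g (carrier ?E)" "g ` carrier ?E = carrier ?E"
    using g'(2) by (auto simp: Bij_def bij_betw_def)
  have d: "?d \<in> carrier ?E" "g ?d = ?d" using idem_closed g'(3) by auto
  \<comment> \<open>Equal projections mean equality after multiplication by \<open>?d\<close>, which
    \<open>g\<close> fixes. Since \<open>g\<close> is injective, this gives both well-definedness
    and injectivity of the induced map.\<close>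
  have eq: "?m (g \<beta>) = ?m (g \<gamma>) \<longleftrightarrow> ?m \<beta> = ?m \<gamma>" if "\<beta> \<in> carrier ?E" "\<gamma> \<in> carrier ?E" for \<beta> \<gamma>
  proof -
    have "?m (g \<beta>) = ?m (g \<gamma>) \<longleftrightarrow> g (?d \<otimes>\<^bsub>?E\<^esub> \<beta>) = g (?d \<otimes>\<^bsub>?E\<^esub> \<gamma>)"
      using that d root_ext_map_eq_iff[of "g \<beta>" "g \<gamma>"] by simp
    also have "\<dots> \<longleftrightarrow> ?d \<otimes>\<^bsub>?E\<^esub> \<beta> = ?d \<otimes>\<^bsub>?E\<^esub> \<gamma>"
      using that d bij(1) e.S.m_closed by (metis inj_onD)
    finally show ?thesis using root_ext_map_eq_iff that by blast
  qed
  define l where "l \<gamma> = (SOME \<beta>. \<beta> \<in> carrier ?E \<and> ?m \<beta> = \<gamma>)" for \<gamma>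
  have l: "l \<gamma> \<in> carrier ?E" "?m (l \<gamma>) = \<gamma>" if "\<gamma> \<in> carrier ?F" for \<gamma>
    using someI_ex[of "\<lambda>\<beta>. \<beta> \<in> carrier ?E \<and> ?m \<beta> = \<gamma>"] root_ext_map_surj[OF that] unfolding l_def by blast+
  define k where "k = (\<lambda>\<gamma>\<in>carrier ?F. ?m (g (l \<gamma>)))"
  have k: "k (?m \<beta>) = ?m (g \<beta>)" if "\<beta> \<in> carrier ?E" for \<beta>
    using that l[of "?m \<beta>"] eq[of "l (?m \<beta>)" \<beta>] by (simp add: k_def)
  have khom: "k \<in> ring_hom ?F ?F"
  proof (rule ring_hom_memI)
    fix \<gamma> assume "\<gamma> \<in> carrier ?F"
    then obtain \<beta> where \<beta>: "\<beta> \<in> carrier ?E" "?m \<beta> = \<gamma>" using root_ext_map_surj by blast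
    show "k \<gamma> \<in> carrier ?F" using k[OF \<beta>(1)] \<beta> by simp
    fix \<gamma>' assume "\<gamma>' \<in> carrier ?F"
    then obtain \<beta>' where \<beta>': "\<beta>' \<in> carrier ?E" "?m \<beta>' = \<gamma>'" using root_ext_map_surj by blast
    show "k (\<gamma> \<otimes>\<^bsub>?F\<^esub> \<gamma>') = k \<gamma> \<otimes>\<^bsub>?F\<^esub> k \<gamma>'"
      using k[OF \<beta>(1)] k[OF \<beta>'(1)] k[OF e.S.m_closed[OF \<beta>(1) \<beta>'(1)]] \<beta> \<beta>' by simp
    show "k (\<gamma> \<oplus>\<^bsub>?F\<^esub> \<gamma>') = k \<gamma> \<oplus>\<^bsub>?F\<^esub> k \<gamma>'"
      using k[OF \<beta>(1)] k[OF \<beta>'(1)] k[OF e.S.a_closed[OF \<beta>(1) \<beta>'(1)]] \<beta> \<beta>' by simp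
  next
    show "k \<one>\<^bsub>?F\<^esub> = \<one>\<^bsub>?F\<^esub>" using k[OF e.S.one_closed] by simp
  qed
  have kinj: "inj_on k (carrier ?F)"
  proof (rule inj_onI)
    fix \<gamma> \<gamma>' assume c: "\<gamma> \<in> carrier ?F" "\<gamma>' \<in> carrier ?F" "k \<gamma> = k \<gamma>'"
    then show "\<gamma> = \<gamma>'" using eq[OF l(1)[OF c(1)] l(1)[OF c(2)]] l(2) by (simp add: k_def)
  qed
  have ksurj: "k ` carrier ?F = carrier ?F"
  proof (intro equalityI subsetI)
    fix \<gamma> assume "\<gamma> \<in> carrier ?F"
    then obtain \<beta> where \<beta>: "\<beta> \<in> carrier ?E" "?m \<beta> = \<gamma>" using root_ext_map_surj by blast
    have "\<beta> \<in> g ` carrier ?E" unfolding bij(2) by (rule \<beta>(1))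
    then obtain \<beta>' where \<beta>': "\<beta> = g \<beta>'" "\<beta>' \<in> carrier ?E" by (rule imageE)
    have "\<gamma> = k (?m \<beta>')" unfolding k[OF \<beta>'(2)] \<beta>'(1)[symmetric] \<beta>(2) ..
    then show "\<gamma> \<in> k ` carrier ?F" using pr.hom_closed[OF \<beta>'(2)] by (rule image_eqI)
  qed (use khom in \<open>auto simp: ring_hom_def\<close>)
  have "k \<in> Bij (carrier ?F)" using kinj ksurj by (simp add: Bij_def bij_betw_def k_def)
  moreover have "k (root_ext_emb S p (h a) c) = root_ext_emb S p (h a) c" if "c \<in> carrier S" for c
  proof -
    obtain b where b: "b \<in> carrier R" "h b = c" using idem_lift[OF \<open>c \<in> carrier S\<close>] by blast
    show ?thesis using k[OF e.hom_closed[OF b(1)]] g'(3)[OF b(1)] root_ext_map_emb[OF a b(1)] b(2) by simp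
  qed
  ultimately have kaut: "k \<in> carrier (root_ext_aut S p (h a))"
    unfolding root_ext_aut_carrier using khom by blast
  show ?thesis
  proof (rule ex1I[of _ k])
    show "k \<in> carrier (root_ext_aut S p (h a)) \<and> (\<forall>\<beta>\<in>carrier ?E. k (?m \<beta>) = ?m (g \<beta>))"
      using kaut k by blast
    fix k' assume k': "k' \<in> carrier (root_ext_aut S p (h a)) \<and> (\<forall>\<beta>\<in>carrier ?E. k' (?m \<beta>) = ?m (g \<beta>))"
    show "k' = k"
    proof (rule extensionalityI)
      show "k' \<in> extensional (carrier ?F)" using k' unfolding root_ext_aut_carrier by (auto simp: Bij_def)
      show "k \<in> extensional (carrier ?F)" by (simp add: k_def)
      fix \<gamma> assume "\<gamma> \<in> carrier ?F"
      then obtain \<beta> where "\<beta> \<in> carrier ?E" "?m \<beta> = \<gamma>" using root_ext_map_surj by blast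
      then show "k' \<gamma> = k \<gamma>" using k k' by auto
    qed
  qed
qed

end
end

section \<open>Polynomial functions and the vanishing ideal\<close>

definition monomial_eval :: "('n::finite \<Rightarrow> 'k::field) \<Rightarrow> ('n \<Rightarrow>\<^sub>0 nat) \<Rightarrow> 'k" where
  "monomial_eval v m = (\<Prod>i\<in>UNIV. v i ^ Poly_Mapping.lookup m i)"

definition total_degree :: "('n::finite \<Rightarrow>\<^sub>0 nat) \<Rightarrow> nat" where
  "total_degree m = (\<Sum>i\<in>UNIV. Poly_Mapping.lookup m i)"

lemma mpoly_eval_alt:
  "mpoly_eval v f = (\<Sum>m\<in>Poly_Mapping.keys f. Poly_Mapping.lookup f m * monomial_eval v m)"
  by (simp add: mpoly_eval_def monomial_eval_def)

lemma homogeneous_alt: "homogeneous d f \<longleftrightarrow> (\<forall>m\<in>Poly_Mapping.keys f. total_degree m = d)"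
  by (simp add: homogeneous_def total_degree_def)

lemma monomial_eval_add: "monomial_eval v (m + n) = monomial_eval v m * monomial_eval v n"
  by (simp add: monomial_eval_def lookup_add power_add prod.distrib)

lemma monomial_eval_0 [simp]: "monomial_eval v 0 = 1"
  by (simp add: monomial_eval_def)

lemma monomial_eval_scale: "monomial_eval (\<lambda>i. c * v i) m = c ^ total_degree m * monomial_eval v m"
  by (simp add: monomial_eval_def total_degree_def power_mult_distrib prod.distrib power_sum)

lemma total_degree_add: "total_degree (m + n) = total_degree m + total_degree n"
  by (simp add: total_degree_def lookup_add sum.distrib)

lemma total_degree_single [simp]: "total_degree (Poly_Mapping.single i (n::nat)) = n"
  by (simp add: total_degree_def lookup_single when_def)

lemma total_degree_0 [simp]: "total_degree 0 = 0"
  by (simp add: total_degree_def)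

lemma mpoly_eval_add [simp]: "mpoly_eval v (f + g) = mpoly_eval v f + mpoly_eval v g"
  unfolding mpoly_eval_alt by (intro setsum_keys_plus_distrib) (auto simp: algebra_simps)

lemma mpoly_eval_0 [simp]: "mpoly_eval v 0 = 0"
  by (simp add: mpoly_eval_alt)

lemma mpoly_eval_uminus [simp]: "mpoly_eval v (- f) = - mpoly_eval v f"
  using mpoly_eval_add[of v f "- f"] by (simp add: eq_neg_iff_add_eq_0 add.commute)

lemma mpoly_eval_diff [simp]: "mpoly_eval v (f - g) = mpoly_eval v f - mpoly_eval v g"
  using mpoly_eval_add[of v f "- g"] by simp

lemma mpoly_eval_sum [simp]: "mpoly_eval v (\<Sum>i\<in>A. f i) = (\<Sum>i\<in>A. mpoly_eval v (f i))"
  by (induction A rule: infinite_finite_induct) auto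

lemma mpoly_eval_single [simp]: "mpoly_eval v (Poly_Mapping.single m a) = a * monomial_eval v m"
  by (cases "a = 0") (auto simp: mpoly_eval_alt)

lemma poly_mapping_sum_single:
  fixes f :: "'a \<Rightarrow>\<^sub>0 'b::comm_monoid_add"
  shows "f = (\<Sum>m\<in>Poly_Mapping.keys f. Poly_Mapping.single m (Poly_Mapping.lookup f m))"
  by (rule poly_mapping_eqI)
    (auto simp: lookup_sum lookup_single when_def sum.delta in_keys_iff intro: sum.neutral)

lemma mpoly_eval_mult [simp]: "mpoly_eval v (f * g) = mpoly_eval v f * mpoly_eval v g"
proof -
  let ?K = "Poly_Mapping.keys" and ?l = "Poly_Mapping.lookup" and ?s = "Poly_Mapping.single"
  have "f * g = (\<Sum>m\<in>?K f. ?s m (?l f m)) * (\<Sum>n\<in>?K g. ?s n (?l g n))"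
    using poly_mapping_sum_single[of f] poly_mapping_sum_single[of g] by simp
  also have "\<dots> = (\<Sum>m\<in>?K f. \<Sum>n\<in>?K g. ?s (m + n) (?l f m * ?l g n))"
    by (simp add: sum_product mult_single)
  finally have "mpoly_eval v (f * g) =
    (\<Sum>m\<in>?K f. \<Sum>n\<in>?K g. ?l f m * ?l g n * (monomial_eval v m * monomial_eval v n))"
    by (simp add: monomial_eval_add)
  also have "\<dots> = mpoly_eval v f * mpoly_eval v g"
    unfolding mpoly_eval_alt by (simp add: sum_product mult_ac)
  finally show ?thesis .
qed

lemma mpoly_eval_1 [simp]: "mpoly_eval v 1 = 1"
  using mpoly_eval_single[of v 0 1] by simp

lemma homogeneous_add: "homogeneous d f \<Longrightarrow> homogeneous d g \<Longrightarrow> homogeneous d (f + g)"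
  unfolding homogeneous_alt using keys_add[of f g] by blast

lemma homogeneous_uminus: "homogeneous d f \<Longrightarrow> homogeneous d (- f)"
  by (simp add: homogeneous_alt in_keys_iff)

lemma homogeneous_mult: "homogeneous d f \<Longrightarrow> homogeneous e g \<Longrightarrow> homogeneous (d + e) (f * g)"
  unfolding homogeneous_alt using keys_mult[of f g] by (fastforce simp: total_degree_add)

lemma homogeneous_single: "homogeneous (total_degree m) (Poly_Mapping.single m a)"
  by (simp add: homogeneous_alt)

lemma homogeneous_const: "homogeneous 0 (Poly_Mapping.single 0 a)"
  using homogeneous_single[of 0 a] by simp

lemma homogeneous_1: "homogeneous 0 1"
  using homogeneous_const[of 1] by simp

lemma mpoly_eval_scale:
  assumes "homogeneous d f"
  shows "mpoly_eval (\<lambda>i. c * v i) f = c ^ d * mpoly_eval v f"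
  using assms unfolding homogeneous_alt mpoly_eval_alt
  by (simp add: monomial_eval_scale sum_distrib_left mult_ac)

definition homogeneous_part :: "nat \<Rightarrow> ('n::finite, 'k::field) mpoly \<Rightarrow> ('n, 'k) mpoly" where
  "homogeneous_part d f =
     (\<Sum>m\<in>{m \<in> Poly_Mapping.keys f. total_degree m = d}. Poly_Mapping.single m (Poly_Mapping.lookup f m))"

lemma homogeneous_0: "homogeneous d 0"
  by (simp add: homogeneous_alt)

lemma homogeneous_homogeneous_part: "homogeneous d (homogeneous_part d f)"
proof -
  have "homogeneous d (\<Sum>m\<in>A. Poly_Mapping.single m (Poly_Mapping.lookup f m))"
    if "\<And>m. m \<in> A \<Longrightarrow> total_degree m = d" for A
    using that
  proof (induction A rule: infinite_finite_induct)
    case (insert m A)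
    then show ?case using homogeneous_single[of m "Poly_Mapping.lookup f m"]
      by (auto intro!: homogeneous_add)
  qed (auto simp: homogeneous_0)
  note sum = this
  show ?thesis unfolding homogeneous_part_def by (rule sum) simp
qed

text \<open>The restriction of \<open>f\<close> to the line through 0 and \<open>v\<close>, as a
  polynomial in the parameter. Its coefficients are the values at \<open>v\<close> of the
  homogeneous parts, which links arbitrary polynomials to the homogeneous ones defining closed
  sets.\<close>

definition line_poly :: "('n::finite \<Rightarrow> 'k::field) \<Rightarrow> ('n, 'k) mpoly \<Rightarrow> 'k poly" where
  "line_poly v f = (\<Sum>m\<in>Poly_Mapping.keys f.
     Polynomial.monom (Poly_Mapping.lookup f m * monomial_eval v m) (total_degree m))"

lemma poly_line_poly: "Polynomial.poly (line_poly v f) c = mpoly_eval (\<lambda>i. c * v i) f"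
  by (simp add: line_poly_def poly_sum Polynomial.poly_monom mpoly_eval_alt monomial_eval_scale mult_ac)

lemma coeff_line_poly: "Polynomial.coeff (line_poly v f) d = mpoly_eval v (homogeneous_part d f)"
  by (simp add: line_poly_def Polynomial.coeff_sum homogeneous_part_def sum.inter_filter)
    (auto intro!: sum.cong)

text \<open>Over a finite field the product of all X - a vanishes everywhere, so adding 1 to it
  gives a polynomial of positive degree without roots.\<close>

lemma infinite_UNIV_alg_closed_field: "infinite (UNIV :: 'k::alg_closed_field set)"
proof
  assume fin: "finite (UNIV :: 'k set)"
  define q where "q = (\<Prod>a\<in>(UNIV :: 'k set). [:- a, 1:])"
  have "degree q = card (UNIV :: 'k set)"
    unfolding q_def by (subst degree_prod_eq_sum_degree) auto
  moreover have "card (UNIV :: 'k set) > 0" using fin by (simp add: card_gt_0_iff)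
  ultimately have "degree (q + [:1:]) > 0" by (simp add: degree_add_eq_left)
  then obtain x where "Polynomial.poly (q + [:1:]) x = 0" using alg_closed_imp_poly_has_root by blast
  moreover have "Polynomial.poly q x = 0"
    unfolding q_def poly_prod using fin by (intro prod_zero) auto
  ultimately show False by simp
qed

lemma proj_spaceE:
  assumes "x \<in> proj_space" "v \<in> x"
  obtains "v \<noteq> (\<lambda>i. 0)" "x = {(\<lambda>i. c * v i) | c. c \<noteq> 0}"
proof -
  obtain w where w: "w \<noteq> (\<lambda>i. 0)" "x = {(\<lambda>i. c * w i) | c. c \<noteq> 0}"
    using assms(1) by (auto simp: proj_space_def)
  then obtain c where c: "c \<noteq> 0" "v = (\<lambda>i. c * w i)" using assms(2) by auto
  have "v \<noteq> (\<lambda>i. 0)" using w(1) c by (auto simp: fun_eq_iff)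
  moreover have "x = {(\<lambda>i. b * v i) | b. b \<noteq> 0}"
  proof (intro equalityI subsetI)
    fix u assume "u \<in> x"
    then obtain b where b: "b \<noteq> 0" "u = (\<lambda>i. b * w i)" using w(2) by auto
    then have "u = (\<lambda>i. (b / c) * v i)" using c by (auto simp: fun_eq_iff)
    then show "u \<in> {(\<lambda>i. b * v i) | b. b \<noteq> 0}" using b(1) c(1) by (auto intro!: exI[of _ "b / c"])
  next
    fix u assume "u \<in> {(\<lambda>i. b * v i) | b. b \<noteq> 0}"
    then obtain b where b: "b \<noteq> 0" "u = (\<lambda>i. b * v i)" by auto
    then have "u = (\<lambda>i. (b * c) * w i)" using c by (auto simp: fun_eq_iff)
    then show "u \<in> x" using b(1) c(1) w(2) by (auto intro!: exI[of _ "b * c"])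
  qed
  ultimately show thesis by (rule that)
qed

lemma proj_space_nonempty: "x \<in> proj_space \<Longrightarrow> \<exists>v. v \<in> x"
  unfolding proj_space_def by (auto intro: exI[of _ 1])

lemma zariski_closed_subset: "zariski_closed C \<Longrightarrow> C \<subseteq> proj_space"
  by (auto simp: zariski_closed_def)

lemma zariski_closed_hypersurface:
  "homogeneous d f \<Longrightarrow> zariski_closed {x \<in> proj_space. \<forall>v\<in>x. mpoly_eval v f = 0}"
  unfolding zariski_closed_def by (intro exI[of _ "{f}"]) auto

locale projective_variety =
  fixes C :: "('n::finite, 'k::alg_closed_field) ppoint set"
  assumes irreducible: "irreducible_closed C"
begin

lemma subset_proj_space: "C \<subseteq> proj_space"
  using irreducible by (intro zariski_closed_subset) (simp add: irreducible_closed_def)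

text \<open>
  Irreducibility only concerns homogeneous polynomials. Two suitable homogeneous parts of \<open>f\<close>
  and \<open>h\<close> are nonzero at a common point; on the line through it, \<open>f\<close> and \<open>h\<close> restrict to
  nonzero polynomials in one variable.
\<close>

lemma vanishing_ideal_prime:
  assumes "f * h \<in> vanishing_ideal C"
  shows "f \<in> vanishing_ideal C \<or> h \<in> vanishing_ideal C"
proof (rule ccontr)
  assume "\<not> ?thesis"
  then obtain x v y w where f: "x \<in> C" "v \<in> x" "mpoly_eval v f \<noteq> 0"
    and h: "y \<in> C" "w \<in> y" "mpoly_eval w h \<noteq> 0"
    by (auto simp: vanishing_ideal_def)
  \<comment> \<open>At parameter 1 the line polynomial takes the value of \<open>q\<close>; being
    nonzero it has a nonzero coefficient, and that is the value of a homogeneous part.\<close>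
  have part: "\<exists>d. mpoly_eval u (homogeneous_part d q) \<noteq> 0" if "mpoly_eval u q \<noteq> 0" for u and q :: "('n, 'k) mpoly"
  proof -
    have "Polynomial.poly (line_poly u q) 1 \<noteq> 0" using that by (simp add: poly_line_poly)
    then have "line_poly u q \<noteq> 0" by auto
    then show ?thesis unfolding coeff_line_poly[symmetric] by (meson leading_coeff_neq_0)
  qed
  obtain d where d: "mpoly_eval v (homogeneous_part d f) \<noteq> 0" using part f by blast
  obtain e where e: "mpoly_eval w (homogeneous_part e h) \<noteq> 0" using part h by blast
  define Z1 where "Z1 = {x \<in> proj_space. \<forall>v\<in>x. mpoly_eval v (homogeneous_part d f) = 0}"
  define Z2 where "Z2 = {x \<in> proj_space. \<forall>v\<in>x. mpoly_eval v (homogeneous_part e h) = 0}"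
  have "zariski_closed Z1" "zariski_closed Z2"
    unfolding Z1_def Z2_def by (rule zariski_closed_hypersurface, rule homogeneous_homogeneous_part)+
  moreover have "\<not> C \<subseteq> Z1" "\<not> C \<subseteq> Z2" using f h d e by (auto simp: Z1_def Z2_def)
  ultimately have "\<not> C \<subseteq> Z1 \<union> Z2" using irreducible unfolding irreducible_closed_def by blast
  then obtain z where z: "z \<in> C" "z \<notin> Z1" "z \<notin> Z2" by blast
  have zp: "z \<in> proj_space" using z(1) subset_proj_space by blast
  obtain a where a: "a \<in> z" "mpoly_eval a (homogeneous_part d f) \<noteq> 0"
    using z zp by (auto simp: Z1_def)
  obtain b where b: "b \<in> z" "mpoly_eval b (homogeneous_part e h) \<noteq> 0"
    using z zp by (auto simp: Z2_def)
  have z_eq: "z = {(\<lambda>i. c * a i) | c. c \<noteq> 0}" using zp a(1) by (auto elim: proj_spaceE)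
  then obtain c where c: "c \<noteq> 0" "b = (\<lambda>i. c * a i)" using b(1) by auto
  have "mpoly_eval a (homogeneous_part e h) \<noteq> 0"
    using b(2) unfolding c(2) mpoly_eval_scale[OF homogeneous_homogeneous_part] by auto
  then have "line_poly a h \<noteq> 0" "line_poly a f \<noteq> 0"
    using a(2) unfolding coeff_line_poly[symmetric] by auto
  \<comment> \<open>The extra factor X excludes the parameter 0, so the chosen multiple of
    \<open>a\<close> still represents the point \<open>z\<close>.\<close>
  then have "[:0, 1:] * (line_poly a f * line_poly a h) \<noteq> 0" by simp
  then have "finite {c. Polynomial.poly ([:0, 1:] * (line_poly a f * line_poly a h)) c = 0}"
    by (rule poly_roots_finite)
  then obtain c where "Polynomial.poly ([:0, 1:] * (line_poly a f * line_poly a h)) c \<noteq> 0"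
    using ex_new_if_finite[OF infinite_UNIV_alg_closed_field] by blast
  then have c: "c \<noteq> 0" "mpoly_eval (\<lambda>i. c * a i) (f * h) \<noteq> 0" by (auto simp: poly_line_poly)
  then have "(\<lambda>i. c * a i) \<in> z" unfolding z_eq by auto
  then show False using assms z(1) c(2) by (auto simp: vanishing_ideal_def)
qed

lemma primeideal_vanishing_ideal: "primeideal (vanishing_ideal C) (mpoly_ring :: ('n, 'k) mpoly ring)"
proof -
  interpret P: cring "mpoly_ring :: ('n, 'k) mpoly ring" by (rule cring_from_type_algebra)
  have car: "carrier (mpoly_ring :: ('n, 'k) mpoly ring) = UNIV"
    and ops: "f \<otimes>\<^bsub>mpoly_ring\<^esub> g = f * g" "f \<oplus>\<^bsub>mpoly_ring\<^esub> g = f + g"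
      "\<one>\<^bsub>mpoly_ring\<^esub> = (1 :: ('n, 'k) mpoly)" "\<zero>\<^bsub>mpoly_ring\<^esub> = (0 :: ('n, 'k) mpoly)"
    for f g :: "('n, 'k) mpoly"
    by (simp_all add: ring_of_type_algebra_def)
  have inv: "\<ominus>\<^bsub>mpoly_ring\<^esub> f = - f" for f :: "('n, 'k) mpoly"
    by (rule P.minus_equality) (simp_all add: car ops)
  have "subgroup (vanishing_ideal C) (add_monoid (mpoly_ring :: ('n, 'k) mpoly ring))"
    by (rule P.add.subgroupI) (auto simp: vanishing_ideal_def car ops inv intro: exI[of _ 0])
  then have "ideal (vanishing_ideal C) (mpoly_ring :: ('n, 'k) mpoly ring)"
    by (intro idealI P.ring_axioms) (auto simp: vanishing_ideal_def car ops)
  then show ?thesis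
  proof (rule primeidealI[OF _ P.is_cring])
    obtain x where "x \<in> C" using irreducible by (auto simp: irreducible_closed_def)
    moreover then obtain v where "v \<in> x" using subset_proj_space proj_space_nonempty by blast
    ultimately have "1 \<notin> vanishing_ideal C" by (auto simp: vanishing_ideal_def)
    then show "carrier mpoly_ring \<noteq> vanishing_ideal C" by (auto simp: car)
  qed (use vanishing_ideal_prime in \<open>auto simp: car ops\<close>)
qed

end

section \<open>Local rings of a curve\<close>

lemma mpoly_ring_simps [simp]:
  fixes f g :: "('n::finite, 'k::field) mpoly"
  shows "f \<in> carrier mpoly_ring" "f \<otimes>\<^bsub>mpoly_ring\<^esub> g = f * g" "f \<oplus>\<^bsub>mpoly_ring\<^esub> g = f + g"
    "\<one>\<^bsub>mpoly_ring\<^esub> = (1 :: ('n, 'k) mpoly)" "\<zero>\<^bsub>mpoly_ring\<^esub> = (0 :: ('n, 'k) mpoly)"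
  by (simp_all add: ring_of_type_algebra_def)

lemma mpoly_ring_minus [simp]:
  fixes f g :: "('n::finite, 'k::field) mpoly"
  shows "\<ominus>\<^bsub>mpoly_ring\<^esub> f = - f" "f \<ominus>\<^bsub>mpoly_ring\<^esub> g = f - g"
proof -
  interpret P: cring "mpoly_ring :: ('n, 'k) mpoly ring" by (rule cring_from_type_algebra)
  show inv: "\<ominus>\<^bsub>mpoly_ring\<^esub> h = - h" for h :: "('n, 'k) mpoly"
    by (rule P.minus_equality) simp_all
  show "f \<ominus>\<^bsub>mpoly_ring\<^esub> g = f - g" by (simp add: P.minus_eq inv)
qed

context projective_variety
begin

sublocale ideal: primeideal "vanishing_ideal C" "mpoly_ring :: ('n, 'k) mpoly ring"
  by (rule primeideal_vanishing_ideal)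

sublocale coord: "domain" "coord_ring C"
  unfolding coord_ring_def by (rule ideal.quotient_is_domain)

sublocale coord_class: ring_hom_cring mpoly_ring "coord_ring C" "\<lambda>f. coord_class C f"
  unfolding coord_ring_def by (rule ideal.rcos_ring_hom_cring)

lemma coord_class_eq_iff: "coord_class C f = coord_class C g \<longleftrightarrow> f - g \<in> vanishing_ideal C"
  using ideal.quotient_eq_iff_same_a_r_cos[OF ideal.is_ideal, of f g] by simp

lemma coord_class_eq_zero_iff: "coord_class C f = \<zero>\<^bsub>coord_ring C\<^esub> \<longleftrightarrow> f \<in> vanishing_ideal C"
  using coord_class_eq_iff[of f 0] coord_class.hom_zero by simp

lemma coord_class_mult: "coord_class C f \<otimes>\<^bsub>coord_ring C\<^esub> coord_class C g = coord_class C (f * g)"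
  using coord_class.hom_mult[of f g] by simp

lemma coord_class_add: "coord_class C f \<oplus>\<^bsub>coord_ring C\<^esub> coord_class C g = coord_class C (f + g)"
  using coord_class.hom_add[of f g] by simp

lemma coord_class_one: "\<one>\<^bsub>coord_ring C\<^esub> = coord_class C 1"
  using coord_class.hom_one by simp

abbreviation frac :: "('n, 'k) mpoly \<Rightarrow> ('n, 'k) mpoly \<Rightarrow> ('n, 'k) local_elt" where
  "frac f g \<equiv> fraction (coord_ring C) (coord_class C f) (coord_class C g)"

abbreviation (input) coord_field :: "('n, 'k) local_elt ring" where
  "coord_field \<equiv> fraction_field (coord_ring C)"

end

section \<open>The local ring at a point\<close>

locale variety_point = projective_variety C
  for C :: "('n::finite, 'k::alg_closed_field) ppoint set" +
  fixes x :: "('n, 'k) ppoint" and v :: "'n \<Rightarrow> 'k"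
  assumes point: "x \<in> C" and rep: "v \<in> x"
begin

text \<open>The pairs whose quotient lies in the local ring. By homogeneity it suffices to test the
  denominator at the single representative \<open>v\<close> of the point.\<close>

definition valid :: "('n, 'k) mpoly \<Rightarrow> ('n, 'k) mpoly \<Rightarrow> bool" where
  "valid f g \<longleftrightarrow> (\<exists>d. homogeneous d f \<and> homogeneous d g \<and> mpoly_eval v g \<noteq> 0)"

lemma point_eq: "x = {(\<lambda>i. c * v i) | c. c \<noteq> 0}" and rep_nonzero: "v \<noteq> (\<lambda>i. 0)"
  using proj_spaceE[OF _ rep] point subset_proj_space by auto

lemma nonvanishing_iff:
  assumes "homogeneous d g"
  shows "(\<forall>w\<in>x. mpoly_eval w g \<noteq> 0) \<longleftrightarrow> mpoly_eval v g \<noteq> 0"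
  using rep unfolding point_eq by (auto simp: mpoly_eval_scale[OF assms])

lemma vanishing_ideal_point: "f \<in> vanishing_ideal C \<Longrightarrow> mpoly_eval v f = 0"
  using point rep unfolding vanishing_ideal_def by blast

lemma eval_nonzero: "mpoly_eval v g \<noteq> 0 \<Longrightarrow> coord_class C g \<noteq> \<zero>\<^bsub>coord_ring C\<^esub>"
  using vanishing_ideal_point coord_class_eq_zero_iff by blast

lemma valid_mult: "valid f g \<Longrightarrow> valid f' g' \<Longrightarrow> valid (f * f') (g * g')"
  unfolding valid_def using homogeneous_mult by (metis mpoly_eval_mult mult_eq_0_iff)

lemma valid_add: "valid f g \<Longrightarrow> valid f' g' \<Longrightarrow> valid (f * g' + f' * g) (g * g')"
proof -
  assume "valid f g" "valid f' g'"
  then obtain d e where d: "homogeneous d f" "homogeneous d g" "mpoly_eval v g \<noteq> 0"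
    and e: "homogeneous e f'" "homogeneous e g'" "mpoly_eval v g' \<noteq> 0" by (auto simp: valid_def)
  have "homogeneous (d + e) (f' * g)"
    using homogeneous_mult[OF e(1) d(2)] by (simp add: add.commute)
  then show ?thesis
    using homogeneous_add homogeneous_mult[OF d(1) e(2)] homogeneous_mult[OF d(2) e(2)] d e
    unfolding valid_def by (metis mpoly_eval_mult mult_eq_0_iff)
qed

lemma valid_uminus: "valid f g \<Longrightarrow> valid (- f) g"
  unfolding valid_def using homogeneous_uminus by blast

lemma valid_const: "valid (Poly_Mapping.single 0 c) 1"
  unfolding valid_def using homogeneous_const homogeneous_1 by (metis mpoly_eval_1 one_neq_zero)

lemma valid_one: "valid 1 1"
  using valid_const[of 1] by simp

lemma frac_mult:
  "valid f g \<Longrightarrow> valid f' g' \<Longrightarrow> frac f g \<otimes>\<^bsub>coord_field\<^esub> frac f' g' = frac (f * f') (g * g')"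
  using coord_class.hom_closed
  by (subst coord.fraction_field_mult) (auto simp: valid_def eval_nonzero coord_class_mult)

lemma frac_add:
  "valid f g \<Longrightarrow> valid f' g' \<Longrightarrow>
    frac f g \<oplus>\<^bsub>coord_field\<^esub> frac f' g' = frac (f * g' + f' * g) (g * g')"
  using coord_class.hom_closed
  by (subst coord.fraction_field_add) (auto simp: valid_def eval_nonzero coord_class_mult coord_class_add)

lemma frac_eq_iff:
  "valid f g \<Longrightarrow> valid f' g' \<Longrightarrow> frac f g = frac f' g' \<longleftrightarrow> f * g' - f' * g \<in> vanishing_ideal C"
  using coord_class.hom_closed
  by (subst coord.fraction_eq_iff) (auto simp: valid_def eval_nonzero coord_class_mult coord_class_eq_iff)

text \<open>Elements of the vanishing ideal vanish at \<open>v\<close>. Hence the value of a local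
  fraction at the point does not depend on its representation.\<close>

lemma frac_eqD:
  assumes "valid f g" "valid f' g'" "frac f g = frac f' g'"
  shows "mpoly_eval v f * mpoly_eval v g' = mpoly_eval v f' * mpoly_eval v g"
proof -
  have "f * g' - f' * g \<in> vanishing_ideal C" using frac_eq_iff assms by blast
  then have "mpoly_eval v (f * g' - f' * g) = 0" by (rule vanishing_ideal_point)
  then show ?thesis by simp
qed

lemma frac_closed: "valid f g \<Longrightarrow> frac f g \<in> carrier coord_field"
  using coord_class.hom_closed by (intro coord.fraction_closed) (auto simp: valid_def eval_nonzero)

lemma frac_one: "\<one>\<^bsub>coord_field\<^esub> = frac 1 1"
  by (simp add: coord.fraction_field_carrier coord_class_one)

lemma frac_zero: "\<zero>\<^bsub>coord_field\<^esub> = frac 0 1"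
  using coord_class.hom_zero by (simp add: coord.fraction_field_carrier coord_class_one)

lemma local_ring_eq: "local_ring C x = coord_field\<lparr>carrier := {frac f g | f g. valid f g}\<rparr>"
proof -
  have "(\<exists>d. homogeneous d f \<and> homogeneous d g \<and> (\<forall>w\<in>x. mpoly_eval w g \<noteq> 0)) \<longleftrightarrow> valid f g" for f g
    unfolding valid_def using nonvanishing_iff by blast
  then have "{frac f g | f g d. homogeneous d f \<and> homogeneous d g \<and> (\<forall>w\<in>x. mpoly_eval w g \<noteq> 0)} =
    {frac f g | f g. valid f g}" by blast
  then show ?thesis by (simp add: local_ring_def)
qed

sublocale ff: field coord_field
  by (rule coord.field_fraction_field)

lemma frac_uminus:
  assumes "valid f g"
  shows "\<ominus>\<^bsub>coord_field\<^esub> frac f g = frac (- f) g"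
proof (rule ff.minus_equality)
  show "frac (- f) g \<oplus>\<^bsub>coord_field\<^esub> frac f g = \<zero>\<^bsub>coord_field\<^esub>"
    using assms valid_uminus valid_mult[OF assms assms] valid_const[of 0]
    unfolding frac_add[OF valid_uminus[OF assms] assms] frac_zero
    by (subst frac_eq_iff) (auto simp: valid_def vanishing_ideal_def homogeneous_0)
qed (use assms valid_uminus in \<open>auto intro: frac_closed\<close>)

lemma subring_local_ring: "subring {frac f g | f g. valid f g} coord_field"
proof (rule ff.subringI)
  show "{frac f g | f g. valid f g} \<subseteq> carrier coord_field" using frac_closed by auto
  show "\<one>\<^bsub>coord_field\<^esub> \<in> {frac f g | f g. valid f g}" unfolding frac_one using valid_one by blast
next
  fix h assume "h \<in> {frac f g | f g. valid f g}"
  then obtain f g where fg: "valid f g" "h = frac f g" by blast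
  show "\<ominus>\<^bsub>coord_field\<^esub> h \<in> {frac f g | f g. valid f g}"
    unfolding fg(2) frac_uminus[OF fg(1)] using valid_uminus[OF fg(1)] by blast
next
  fix h h' assume "h \<in> {frac f g | f g. valid f g}" "h' \<in> {frac f g | f g. valid f g}"
  then obtain f g f' g' where fg: "valid f g" "h = frac f g" "valid f' g'" "h' = frac f' g'" by blast
  show "h \<otimes>\<^bsub>coord_field\<^esub> h' \<in> {frac f g | f g. valid f g}"
    unfolding fg(2,4) frac_mult[OF fg(1,3)] using valid_mult[OF fg(1,3)] by blast
  show "h \<oplus>\<^bsub>coord_field\<^esub> h' \<in> {frac f g | f g. valid f g}"
    unfolding fg(2,4) frac_add[OF fg(1,3)] using valid_add[OF fg(1,3)] by blast
qed

sublocale L: "domain" "local_ring C x"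
  unfolding local_ring_eq by (rule ff.subring_is_domain[OF subring_local_ring])

lemma local_ring_mult: "valid f g \<Longrightarrow> valid f' g' \<Longrightarrow> frac f g \<otimes>\<^bsub>local_ring C x\<^esub> frac f' g' = frac (f * f') (g * g')"
  using frac_mult by (simp add: local_ring_eq)

lemma local_ring_add:
  "valid f g \<Longrightarrow> valid f' g' \<Longrightarrow> frac f g \<oplus>\<^bsub>local_ring C x\<^esub> frac f' g' = frac (f * g' + f' * g) (g * g')"
  using frac_add by (simp add: local_ring_eq)

lemma local_ring_one: "\<one>\<^bsub>local_ring C x\<^esub> = frac 1 1"
  using frac_one by (simp add: local_ring_eq)

lemma local_ring_zero: "\<zero>\<^bsub>local_ring C x\<^esub> = frac 0 1"
  using frac_zero by (simp add: local_ring_eq)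

lemma local_ring_closed: "valid f g \<Longrightarrow> frac f g \<in> carrier (local_ring C x)"
  by (auto simp: local_ring_eq)

lemma local_ringE:
  assumes "a \<in> carrier (local_ring C x)"
  obtains f g where "valid f g" "a = frac f g"
  using assms by (auto simp: local_ring_eq)

lemma local_ring_uminus:
  assumes "valid f g"
  shows "\<ominus>\<^bsub>local_ring C x\<^esub> frac f g = frac (- f) g"
proof (rule L.minus_equality)
  show "frac (- f) g \<oplus>\<^bsub>local_ring C x\<^esub> frac f g = \<zero>\<^bsub>local_ring C x\<^esub>"
    using ff.l_neg[OF frac_closed[OF assms]] frac_uminus[OF assms] by (simp add: local_ring_eq)
qed (use assms valid_uminus in \<open>auto intro: local_ring_closed\<close>)

text \<open>The inverse of f/g can only be g/f, which is admissible exactly when \<open>f\<close>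
  does not vanish at the point. So the nonunits are the fractions with value 0 there.\<close>

lemma local_ring_unit_iff:
  assumes "valid f g"
  shows "frac f g \<in> Units (local_ring C x) \<longleftrightarrow> mpoly_eval v f \<noteq> 0"
proof
  assume "frac f g \<in> Units (local_ring C x)"
  then obtain b where b: "b \<in> carrier (local_ring C x)" "frac f g \<otimes>\<^bsub>local_ring C x\<^esub> b = \<one>\<^bsub>local_ring C x\<^esub>"
    by (auto simp: Units_def)
  then obtain f' g' where fg: "valid f' g'" "b = frac f' g'" by (elim local_ringE)
  have "frac (f * f') (g * g') = frac 1 1"
    using b(2) unfolding fg(2) local_ring_mult[OF assms fg(1)] local_ring_one .
  from frac_eqD[OF valid_mult[OF assms fg(1)] valid_one this]
  show "mpoly_eval v f \<noteq> 0" using assms fg(1) by (auto simp: valid_def)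
next
  assume f: "mpoly_eval v f \<noteq> 0"
  then have gf: "valid g f" using assms by (auto simp: valid_def)
  have "frac f g \<otimes>\<^bsub>local_ring C x\<^esub> frac g f = \<one>\<^bsub>local_ring C x\<^esub>"
    unfolding local_ring_mult[OF assms gf] local_ring_one frac_eq_iff[OF valid_mult[OF assms gf] valid_one]
    by (simp add: vanishing_ideal_def mult.commute)
  moreover from this have "frac g f \<otimes>\<^bsub>local_ring C x\<^esub> frac f g = \<one>\<^bsub>local_ring C x\<^esub>"
    using local_ring_closed assms gf by (simp add: L.m_comm)
  ultimately show "frac f g \<in> Units (local_ring C x)"
    using local_ring_closed assms gf unfolding Units_def by blast
qed

lemma local_const_eq: "local_const C c = frac (Poly_Mapping.single 0 c) 1"
  by (simp add: local_const_def coord_class_one)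

lemma local_const_hom: "ring_hom_cring ring_of_type_algebra (local_ring C x) (local_const C)"
proof (rule ring_hom_cringI[OF cring_from_type_algebra L.is_cring], rule ring_hom_memI)
  fix a b :: 'k
  show "local_const C a \<in> carrier (local_ring C x)"
    unfolding local_const_eq by (intro local_ring_closed valid_const)
  have s: "Poly_Mapping.single 0 (a * b) = Poly_Mapping.single 0 a * (Poly_Mapping.single 0 b :: ('n, 'k) mpoly)"
    by (simp add: mult_single)
  show "local_const C (a \<otimes>\<^bsub>ring_of_type_algebra\<^esub> b) = local_const C a \<otimes>\<^bsub>local_ring C x\<^esub> local_const C b"
    unfolding local_const_eq local_ring_mult[OF valid_const valid_const]
    by (simp add: ring_of_type_algebra_def s)
  show "local_const C (a \<oplus>\<^bsub>ring_of_type_algebra\<^esub> b) = local_const C a \<oplus>\<^bsub>local_ring C x\<^esub> local_const C b"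
    unfolding local_const_eq local_ring_add[OF valid_const valid_const]
    by (simp add: ring_of_type_algebra_def single_add)
  show "local_const C \<one>\<^bsub>ring_of_type_algebra\<^esub> = \<one>\<^bsub>local_ring C x\<^esub>"
    unfolding local_const_eq local_ring_one by (simp add: ring_of_type_algebra_def)
qed

text \<open>The residue field is the algebraically closed constant field: a constant p-th root of
  the value of \<open>u\<close> works. This starts the Newton iteration.\<close>

lemma residue_root:
  fixes p :: nat
  assumes "p > 0" "u \<in> Units (local_ring C x)"
  shows "\<exists>w\<in>carrier (local_ring C x). w [^]\<^bsub>local_ring C x\<^esub> p \<ominus>\<^bsub>local_ring C x\<^esub> u \<in> nonunits (local_ring C x)"
proof -
  interpret c: ring_hom_cring ring_of_type_algebra "local_ring C x" "local_const C" by (rule local_const_hom)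
  have "u \<in> carrier (local_ring C x)" using assms(2) by (rule L.Units_closed)
  then obtain f g where fg: "valid f g" "u = frac f g" by (elim local_ringE)
  obtain d where d: "d ^ p = mpoly_eval v f / mpoly_eval v g" using nth_root_exists[OF assms(1)] by blast
  have pow: "a [^]\<^bsub>(ring_of_type_algebra :: 'k ring)\<^esub> n = a ^ n" for a and n :: nat
    by (induction n) (simp_all add: ring_of_type_algebra_def mult.commute)
  have car: "a \<in> carrier ring_of_type_algebra" for a :: 'k by (simp add: ring_of_type_algebra_def)
  let ?s = "Poly_Mapping.single 0 (d ^ p) :: ('n, 'k) mpoly"
  have val: "valid (?s * g + - f * 1) (1 * g)"
    by (intro valid_add valid_const valid_uminus fg)
  have "local_const C d [^]\<^bsub>local_ring C x\<^esub> p \<ominus>\<^bsub>local_ring C x\<^esub> u = frac ?s 1 \<oplus>\<^bsub>local_ring C x\<^esub> frac (- f) g"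
    unfolding L.minus_eq fg(2) local_ring_uminus[OF fg(1)] using c.hom_pow[OF car, of d p]
    by (simp add: pow local_const_eq)
  also have "\<dots> = frac (?s * g + - f * 1) (1 * g)"
    by (intro local_ring_add valid_const valid_uminus fg)
  also have "\<dots> \<in> nonunits (local_ring C x)"
    unfolding nonunits_def
  proof (intro DiffI local_ring_closed val)
    have "mpoly_eval v g \<noteq> 0" using fg(1) unfolding valid_def by blast
    then have "mpoly_eval v (?s * g + - f * 1) = 0" using d by simp
    then show "frac (?s * g + - f * 1) (1 * g) \<notin> Units (local_ring C x)"
      using local_ring_unit_iff[OF val] by blast
  qed
  finally show ?thesis using c.hom_closed[OF car] by blast
qed

lemma local_const_unit: "c \<noteq> 0 \<Longrightarrow> local_const C c \<in> Units (local_ring C x)"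
  unfolding local_const_eq by (subst local_ring_unit_iff[OF valid_const]) simp

text \<open>A prime p different from the characteristic is a nonzero constant, and nonzero constants
  are units. The Newton step divides by p.\<close>

lemma local_ring_of_nat_unit:
  assumes "Factorial_Ring.prime p" "p \<noteq> CHAR('k)"
  shows "add_pow (local_ring C x) p \<one>\<^bsub>local_ring C x\<^esub> \<in> Units (local_ring C x)"
proof -
  interpret c: ring_hom_cring ring_of_type_algebra "local_ring C x" "local_const C" by (rule local_const_hom)
  have "add_pow (local_ring C x) n \<one>\<^bsub>local_ring C x\<^esub> = local_const C (of_nat n)" for n :: nat
  proof (induction n)
    case 0
    show ?case using c.hom_zero by (simp add: ring_of_type_algebra_def)
  next
    case (Suc n)
    then show ?case using c.hom_add[of 1 "of_nat n"] c.hom_one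
      by (simp add: ring_of_type_algebra_def L.a_comm)
  qed
  moreover have "(of_nat p :: 'k) \<noteq> 0"
    using assms CHAR_not_1[where ?'a = 'k] prime_nat_iff by (auto simp: of_nat_eq_0_iff_char_dvd)
  ultimately show ?thesis using local_const_unit by simp
qed

text \<open>The witness is a linear form vanishing at \<open>x\<close> but not at \<open>y\<close>, divided by a coordinate.\<close>

lemma nonunits_nontrivial:
  assumes "y \<in> C" "y \<noteq> x"
  shows "\<exists>a\<in>nonunits (local_ring C x). a \<noteq> \<zero>\<^bsub>local_ring C x\<^esub>"
proof -
  obtain w where w: "w \<in> y" using assms(1) subset_proj_space proj_space_nonempty by blast
  have y: "w \<noteq> (\<lambda>i. 0)" "y = {(\<lambda>i. c * w i) | c. c \<noteq> 0}"
    using proj_spaceE[OF _ w] assms(1) subset_proj_space by auto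
  obtain k where k: "v k \<noteq> 0" using rep_nonzero by auto
  \<comment> \<open>If all 2 by 2 minors of the two representatives vanished, the vectors would be
    proportional and the points equal.\<close>
  have "\<exists>i j. v i * w j \<noteq> v j * w i"
  proof (rule ccontr)
    assume "\<not> ?thesis"
    then have eq: "v k * w j = v j * w k" for j by blast
    then have wv: "w = (\<lambda>j. (w k / v k) * v j)" using k by (auto simp: fun_eq_iff field_simps)
    then have "w k \<noteq> 0" using y(1) by (metis div_0 mult_zero_left)
    then have "w \<in> x" using wv k unfolding point_eq by (auto intro!: exI[of _ "w k / v k"])
    then have "x = {(\<lambda>i. c * w i) | c. c \<noteq> 0}"
      using proj_spaceE[of x w] point subset_proj_space by blast
    then have "x = y" unfolding y(2) .
    then show False using assms(2) by simp
  qed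
  then obtain i j where ij: "v i * w j \<noteq> v j * w i" by blast
  let ?X = "\<lambda>i a. Poly_Mapping.single (Poly_Mapping.single i 1) a :: ('n, 'k) mpoly"
  define f where "f = ?X j (v i) + ?X i (- v j)"
  have X: "mpoly_eval u (?X i a) = a * u i" for u i a
  proof -
    have "monomial_eval u (Poly_Mapping.single i 1) = (\<Prod>j\<in>UNIV. if i = j then u i else 1)"
      unfolding monomial_eval_def by (intro prod.cong) (auto simp: lookup_single when_def)
    then show ?thesis by simp
  qed
  have evf: "mpoly_eval u f = v i * u j - v j * u i" for u
    unfolding f_def mpoly_eval_add X by simp
  have hX: "homogeneous 1 (?X i a)" for i a using homogeneous_single[of "Poly_Mapping.single i 1" a] by simp
  have val: "valid f (?X k 1)"
    unfolding valid_def f_def using hX homogeneous_add X k by (metis mult_1)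
  have "frac f (?X k 1) \<in> nonunits (local_ring C x)"
    using local_ring_unit_iff[OF val] local_ring_closed[OF val] evf[of v]
    unfolding nonunits_def by simp
  moreover have "frac f (?X k 1) \<noteq> \<zero>\<^bsub>local_ring C x\<^esub>"
  proof
    assume "frac f (?X k 1) = \<zero>\<^bsub>local_ring C x\<^esub>"
    then have "f \<in> vanishing_ideal C"
      unfolding local_ring_zero using frac_eq_iff[OF val valid_const[of 0]] by simp
    then have "mpoly_eval w f = 0" using w assms(1) by (auto simp: vanishing_ideal_def)
    then show False using ij evf[of w] by simp
  qed
  ultimately show ?thesis by blast
qed

end

text \<open>Dimension 1 provides a strict chain of two nonempty irreducible closed subsets, so the
  larger one contains a point outside the smaller. A point other than \<open>x\<close> is what
  excludes a zero maximal ideal.\<close>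

lemma two_points:
  assumes "zariski_dim C = 1"
  shows "\<exists>y\<in>C. y \<noteq> x"
proof -
  have "\<exists>n>0. \<exists>Z. (\<forall>i\<le>n. irreducible_closed (Z i) \<and> Z i \<subseteq> C) \<and> (\<forall>i<n. Z i \<subset> Z (Suc i))"
    (is "\<exists>n>0. ?chain n")
  proof (rule ccontr)
    assume *: "\<not> (\<exists>n>0. ?chain n)"
    have "zariski_dim C \<le> enat 0"
      unfolding zariski_dim_def
    proof (rule Sup_least)
      fix e assume "e \<in> enat ` {n. \<exists>Z. (\<forall>i\<le>n. irreducible_closed (Z i) \<and> Z i \<subseteq> C) \<and> (\<forall>i<n. Z i \<subset> Z (Suc i))}"
      then obtain m where m: "e = enat m" "?chain m" by (elim imageE) (simp only: mem_Collect_eq)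
      have "\<not> m > 0"
      proof
        assume "m > 0"
        from this m(2) have "m > 0 \<and> ?chain m" by (rule conjI)
        then have "\<exists>n>0. ?chain n" by (rule exI)
        with * show False by (rule notE)
      qed
      then show "e \<le> enat 0" using m(1) by simp
    qed
    then show False using assms by (simp add: zero_enat_def[symmetric])
  qed
  then obtain n Z where n: "n > 0" and Z: "\<forall>i\<le>n. irreducible_closed (Z i) \<and> Z i \<subseteq> C" "\<forall>i<n. Z i \<subset> Z (Suc i)"
    by blast
  have Z0: "Z 0 \<noteq> {}" "Z 0 \<subset> Z (Suc 0)" "Z (Suc 0) \<subseteq> C"
    using Z n by (auto simp: irreducible_closed_def Suc_le_eq)
  then obtain a b where "a \<in> Z 0" "b \<in> Z (Suc 0)" "b \<notin> Z 0" by blast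
  then show ?thesis using Z0 by (cases "a = x") auto
qed

text \<open>In dimension 1 nonsingularity asks for a generating set with one element. The generator
  is nonzero because a second point of the curve yields a nonzero nonunit.\<close>

lemma (in variety_point) local_ring_principal:
  assumes dim: "zariski_dim C = 1" and ns: "nonsingular_at C x"
  shows "\<exists>\<pi>. principal_local_domain (local_ring C x) \<pi>"
proof -
  obtain B where B: "card B = 1" "B \<subseteq> nonunits (local_ring C x)"
    "Idl\<^bsub>local_ring C x\<^esub> B = nonunits (local_ring C x)"
    using ns dim unfolding nonsingular_at_def by (auto simp: one_enat_def)
  then obtain \<pi> where "B = {\<pi>}" by (auto simp: card_1_singleton_iff)
  then have \<pi>: "\<pi> \<in> carrier (local_ring C x)" "nonunits (local_ring C x) = PIdl\<^bsub>local_ring C x\<^esub> \<pi>"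
    using B L.cgenideal_eq_genideal[of \<pi>] by (auto simp: nonunits_def)
  moreover have "\<pi> \<noteq> \<zero>\<^bsub>local_ring C x\<^esub>"
  proof
    assume "\<pi> = \<zero>\<^bsub>local_ring C x\<^esub>"
    then have "nonunits (local_ring C x) \<subseteq> {\<zero>\<^bsub>local_ring C x\<^esub>}"
      unfolding \<pi>(2) cgenideal_def by auto
    then show False using two_points[OF dim, of x] nonunits_nontrivial by blast
  qed
  ultimately show ?thesis by (intro exI principal_local_domain.intro principal_local_domain_axioms.intro L.domain_axioms)
qed

section \<open>Place fields and adeles of a curve\<close>

locale curve =
  fixes C :: "('n::finite, 'k::alg_closed_field) ppoint set"
  assumes curve: "nonsingular_projective_curve C"
begin

lemma variety_point_exists: "x \<in> C \<Longrightarrow> \<exists>v. variety_point C x v"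
proof -
  assume x: "x \<in> C"
  interpret projective_variety C
    using curve by unfold_locales (simp add: nonsingular_projective_curve_def)
  obtain v where "v \<in> x" using x subset_proj_space proj_space_nonempty by blast
  with x show ?thesis by (auto intro!: exI variety_point.intro variety_point_axioms.intro projective_variety_axioms)
qed

lemma local_uniformizer: "x \<in> C \<Longrightarrow> \<exists>\<pi>. principal_local_domain (local_ring C x) \<pi>"
  using variety_point_exists variety_point.local_ring_principal curve
  unfolding nonsingular_projective_curve_def by metis

lemma complete_local_ring_valuation:
  assumes "x \<in> C"
  shows "\<exists>\<pi>. discrete_valuation_domain (complete_local_ring C x) \<pi>"
proof -
  obtain \<pi> where "principal_local_domain (local_ring C x) \<pi>" using local_uniformizer[OF assms] ..
  then show ?thesis
    unfolding complete_local_ring_def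
    by (intro exI) (rule principal_local_domain.discrete_valuation_adic_completion)
qed

lemma domain_complete_local_ring:
  assumes "x \<in> C"
  shows "domain (complete_local_ring C x)"
proof -
  obtain \<pi> where "discrete_valuation_domain (complete_local_ring C x) \<pi>"
    using complete_local_ring_valuation[OF assms] ..
  then show ?thesis by (rule discrete_valuation_domain.axioms(1))
qed

lemma field_place_field: "x \<in> C \<Longrightarrow> field (place_field C x)"
  unfolding place_field_def by (intro domain.field_fraction_field domain_complete_local_ring)

lemma cring_place_field: "x \<in> C \<Longrightarrow> cring (place_field C x)"
  using field_place_field by (rule fieldE(1))

lemma place_val_mult:
  assumes "x \<in> C" "a \<in> carrier (place_field C x) - {\<zero>\<^bsub>place_field C x\<^esub>}"
    "b \<in> carrier (place_field C x) - {\<zero>\<^bsub>place_field C x\<^esub>}"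
  shows "place_val C x (a \<otimes>\<^bsub>place_field C x\<^esub> b) = place_val C x a + place_val C x b"
proof -
  obtain \<pi> where "discrete_valuation_domain (complete_local_ring C x) \<pi>"
    using complete_local_ring_valuation[OF assms(1)] ..
  then show ?thesis
    using assms(2,3) unfolding place_val_def place_field_def by (rule discrete_valuation_domain.dvr_val_mult)
qed

lemma complete_local_ring_root:
  assumes x: "x \<in> C" and p: "Factorial_Ring.prime p" "p \<noteq> CHAR('k)"
    and u: "u \<in> Units (complete_local_ring C x)"
  shows "\<exists>w\<in>carrier (complete_local_ring C x). w [^]\<^bsub>complete_local_ring C x\<^esub> p = u"
proof -
  obtain \<pi> where "principal_local_domain (local_ring C x) \<pi>" using local_uniformizer[OF x] by blast
  then interpret L: principal_local_domain "local_ring C x" \<pi> .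
  obtain v where "variety_point C x v" using variety_point_exists[OF x] by blast
  then interpret v: variety_point C x v .
  have p0: "p > 0" using p(1) by (rule prime_gt_0_nat)
  have I1: "L.I 1 = nonunits (local_ring C x)" using L.nonunits_principal by simp
  show ?thesis
    unfolding complete_local_ring_def
  proof (rule L.adic_root[OF p0 v.local_ring_of_nat_unit[OF p]])
    fix u assume "u \<in> Units (local_ring C x)"
    from v.residue_root[OF p0 this]
    show "\<exists>w\<in>carrier (local_ring C x). w [^]\<^bsub>local_ring C x\<^esub> p \<ominus>\<^bsub>local_ring C x\<^esub> u \<in> L.I 1"
      unfolding I1 .
  qed (use u in \<open>simp add: complete_local_ring_def\<close>)
qed

text \<open>All units of the complete local ring are p-th powers by Newton iteration, so the only
  obstruction to being a p-th power is the valuation modulo p.\<close>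

lemma place_val_root:
  assumes x: "x \<in> C" and p: "Factorial_Ring.prime p" "p \<noteq> CHAR('k)"
    and a: "a \<in> carrier (place_field C x) - {\<zero>\<^bsub>place_field C x\<^esub>}" "int p dvd place_val C x a"
  shows "\<exists>b\<in>carrier (place_field C x). a = b [^]\<^bsub>place_field C x\<^esub> p"
proof -
  obtain \<pi> where "discrete_valuation_domain (complete_local_ring C x) \<pi>"
    using complete_local_ring_valuation[OF x] by blast
  then interpret D: discrete_valuation_domain "complete_local_ring C x" \<pi> .
  show ?thesis unfolding place_field_def
    by (rule D.dvr_val_root[OF complete_local_ring_root[OF x p] prime_gt_0_nat[OF p(1)]])
      (use a in \<open>simp_all add: place_field_def place_val_def\<close>)
qed

lemma integer_hom:
  assumes "x \<in> C"
  shows "ring_hom_cring (complete_local_ring C x) (place_field C x)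
    (\<lambda>a. fraction (complete_local_ring C x) a \<one>\<^bsub>complete_local_ring C x\<^esub>)"
proof -
  interpret A: "domain" "complete_local_ring C x" by (rule domain_complete_local_ring[OF assms])
  show ?thesis using A.fraction_ring_hom cring_place_field[OF assms]
    by (intro ring_hom_cringI A.is_cring) (simp_all add: place_field_def)
qed

lemma place_const_eq:
  assumes "principal_local_domain (local_ring C x) \<pi>"
  shows "place_const C x c = fraction (complete_local_ring C x)
    (principal_local_domain.adic_emb (local_ring C x) \<pi> (local_const C c)) \<one>\<^bsub>complete_local_ring C x\<^esub>"
proof -
  interpret L: principal_local_domain "local_ring C x" \<pi> by fact
  show ?thesis
    by (simp add: place_const_def L.adic_emb_def L.adic_lim_def L.ideal_power_nonunits)
qed

text \<open>The map is the composite of three homomorphisms: constants into the local ring, the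
  local ring into its completion, and the completion into its fraction field.\<close>

lemma place_const_hom:
  assumes x: "x \<in> C"
  shows "ring_hom_cring ring_of_type_algebra (place_field C x) (place_const C x)"
proof -
  obtain \<pi> where \<pi>: "principal_local_domain (local_ring C x) \<pi>" using local_uniformizer[OF x] by blast
  then interpret L: principal_local_domain "local_ring C x" \<pi> .
  obtain v where "variety_point C x v" using variety_point_exists[OF x] by blast
  then interpret v: variety_point C x v .
  interpret c: ring_hom_cring ring_of_type_algebra "local_ring C x" "local_const C" by (rule v.local_const_hom)
  interpret e: ring_hom_cring "local_ring C x" "complete_local_ring C x" L.adic_emb
    unfolding complete_local_ring_def by (rule L.adic_emb_hom)
  interpret i: ring_hom_cring "complete_local_ring C x" "place_field C x"
    "\<lambda>a. fraction (complete_local_ring C x) a \<one>\<^bsub>complete_local_ring C x\<^esub>" by (rule integer_hom[OF x])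
  show ?thesis
    using ring_hom_trans[OF ring_hom_trans[OF c.homh e.homh] i.homh]
    by (intro ring_hom_cringI c.R.is_cring i.S.is_cring) (simp add: comp_def place_const_eq[OF \<pi>, abs_def])
qed

lemma place_const_integer:
  assumes x: "x \<in> C"
  shows "place_const C x c \<in> place_integers C x"
proof -
  obtain \<pi> where \<pi>: "principal_local_domain (local_ring C x) \<pi>" using local_uniformizer[OF x] by blast
  then interpret L: principal_local_domain "local_ring C x" \<pi> .
  obtain v where "variety_point C x v" using variety_point_exists[OF x] by blast
  then interpret v: variety_point C x v .
  interpret c: ring_hom_cring ring_of_type_algebra "local_ring C x" "local_const C" by (rule v.local_const_hom)
  interpret e: ring_hom_cring "local_ring C x" "complete_local_ring C x" L.adic_emb
    unfolding complete_local_ring_def by (rule L.adic_emb_hom)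
  have "L.adic_emb (local_const C c) \<in> carrier (complete_local_ring C x)"
    by (intro e.hom_closed c.hom_closed) (simp add: ring_of_type_algebra_def)
  then show ?thesis unfolding place_const_eq[OF \<pi>] place_integers_def by blast
qed

lemma subring_place_integers:
  assumes "x \<in> C"
  shows "subring (place_integers C x) (place_field C x)"
proof -
  interpret i: ring_hom_cring "complete_local_ring C x" "place_field C x"
    "\<lambda>a. fraction (complete_local_ring C x) a \<one>\<^bsub>complete_local_ring C x\<^esub>" by (rule integer_hom[OF assms])
  show ?thesis unfolding place_integers_def
    by (rule ring_hom_ring.img_is_subring[OF
          ring_hom_ringI2[OF i.R.ring_axioms i.S.ring_axioms i.homh] i.R.carrier_is_subring])
qed

section \<open>The ring of adeles\<close>

lemma adele_carrier:
  "\<alpha> \<in> carrier (adele_ring C) \<longleftrightarrow>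
    \<alpha> \<in> extensional C \<and> (\<forall>x\<in>C. \<alpha> x \<in> carrier (place_field C x)) \<and> finite {x \<in> C. \<alpha> x \<notin> place_integers C x}"
  by (auto simp: adele_ring_def PiE_def)

lemma adele_ops:
  "\<alpha> \<otimes>\<^bsub>adele_ring C\<^esub> \<beta> = (\<lambda>x\<in>C. \<alpha> x \<otimes>\<^bsub>place_field C x\<^esub> \<beta> x)"
  "\<alpha> \<oplus>\<^bsub>adele_ring C\<^esub> \<beta> = (\<lambda>x\<in>C. \<alpha> x \<oplus>\<^bsub>place_field C x\<^esub> \<beta> x)"
  "\<one>\<^bsub>adele_ring C\<^esub> = (\<lambda>x\<in>C. \<one>\<^bsub>place_field C x\<^esub>)"
  "\<zero>\<^bsub>adele_ring C\<^esub> = (\<lambda>x\<in>C. \<zero>\<^bsub>place_field C x\<^esub>)"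
  by (simp_all add: adele_ring_def)

text \<open>The places where the result is not integral lie in the union of two finite sets. Unary
  operations are covered by taking both adeles equal.\<close>

lemma adele_closed_binop:
  assumes "\<alpha> \<in> carrier (adele_ring C)" "\<beta> \<in> carrier (adele_ring C)"
    and "\<And>x. x \<in> C \<Longrightarrow> \<gamma> x \<in> carrier (place_field C x)"
    and "\<And>x. x \<in> C \<Longrightarrow> \<alpha> x \<in> place_integers C x \<Longrightarrow> \<beta> x \<in> place_integers C x \<Longrightarrow> \<gamma> x \<in> place_integers C x"
  shows "(\<lambda>x\<in>C. \<gamma> x) \<in> carrier (adele_ring C)"
  unfolding adele_carrier
proof (intro conjI ballI)
  have "{x \<in> C. (\<lambda>x\<in>C. \<gamma> x) x \<notin> place_integers C x} \<subseteq>
    {x \<in> C. \<alpha> x \<notin> place_integers C x} \<union> {x \<in> C. \<beta> x \<notin> place_integers C x}"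
    using assms(4) by auto
  then show "finite {x \<in> C. (\<lambda>x\<in>C. \<gamma> x) x \<notin> place_integers C x}"
    by (rule finite_subset) (use assms(1,2) in \<open>simp add: adele_carrier\<close>)
qed (use assms in auto)

lemma cring_adele_ring: "cring (adele_ring C)"
proof (rule cringI)
  note F = cring_place_field and A = adele_ops
  have comp: "\<alpha> x \<in> carrier (place_field C x)" if "\<alpha> \<in> carrier (adele_ring C)" "x \<in> C" for \<alpha> x
    using that by (simp add: adele_carrier)
  have integers: "a \<otimes>\<^bsub>place_field C x\<^esub> b \<in> place_integers C x" "a \<oplus>\<^bsub>place_field C x\<^esub> b \<in> place_integers C x"
    "\<ominus>\<^bsub>place_field C x\<^esub> a \<in> place_integers C x"
    if "x \<in> C" "a \<in> place_integers C x" "b \<in> place_integers C x" for a b x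
    using subringE(6,7)[OF subring_place_integers[OF that(1)] that(2,3)]
      subringE(5)[OF subring_place_integers[OF that(1)] that(2)] by simp_all
  have constants: "\<one>\<^bsub>adele_ring C\<^esub> \<in> carrier (adele_ring C)" "\<zero>\<^bsub>adele_ring C\<^esub> \<in> carrier (adele_ring C)"
  proof -
    have "{x \<in> C. (\<lambda>x\<in>C. \<one>\<^bsub>place_field C x\<^esub>) x \<notin> place_integers C x} = {}"
      "{x \<in> C. (\<lambda>x\<in>C. \<zero>\<^bsub>place_field C x\<^esub>) x \<notin> place_integers C x} = {}"
      using subringE(2,3)[OF subring_place_integers] by auto
    then show "\<one>\<^bsub>adele_ring C\<^esub> \<in> carrier (adele_ring C)" "\<zero>\<^bsub>adele_ring C\<^esub> \<in> carrier (adele_ring C)"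
      unfolding adele_carrier A using cring.cring_simprules(2,6)[OF F] by (simp_all del: Collect_empty_eq)
  qed
  have closed: "\<alpha> \<otimes>\<^bsub>adele_ring C\<^esub> \<beta> \<in> carrier (adele_ring C)" "\<alpha> \<oplus>\<^bsub>adele_ring C\<^esub> \<beta> \<in> carrier (adele_ring C)"
    if "\<alpha> \<in> carrier (adele_ring C)" "\<beta> \<in> carrier (adele_ring C)" for \<alpha> \<beta>
    unfolding A using that comp integers cring.cring_simprules(1,5)[OF F]
    by (auto intro!: adele_closed_binop[OF that])
  have eqI: "(\<lambda>x\<in>C. f x) = (\<lambda>x\<in>C. g x)" if "\<And>x. x \<in> C \<Longrightarrow> f x = g x" for f g :: "('n, 'k) adele"
    using that by (simp cong: restrict_cong)
  have restr: "(\<lambda>x\<in>C. \<alpha> x) = \<alpha>" if "\<alpha> \<in> carrier (adele_ring C)" for \<alpha>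
    using that by (simp add: adele_carrier extensional_restrict)
  show "abelian_group (adele_ring C)"
  proof (rule abelian_groupI)
    fix \<alpha> \<beta> \<gamma> assume c: "\<alpha> \<in> carrier (adele_ring C)" "\<beta> \<in> carrier (adele_ring C)" "\<gamma> \<in> carrier (adele_ring C)"
    show "\<alpha> \<oplus>\<^bsub>adele_ring C\<^esub> \<beta> \<in> carrier (adele_ring C)" using c closed by blast
    show "\<alpha> \<oplus>\<^bsub>adele_ring C\<^esub> \<beta> \<oplus>\<^bsub>adele_ring C\<^esub> \<gamma> = \<alpha> \<oplus>\<^bsub>adele_ring C\<^esub> (\<beta> \<oplus>\<^bsub>adele_ring C\<^esub> \<gamma>)"
      unfolding A using c comp cring.cring_simprules(7)[OF F] by (intro eqI) simp
    show "\<alpha> \<oplus>\<^bsub>adele_ring C\<^esub> \<beta> = \<beta> \<oplus>\<^bsub>adele_ring C\<^esub> \<alpha>"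
      unfolding A using c comp cring.cring_simprules(10)[OF F] by (intro eqI) simp
  next
    fix \<alpha> assume c: "\<alpha> \<in> carrier (adele_ring C)"
    have "\<zero>\<^bsub>adele_ring C\<^esub> \<oplus>\<^bsub>adele_ring C\<^esub> \<alpha> = (\<lambda>x\<in>C. \<alpha> x)"
      unfolding A using c comp cring.cring_simprules(8)[OF F] by (intro eqI) simp
    then show "\<zero>\<^bsub>adele_ring C\<^esub> \<oplus>\<^bsub>adele_ring C\<^esub> \<alpha> = \<alpha>" using restr[OF c] by simp
    have "(\<lambda>x\<in>C. \<ominus>\<^bsub>place_field C x\<^esub> \<alpha> x) \<in> carrier (adele_ring C)"
      using comp[OF c] integers cring.cring_simprules(3)[OF F] by (intro adele_closed_binop[OF c c]) auto
    moreover have "(\<lambda>x\<in>C. \<ominus>\<^bsub>place_field C x\<^esub> \<alpha> x) \<oplus>\<^bsub>adele_ring C\<^esub> \<alpha> = \<zero>\<^bsub>adele_ring C\<^esub>"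
      unfolding A using c comp cring.cring_simprules(9)[OF F] by (intro eqI) simp
    ultimately show "\<exists>\<beta>\<in>carrier (adele_ring C). \<beta> \<oplus>\<^bsub>adele_ring C\<^esub> \<alpha> = \<zero>\<^bsub>adele_ring C\<^esub>" by blast
  qed (rule constants)
  show "Group.comm_monoid (adele_ring C)"
  proof (rule comm_monoidI)
    fix \<alpha> \<beta> \<gamma> assume c: "\<alpha> \<in> carrier (adele_ring C)" "\<beta> \<in> carrier (adele_ring C)" "\<gamma> \<in> carrier (adele_ring C)"
    show "\<alpha> \<otimes>\<^bsub>adele_ring C\<^esub> \<beta> \<otimes>\<^bsub>adele_ring C\<^esub> \<gamma> = \<alpha> \<otimes>\<^bsub>adele_ring C\<^esub> (\<beta> \<otimes>\<^bsub>adele_ring C\<^esub> \<gamma>)"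
      unfolding A using c comp cring.cring_simprules(11)[OF F] by (intro eqI) simp
  next
    fix \<alpha> \<beta> assume c: "\<alpha> \<in> carrier (adele_ring C)" "\<beta> \<in> carrier (adele_ring C)"
    show "\<alpha> \<otimes>\<^bsub>adele_ring C\<^esub> \<beta> \<in> carrier (adele_ring C)" using c closed by blast
    show "\<alpha> \<otimes>\<^bsub>adele_ring C\<^esub> \<beta> = \<beta> \<otimes>\<^bsub>adele_ring C\<^esub> \<alpha>"
      unfolding A using c comp cring.cring_simprules(14)[OF F] by (intro eqI) simp
  next
    fix \<alpha> assume c: "\<alpha> \<in> carrier (adele_ring C)"
    have "\<one>\<^bsub>adele_ring C\<^esub> \<otimes>\<^bsub>adele_ring C\<^esub> \<alpha> = (\<lambda>x\<in>C. \<alpha> x)"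
      unfolding A using c comp cring.cring_simprules(12)[OF F] by (intro eqI) simp
    then show "\<one>\<^bsub>adele_ring C\<^esub> \<otimes>\<^bsub>adele_ring C\<^esub> \<alpha> = \<alpha>" using restr[OF c] by simp
  qed (rule constants)
  fix \<alpha> \<beta> \<gamma> assume c: "\<alpha> \<in> carrier (adele_ring C)" "\<beta> \<in> carrier (adele_ring C)" "\<gamma> \<in> carrier (adele_ring C)"
  show "(\<alpha> \<oplus>\<^bsub>adele_ring C\<^esub> \<beta>) \<otimes>\<^bsub>adele_ring C\<^esub> \<gamma> =
    \<alpha> \<otimes>\<^bsub>adele_ring C\<^esub> \<gamma> \<oplus>\<^bsub>adele_ring C\<^esub> \<beta> \<otimes>\<^bsub>adele_ring C\<^esub> \<gamma>"
    unfolding A using c comp cring.cring_simprules(13)[OF F] by (intro eqI) simp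
qed

lemma adele_component_hom:
  "x \<in> C \<Longrightarrow> ring_hom_cring (adele_ring C) (place_field C x) (\<lambda>\<alpha>. \<alpha> x)"
  by (intro ring_hom_cringI cring_adele_ring cring_place_field ring_hom_memI)
    (auto simp: adele_ops adele_carrier)

text \<open>With \<open>c\<close> the unit of the place field this is the idempotent cutting out the
  factor at \<open>x\<close>; for other \<open>c\<close> it is the lift of \<open>c\<close>
  supported at \<open>x\<close>.\<close>

definition adele_single :: "('n, 'k) ppoint \<Rightarrow> ('n, 'k) place_elt \<Rightarrow> ('n, 'k) adele" where
  "adele_single x c = (\<lambda>y\<in>C. if y = x then c else \<zero>\<^bsub>place_field C y\<^esub>)"

lemma adele_single_closed:
  assumes "x \<in> C" "c \<in> carrier (place_field C x)"
  shows "adele_single x c \<in> carrier (adele_ring C)"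
  unfolding adele_carrier
proof (intro conjI ballI)
  have "{y \<in> C. adele_single x c y \<notin> place_integers C y} \<subseteq> {x}"
    using subringE(2)[OF subring_place_integers] by (auto simp: adele_single_def)
  then show "finite {y \<in> C. adele_single x c y \<notin> place_integers C y}" by (rule finite_subset) simp
qed (use assms cring.cring_simprules(2)[OF cring_place_field] in \<open>auto simp: adele_single_def\<close>)

lemma adele_const_closed:
  "adele_const C c \<in> carrier (adele_ring C)"
proof -
  have "{x \<in> C. adele_const C c x \<notin> place_integers C x} = {}"
    using place_const_integer by (auto simp: adele_const_def)
  moreover have "place_const C x c \<in> carrier (place_field C x)" if "x \<in> C" for x
    using place_const_integer[OF that, of c] subringE(1)[OF subring_place_integers[OF that]] by blast
  ultimately show ?thesis unfolding adele_carrier by (simp add: adele_const_def del: Collect_empty_eq)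
qed

lemma adele_const_hom: "ring_hom_cring ring_of_type_algebra (adele_ring C) (adele_const C)"
proof (rule ring_hom_cringI[OF cring_from_type_algebra cring_adele_ring], rule ring_hom_memI)
  note hom = ring_hom_cring.homh[OF place_const_hom]
  have car: "a \<in> carrier ring_of_type_algebra" for a :: 'k by (simp add: ring_of_type_algebra_def)
  fix a b :: 'k
  show "adele_const C a \<in> carrier (adele_ring C)" by (rule adele_const_closed)
  show "adele_const C (a \<otimes>\<^bsub>ring_of_type_algebra\<^esub> b) = adele_const C a \<otimes>\<^bsub>adele_ring C\<^esub> adele_const C b"
    unfolding adele_ops adele_const_def using ring_hom_mult[OF hom car car] by (simp cong: restrict_cong)
  show "adele_const C (a \<oplus>\<^bsub>ring_of_type_algebra\<^esub> b) = adele_const C a \<oplus>\<^bsub>adele_ring C\<^esub> adele_const C b"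
    unfolding adele_ops adele_const_def using ring_hom_add[OF hom car car] by (simp cong: restrict_cong)
  show "adele_const C \<one>\<^bsub>ring_of_type_algebra\<^esub> = \<one>\<^bsub>adele_ring C\<^esub>"
    unfolding adele_ops adele_const_def using ring_hom_one[OF hom] by (simp cong: restrict_cong)
qed

end

section \<open>Roots of unity and logarithms\<close>

text \<open>As p is prime, an exponent d not divisible by p has an inverse e modulo p. Then w =
  w^(de), so w^d = 1 would force w = 1.\<close>

lemma root_of_unity_power_eq_iff:
  fixes w :: "'k::field"
  assumes p: "Factorial_Ring.prime p" and w: "w ^ p = 1" "w \<noteq> 1"
  shows "w ^ i = w ^ j \<longleftrightarrow> [i = j] (mod p)"
proof -
  have w0: "w \<noteq> 0" using w(1) prime_gt_0_nat[OF p] by (metis power_0_left less_numeral_extra(3) zero_neq_one)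
  have dvd: "w ^ d = 1 \<longleftrightarrow> p dvd d" for d
  proof
    assume d: "w ^ d = 1"
    show "p dvd d"
    proof (rule ccontr)
      assume "\<not> p dvd d"
      then have "coprime d p" using prime_imp_coprime[OF p] coprime_commute by blast
      then obtain e where "[d * e = Suc 0] (mod p)" using cong_solve_coprime_nat by blast
      moreover have "1 < p" using p by (rule prime_gt_1_nat)
      ultimately have "(d * e) mod p = 1" by (simp add: cong_def)
      then obtain q where de: "d * e = 1 + p * q" by (metis add.commute mult.commute div_mult_mod_eq)
      have "w ^ (d * e) = w" unfolding de by (simp add: power_add power_mult w(1))
      then show False using d w(2) by (simp add: power_mult)
    qed
  qed (auto simp: power_mult w(1))
  have le: "w ^ i = w ^ j \<longleftrightarrow> [i = j] (mod p)" if "i \<le> j" for i j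
  proof -
    have "w ^ j = w ^ i * w ^ (j - i)" using that by (simp flip: power_add)
    then have "w ^ i = w ^ j \<longleftrightarrow> w ^ (j - i) = 1" using w0 by auto
    also have "\<dots> \<longleftrightarrow> [i = j] (mod p)" unfolding dvd using cong_altdef_nat[OF that, of p] cong_sym_eq by metis
    finally show ?thesis .
  qed
  show ?thesis
    using le[of i j] le[of j i] by (metis cong_sym_eq nat_le_linear)
qed

text \<open>The powers of \<open>\<zeta>\<close> with exponents below p are p distinct roots of X^p
  - 1, which has at most p roots; so they are all of them, and \<open>log_mu\<close> inverts a
  bijection.\<close>

lemma log_mu_root:
  fixes \<zeta> u :: "'k::field"
  assumes p: "p > 0" and \<zeta>: "primitive_root_of_unity p \<zeta>" and u: "u ^ p = 1"
  obtains j where "j < p" "log_mu p \<zeta> u = int j" "\<zeta> ^ j = u"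
proof -
  have \<zeta>': "\<zeta> ^ p = 1" "\<And>j. 0 < j \<Longrightarrow> j < p \<Longrightarrow> \<zeta> ^ j \<noteq> 1"
    using \<zeta> by (auto simp: primitive_root_of_unity_def)
  have \<zeta>0: "\<zeta> \<noteq> 0" using \<zeta>'(1) p by (metis power_0_left less_numeral_extra(3) zero_neq_one)
  have inj: "inj_on (\<lambda>j. \<zeta> ^ j) {..<p}"
  proof (rule linorder_inj_onI)
    fix i j :: nat assume ij: "i < j" "i \<in> {..<p}" "j \<in> {..<p}"
    have "\<zeta> ^ j = \<zeta> ^ i * \<zeta> ^ (j - i)" using ij by (simp flip: power_add)
    then show "\<zeta> ^ i \<noteq> \<zeta> ^ j" using \<zeta>'(2)[of "j - i"] ij \<zeta>0 by auto
  qed auto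
  let ?q = "Polynomial.monom 1 p - 1 :: 'k poly"
  have q0: "?q \<noteq> 0"
  proof
    assume "?q = 0"
    then have "Polynomial.coeff ?q p = 0" by simp
    then show False using p by (simp add: coeff_1)
  qed
  have deg: "degree ?q \<le> p" by (intro degree_diff_le degree_monom_le) simp
  have roots: "{x. Polynomial.poly ?q x = 0} = {x. x ^ p = 1}" by (simp add: Polynomial.poly_monom)
  have fin: "finite {x :: 'k. x ^ p = 1}" using poly_roots_finite[OF q0] unfolding roots .
  have "card {x :: 'k. x ^ p = 1} \<le> p"
    using card_poly_roots_bound[OF q0] deg unfolding roots by simp
  moreover have "card ((\<lambda>j. \<zeta> ^ j) ` {..<p}) = p" using inj by (simp add: card_image)
  moreover have "(\<lambda>j. \<zeta> ^ j) ` {..<p} \<subseteq> {x. x ^ p = 1}"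
  proof
    fix x assume "x \<in> (\<lambda>j. \<zeta> ^ j) ` {..<p}"
    then obtain j where "x = \<zeta> ^ j" by blast
    then have "x ^ p = (\<zeta> ^ p) ^ j" by (simp flip: power_mult add: mult.commute)
    then show "x \<in> {x. x ^ p = 1}" using \<zeta>'(1) by simp
  qed
  ultimately have img: "(\<lambda>j. \<zeta> ^ j) ` {..<p} = {x. x ^ p = 1}"
    using card_seteq[OF fin] by auto
  have "u \<in> (\<lambda>j. \<zeta> ^ j) ` {..<p}" unfolding img using u by simp
  then obtain j where j: "j < p" "\<zeta> ^ j = u" by auto
  have car: "carrier (residue_ring (int p)) = {0..int p - 1}" by (simp add: residue_ring_def)
  have "inj_on (\<lambda>j. \<zeta> powi j) {0..int p - 1}"
  proof (rule inj_onI)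
    fix a b :: int assume ab: "a \<in> {0..int p - 1}" "b \<in> {0..int p - 1}" "\<zeta> powi a = \<zeta> powi b"
    then have "\<zeta> ^ nat a = \<zeta> ^ nat b" by (simp add: power_int_def)
    then have "nat a = nat b" using inj_onD[OF inj] ab by auto
    then show "a = b" using ab by auto
  qed
  then have "log_mu p \<zeta> (\<zeta> powi int j) = int j"
    unfolding log_mu_def car using j by (intro inv_into_f_f) auto
  then show thesis using j by (intro that[of j]) simp_all
qed

text \<open>If \<open>\<omega>\<close> is the j-th power of \<open>\<zeta>\<close>, its m-th power
  has logarithm jm modulo p, and the quotient j/(jm) is the inverse of m, that is n. It makes sense
  because p cannot divide m, nor j as \<open>\<omega>\<close> is not 1.\<close>

lemma log_quotient:
  fixes \<zeta> \<omega> :: "'k::field"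
  assumes p: "Factorial_Ring.prime p" and \<zeta>: "primitive_root_of_unity p \<zeta>"
    and \<omega>: "\<omega> ^ p = 1" "\<omega> \<noteq> 1" and m: "[int m * n = 1] (mod int p)"
  defines "Zp \<equiv> residue_ring (int p)"
  shows "log_mu p \<zeta> (\<omega> ^ m) \<in> Units Zp"
    "[n = log_mu p \<zeta> \<omega> \<otimes>\<^bsub>Zp\<^esub> inv\<^bsub>Zp\<^esub> log_mu p \<zeta> (\<omega> ^ m)] (mod int p)"
proof -
  interpret residues_prime p Zp unfolding Zp_def by (simp add: residues_prime_def p)
  have p0: "p > 0" using p by (rule prime_gt_0_nat)
  have \<zeta>1: "\<zeta> ^ p = 1" "\<zeta> \<noteq> 1"
    using \<zeta> prime_gt_1_nat[OF p] unfolding primitive_root_of_unity_def by (auto dest: spec[of _ 1])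
  obtain j where j: "j < p" "log_mu p \<zeta> \<omega> = int j" "\<zeta> ^ j = \<omega>" using log_mu_root[OF p0 \<zeta> \<omega>(1)] .
  have "(\<omega> ^ m) ^ p = 1" using \<omega>(1) by (metis power_mult mult.commute power_one)
  then obtain k where k: "k < p" "log_mu p \<zeta> (\<omega> ^ m) = int k" "\<zeta> ^ k = \<omega> ^ m"
    using log_mu_root[OF p0 \<zeta>] by blast
  have "\<zeta> ^ k = \<zeta> ^ (j * m)" using j(3) k(3) by (simp add: power_mult)
  then have kj: "[k = j * m] (mod p)" using root_of_unity_power_eq_iff[OF p \<zeta>1] by blast
  then have kj': "[int k = int j * int m] (mod int p)" by (metis cong_int_iff of_nat_mult)
  have "k \<noteq> 0"
  proof
    assume "k = 0"
    then have "\<omega> ^ m = 1" using k(3) by simp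
    then have "p dvd m" using root_of_unity_power_eq_iff[OF p \<omega>, of m 0] by (simp add: cong_0_iff)
    then have "[int m * n = 0] (mod int p)" by (simp add: cong_0_iff)
    then have "[1 = (0::int)] (mod int p)" using m cong_sym cong_trans by blast
    then show False using prime_gt_1_nat[OF p] by (simp add: cong_0_iff)
  qed
  then show unit: "log_mu p \<zeta> (\<omega> ^ m) \<in> Units Zp"
    unfolding k(2) res_prime_units_eq using k(1) by auto
  define w where "w = inv\<^bsub>Zp\<^esub> (int k)"
  have "int k \<otimes>\<^bsub>Zp\<^esub> w = \<one>\<^bsub>Zp\<^esub>" using unit unfolding k(2) w_def by simp
  then have kw: "[int k * w = 1] (mod int p)"
    using prime_gt_1_nat[OF p] by (simp add: res_mult_eq res_one_eq cong_def)
  have "[int j * w * (int m * n) = int j * w * 1] (mod int p)" by (rule cong_scalar_left[OF m])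
  moreover have "[int k * w * n = int j * int m * w * n] (mod int p)"
    by (intro cong_scalar_right kj')
  moreover have "[int k * w * n = 1 * n] (mod int p)" by (rule cong_scalar_right[OF kw])
  ultimately have "[n = int j * w] (mod int p)"
    by (simp add: mult_ac) (metis cong_sym cong_trans)
  then show "[n = log_mu p \<zeta> \<omega> \<otimes>\<^bsub>Zp\<^esub> inv\<^bsub>Zp\<^esub> log_mu p \<zeta> (\<omega> ^ m)] (mod int p)"
    unfolding j(2) k(2) w_def[symmetric] res_mult_eq by (simp add: cong_def)
qed

section \<open>Valuations of primitive elements\<close>

lemma ring_of_type_algebra_pow:
  "a [^]\<^bsub>(ring_of_type_algebra :: 'k::field ring)\<^esub> (n::nat) = a ^ n"
  by (induction n) (simp_all add: ring_of_type_algebra_def mult.commute)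

lemma ring_of_type_algebra_simps:
  fixes a b :: "'k::field"
  shows "a \<in> carrier ring_of_type_algebra" "a \<otimes>\<^bsub>ring_of_type_algebra\<^esub> b = a * b"
    "a \<oplus>\<^bsub>ring_of_type_algebra\<^esub> b = a + b"
    "\<one>\<^bsub>ring_of_type_algebra\<^esub> = (1::'k)" "\<zero>\<^bsub>ring_of_type_algebra\<^esub> = (0::'k)"
  by (simp_all add: ring_of_type_algebra_def)

lemma const_hom_unit:
  assumes "ring_hom_cring (ring_of_type_algebra :: 'k::field ring) S h" "c \<noteq> 0"
  shows "h c \<in> Units S"
proof -
  interpret ring_hom_cring "ring_of_type_algebra :: 'k ring" S h by fact
  have 1: "h c \<otimes>\<^bsub>S\<^esub> h (inverse c) = \<one>\<^bsub>S\<^esub>"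
    using hom_mult[of c "inverse c"] hom_one assms(2) by (simp add: ring_of_type_algebra_simps)
  have c: "h c \<in> carrier S" "h (inverse c) \<in> carrier S"
    by (simp_all add: ring_of_type_algebra_simps)
  have "h (inverse c) \<otimes>\<^bsub>S\<^esub> h c = \<one>\<^bsub>S\<^esub>" using 1 S.m_comm[OF c] by simp
  then show ?thesis unfolding Units_def using 1 c by blast
qed

lemma const_hom_diff:
  assumes "ring_hom_cring (ring_of_type_algebra :: 'k::field ring) S h"
  shows "h a \<ominus>\<^bsub>S\<^esub> h b = h (a - b)"
proof -
  interpret ring_hom_cring "ring_of_type_algebra :: 'k ring" S h by fact
  have c: "h c \<in> carrier S" for c by (simp add: ring_of_type_algebra_simps)
  have "h (a - b) \<oplus>\<^bsub>S\<^esub> h b = h a"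
    using hom_add[of "a - b" b] by (simp add: ring_of_type_algebra_simps)
  then have "h a \<ominus>\<^bsub>S\<^esub> h b = h (a - b) \<oplus>\<^bsub>S\<^esub> h b \<ominus>\<^bsub>S\<^esub> h b" by simp
  also have "\<dots> = h (a - b)" using c by (simp add: S.minus_eq S.a_assoc S.r_neg)
  finally show ?thesis .
qed

context curve
begin

lemma split_projection_component:
  assumes x: "x \<in> C"
  shows "split_projection (adele_ring C) (place_field C x) (\<lambda>\<alpha>. \<alpha> x) (adele_single x \<one>\<^bsub>place_field C x\<^esub>)"
proof -
  interpret h: ring_hom_cring "adele_ring C" "place_field C x" "\<lambda>\<alpha>. \<alpha> x" by (rule adele_component_hom[OF x])
  have F: "cring (place_field C y)" if "y \<in> C" for y using cring_place_field[OF that] .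
  show ?thesis
  proof unfold_locales
    show "adele_single x \<one>\<^bsub>place_field C x\<^esub> \<in> carrier (adele_ring C)" by (rule adele_single_closed[OF x]) simp
    show "adele_single x \<one>\<^bsub>place_field C x\<^esub> x = \<one>\<^bsub>place_field C x\<^esub>" using x by (simp add: adele_single_def)
  next
    fix \<alpha> assume \<alpha>: "\<alpha> \<in> carrier (adele_ring C)" "\<alpha> x = \<zero>\<^bsub>place_field C x\<^esub>"
    have "adele_single x \<one>\<^bsub>place_field C x\<^esub> y \<otimes>\<^bsub>place_field C y\<^esub> \<alpha> y = \<zero>\<^bsub>place_field C y\<^esub>" if "y \<in> C" for y
      using that \<alpha> cring.cring_simprules(6,26)[OF F[OF that]] cring.cring_simprules(24,25)[OF F[OF that]]
      by (cases "y = x") (auto simp: adele_single_def adele_carrier)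
    then show "adele_single x \<one>\<^bsub>place_field C x\<^esub> \<otimes>\<^bsub>adele_ring C\<^esub> \<alpha> = \<zero>\<^bsub>adele_ring C\<^esub>"
      unfolding adele_ops by (simp cong: restrict_cong)
  next
    fix c assume c: "c \<in> carrier (place_field C x)"
    have "adele_single x \<one>\<^bsub>place_field C x\<^esub> y \<otimes>\<^bsub>place_field C y\<^esub> adele_single x c y = adele_single x c y" if "y \<in> C" for y
      using that c cring.cring_simprules(2)[OF F[OF that]] cring.cring_simprules(12)[OF F[OF that]]
        cring.cring_simprules(24,25,26)[OF F[OF that]]
      by (cases "y = x") (auto simp: adele_single_def)
    then have "adele_single x \<one>\<^bsub>place_field C x\<^esub> \<otimes>\<^bsub>adele_ring C\<^esub> adele_single x c = (\<lambda>y\<in>C. adele_single x c y)"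
      unfolding adele_ops by (simp cong: restrict_cong)
    also have "\<dots> = adele_single x c" using adele_single_closed[OF x c] by (simp add: adele_carrier extensional_restrict)
    finally show "\<exists>\<alpha>\<in>carrier (adele_ring C). \<alpha> x = c \<and> adele_single x \<one>\<^bsub>place_field C x\<^esub> \<otimes>\<^bsub>adele_ring C\<^esub> \<alpha> = \<alpha>"
      using adele_single_closed[OF x c] x by (intro bexI[of _ "adele_single x c"]) (auto simp: adele_single_def)
  qed
qed

lemma component_proj_eq:
  "component_proj C p t x = root_ext_map (adele_ring C) (place_field C x) (\<lambda>\<alpha>. \<alpha> x) p t"
  by (simp add: fun_eq_iff component_proj_def root_ext_map_def)

text \<open>Unique existence of the induced automorphism gives access to the properties in the
  definite description.\<close>

lemma component_aut:
  assumes x: "x \<in> C" and p: "p > 0" and t: "t \<in> carrier (adele_ring C)" and g: "g \<in> carrier (GG C p t)"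
  shows "component_aut C p t x g \<in> carrier (root_ext_aut (place_field C x) p (t x))"
    "\<And>\<beta>. \<beta> \<in> carrier (adele_ext C p t) \<Longrightarrow>
       component_aut C p t x g (component_proj C p t x \<beta>) = component_proj C p t x (g \<beta>)"
  using theI'[OF split_projection.component_automorphism[OF split_projection_component[OF x] t p g]]
  unfolding component_aut_def component_proj_eq by blast+

lemma idele_component_nonzero:
  assumes "x \<in> C" "u \<in> ideles C"
  shows "u x \<in> carrier (place_field C x) - {\<zero>\<^bsub>place_field C x\<^esub>}"
proof -
  interpret h: ring_hom_cring "adele_ring C" "place_field C x" "\<lambda>\<alpha>. \<alpha> x" by (rule adele_component_hom[OF assms(1)])
  interpret K: field "place_field C x" by (rule field_place_field[OF assms(1)])
  have u: "u \<in> carrier (adele_ring C)" "inv\<^bsub>adele_ring C\<^esub> u \<in> carrier (adele_ring C)"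
    "u \<otimes>\<^bsub>adele_ring C\<^esub> inv\<^bsub>adele_ring C\<^esub> u = \<one>\<^bsub>adele_ring C\<^esub>"
    using assms(2) by auto
  have "u x \<otimes>\<^bsub>place_field C x\<^esub> (inv\<^bsub>adele_ring C\<^esub> u) x = \<one>\<^bsub>place_field C x\<^esub>"
    using h.hom_mult[OF u(1,2)] h.hom_one unfolding u(3) by simp
  then have "u x \<noteq> \<zero>\<^bsub>place_field C x\<^esub>" using h.hom_closed[OF u(2)] by auto
  then show ?thesis using h.hom_closed[OF u(1)] by simp
qed

section \<open>Valuations at a place and p-th powers\<close>

lemma place_val_one:
  assumes "x \<in> C"
  shows "place_val C x \<one>\<^bsub>place_field C x\<^esub> = 0"
proof -
  interpret K: field "place_field C x" by (rule field_place_field[OF assms])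
  show ?thesis using place_val_mult[OF assms, of "\<one>\<^bsub>place_field C x\<^esub>" "\<one>\<^bsub>place_field C x\<^esub>"] by simp
qed

lemma place_val_pow:
  assumes "x \<in> C" "a \<in> carrier (place_field C x) - {\<zero>\<^bsub>place_field C x\<^esub>}"
  shows "a [^]\<^bsub>place_field C x\<^esub> (n::nat) \<in> carrier (place_field C x) - {\<zero>\<^bsub>place_field C x\<^esub>}"
    "place_val C x (a [^]\<^bsub>place_field C x\<^esub> n) = int n * place_val C x a"
proof -
  interpret K: field "place_field C x" by (rule field_place_field[OF assms(1)])
  show nz: "a [^]\<^bsub>place_field C x\<^esub> n \<in> carrier (place_field C x) - {\<zero>\<^bsub>place_field C x\<^esub>}" for n :: nat
    by (induction n) (use assms(2) in \<open>auto simp: K.integral_iff\<close>)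
  show "place_val C x (a [^]\<^bsub>place_field C x\<^esub> n) = int n * place_val C x a"
  proof (induction n)
    case (Suc n)
    then show ?case using place_val_mult[OF assms(1) nz[of n] assms(2)] by (simp add: algebra_simps)
  qed (simp add: place_val_one[OF assms(1)])
qed

lemma place_val_inv:
  assumes "x \<in> C" "a \<in> carrier (place_field C x) - {\<zero>\<^bsub>place_field C x\<^esub>}"
  shows "inv\<^bsub>place_field C x\<^esub> a \<in> carrier (place_field C x) - {\<zero>\<^bsub>place_field C x\<^esub>}"
    "place_val C x (inv\<^bsub>place_field C x\<^esub> a) = - place_val C x a"
proof -
  interpret K: field "place_field C x" by (rule field_place_field[OF assms(1)])
  have a: "a \<in> Units (place_field C x)" using assms(2) by (simp add: K.field_Units)
  have "inv\<^bsub>place_field C x\<^esub> a \<in> Units (place_field C x)" using a by (rule K.Units_inv_Units)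
  then show inv: "inv\<^bsub>place_field C x\<^esub> a \<in> carrier (place_field C x) - {\<zero>\<^bsub>place_field C x\<^esub>}"
    by (simp only: K.field_Units)
  have "place_val C x (a \<otimes>\<^bsub>place_field C x\<^esub> inv\<^bsub>place_field C x\<^esub> a) = 0"
    using a place_val_one[OF assms(1)] by simp
  then show "place_val C x (inv\<^bsub>place_field C x\<^esub> a) = - place_val C x a"
    using place_val_mult[OF assms inv] by simp
qed

text \<open>If p divides the valuation of \<open>a\<close>, then \<open>a\<close> is a p-th power
  and \<open>y\<close> defines a point with coordinates in the place field. Evaluating
  \<open>z\<close> there makes \<open>b\<close> a p-th power as well.\<close>

lemma power_basis_val_dvd:
  assumes x: "x \<in> C" and p: "Factorial_Ring.prime p" "p \<noteq> CHAR('k)"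
    and hom: "ring_hom_cring (place_field C x) E \<iota>"
    and y: "power_basis (place_field C x) E \<iota> p y" "y [^]\<^bsub>E\<^esub> p = \<iota> a"
    and z: "z \<in> carrier E" "z [^]\<^bsub>E\<^esub> p = \<iota> b"
    and a: "a \<in> carrier (place_field C x) - {\<zero>\<^bsub>place_field C x\<^esub>}"
    and b: "b \<in> carrier (place_field C x) - {\<zero>\<^bsub>place_field C x\<^esub>}"
    and dvd: "int p dvd place_val C x a"
  shows "int p dvd place_val C x b"
proof -
  interpret K: field "place_field C x" by (rule field_place_field[OF x])
  interpret ring_hom_cring "place_field C x" E \<iota> by (rule hom)
  have p0: "p > 0" using p(1) by (rule prime_gt_0_nat)
  obtain c where c: "c \<in> carrier (place_field C x)" "a = c [^]\<^bsub>place_field C x\<^esub> p"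
    using place_val_root[OF x p a dvd] by blast
  obtain d where d: "d \<in> carrier (place_field C x)" "b = d [^]\<^bsub>place_field C x\<^esub> p"
    using power_basis_root[OF y(1) p0 c(1) _ z] y(2) c(2) b by blast
  have "d \<noteq> \<zero>\<^bsub>place_field C x\<^esub>" using b d(2) p0 by (auto simp: K.nat_pow_zero)
  then show ?thesis using place_val_pow(2)[OF x, of d p] d by simp
qed

text \<open>The definite description in \<open>kummer_pairing\<close> needs an explicit p-th root of
  \<open>z\<close> and uniqueness of the eigenvalue among all roots. Both come from the eigenbasis
  of powers of \<open>y\<close>, without the field property of the extension.\<close>

lemma kummer_pairing_primitive:
  assumes x: "x \<in> C" and p: "Factorial_Ring.prime p" "p \<noteq> CHAR('k)"
    and t: "t x \<in> carrier (place_field C x)"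
    and k: "k \<in> carrier (root_ext_aut (place_field C x) p (t x))"
    and y: "power_basis (place_field C x) (place_ext C p t x) (place_emb C p t x) p y"
      "y [^]\<^bsub>place_ext C p t x\<^esub> p = place_emb C p t x s"
    and s: "s \<in> carrier (place_field C x) - {\<zero>\<^bsub>place_field C x\<^esub>}"
    and ky: "k y = place_emb C p t x (place_const C x \<omega>) \<otimes>\<^bsub>place_ext C p t x\<^esub> y"
    and \<omega>: "\<omega> ^ p = 1" "\<omega> \<noteq> 1"
    and z: "z \<in> uniformizers C x"
    and m: "[int m * place_val C x s = 1] (mod int p)"
  shows "kummer_pairing C p t x k z = \<omega> ^ m"
proof -
  let ?K = "place_field C x" and ?E = "place_ext C p t x" and ?\<iota> = "place_emb C p t x"
  have p0: "p > 0" using p(1) by (rule prime_gt_0_nat)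
  interpret K: field ?K by (rule field_place_field[OF x])
  interpret i: ring_hom_cring ?K ?E ?\<iota> by (rule K.root_ext_emb_hom[OF t])
  interpret c: ring_hom_cring ring_of_type_algebra ?K "place_const C x" by (rule place_const_hom[OF x])
  have k': "k \<in> ring_hom ?E ?E" "\<And>a. a \<in> carrier ?K \<Longrightarrow> k (?\<iota> a) = ?\<iota> a"
    using k unfolding root_ext_aut_carrier by auto
  interpret k: ring_hom_cring ?E ?E k by (rule ring_hom_cringI[OF i.S.is_cring i.S.is_cring k'(1)])
  have yE: "y \<in> carrier ?E" by (rule i.power_basis_closed[OF y(1)])
  have zK: "z \<in> carrier ?K - {\<zero>\<^bsub>?K\<^esub>}" "place_val C x z = 1" using z by (auto simp: uniformizers_def)
  have cK: "place_const C x a \<in> carrier ?K" for a by (simp add: ring_of_type_algebra_simps)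
  have cpow: "place_const C x a [^]\<^bsub>?K\<^esub> n = place_const C x (a ^ n)" for a and n :: nat
    using c.hom_pow[of a n] by (simp add: ring_of_type_algebra_simps ring_of_type_algebra_pow)
  have c_inj: "a = b" if "place_const C x a = place_const C x b" for a b
  proof (rule ccontr)
    assume "a \<noteq> b"
    then have "place_const C x a \<ominus>\<^bsub>?K\<^esub> place_const C x b \<in> Units ?K"
      unfolding const_hom_diff[OF place_const_hom[OF x]] by (intro const_hom_unit[OF place_const_hom[OF x]]) simp
    then show False unfolding that using cK by (simp add: K.field_Units K.minus_eq K.r_neg)
  qed
  \<comment> \<open>The inverse used in the pairing exists because \<open>\<beta>\<close> divides
    the unit \<open>z\<close>: it is the (p-1)-th power of \<open>\<beta>\<close> times the inverse
    of \<open>z\<close>.\<close>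
  have unit: "\<beta> \<in> Units ?E" if \<beta>: "\<beta> \<in> carrier ?E" "\<beta> [^]\<^bsub>?E\<^esub> p = ?\<iota> z" for \<beta>
  proof -
    have zU: "z \<in> Units ?K" using zK by (simp add: K.field_Units)
    have zc: "z \<in> carrier ?K" "inv\<^bsub>?K\<^esub> z \<in> carrier ?K"
      using zU by (rule K.Units_closed, rule K.Units_inv_closed)
    have iz: "?\<iota> z \<otimes>\<^bsub>?E\<^esub> ?\<iota> (inv\<^bsub>?K\<^esub> z) = \<one>\<^bsub>?E\<^esub>"
      unfolding i.hom_mult[OF zc, symmetric] K.Units_r_inv[OF zU] by (rule i.hom_one)
    have "\<beta> [^]\<^bsub>?E\<^esub> Suc (p - 1) = \<beta> \<otimes>\<^bsub>?E\<^esub> \<beta> [^]\<^bsub>?E\<^esub> (p - 1)"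
      using \<beta>(1) by (simp add: i.S.m_comm del: One_nat_def)
    then have pow: "\<beta> \<otimes>\<^bsub>?E\<^esub> \<beta> [^]\<^bsub>?E\<^esub> (p - 1) = ?\<iota> z" using p0 \<beta>(2) by simp
    define W where "W = \<beta> [^]\<^bsub>?E\<^esub> (p - 1) \<otimes>\<^bsub>?E\<^esub> ?\<iota> (inv\<^bsub>?K\<^esub> z)"
    have W: "W \<in> carrier ?E" using \<beta>(1) zc(2) by (simp add: W_def)
    have "\<beta> \<otimes>\<^bsub>?E\<^esub> W = (\<beta> \<otimes>\<^bsub>?E\<^esub> \<beta> [^]\<^bsub>?E\<^esub> (p - 1)) \<otimes>\<^bsub>?E\<^esub> ?\<iota> (inv\<^bsub>?K\<^esub> z)"
      unfolding W_def using \<beta>(1) zc(2) by (simp add: i.S.m_assoc)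
    then have "\<beta> \<otimes>\<^bsub>?E\<^esub> W = \<one>\<^bsub>?E\<^esub>" unfolding pow iz .
    moreover from this have "W \<otimes>\<^bsub>?E\<^esub> \<beta> = \<one>\<^bsub>?E\<^esub>" using i.S.m_comm[OF W \<beta>(1)] by simp
    ultimately show ?thesis unfolding Units_def using \<beta>(1) W by blast
  qed
  have ratio: "k \<beta> \<otimes>\<^bsub>?E\<^esub> inv\<^bsub>?E\<^esub> \<beta> = ?\<iota> a \<longleftrightarrow> k \<beta> = ?\<iota> a \<otimes>\<^bsub>?E\<^esub> \<beta>"
    if \<beta>: "\<beta> \<in> Units ?E" and a: "a \<in> carrier ?K" for a \<beta>
  proof -
    have \<beta>E: "\<beta> \<in> carrier ?E" using \<beta> by (rule i.S.Units_closed)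
    show ?thesis
    proof
      assume "k \<beta> \<otimes>\<^bsub>?E\<^esub> inv\<^bsub>?E\<^esub> \<beta> = ?\<iota> a"
      from this[symmetric] show "k \<beta> = ?\<iota> a \<otimes>\<^bsub>?E\<^esub> \<beta>"
        using \<beta> \<beta>E by (simp add: i.S.m_assoc)
    next
      assume "k \<beta> = ?\<iota> a \<otimes>\<^bsub>?E\<^esub> \<beta>"
      then show "k \<beta> \<otimes>\<^bsub>?E\<^esub> inv\<^bsub>?E\<^esub> \<beta> = ?\<iota> a"
        using \<beta> \<beta>E a by (simp add: i.S.m_assoc)
    qed
  qed
  let ?P = "\<lambda>c. c ^ p = 1 \<and>
    (\<exists>\<beta>\<in>carrier ?E. \<beta> [^]\<^bsub>?E\<^esub> p = ?\<iota> z \<and> k \<beta> \<otimes>\<^bsub>?E\<^esub> inv\<^bsub>?E\<^esub> \<beta> = ?\<iota> (place_const C x c))"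
  have "(THE c. ?P c) = \<omega> ^ m"
  proof (rule the_equality)
    let ?sm = "s [^]\<^bsub>?K\<^esub> m"
    \<comment> \<open>The choice of \<open>m\<close> makes the valuation of s^m / z divisible by p,
      so this quotient is a p-th power d^p.\<close>
    define q where "q = inv\<^bsub>?K\<^esub> z \<otimes>\<^bsub>?K\<^esub> ?sm"
    note sm = place_val_pow[OF x s, of m] and iz = place_val_inv[OF x zK(1)]
    have q: "q \<in> carrier ?K - {\<zero>\<^bsub>?K\<^esub>}" using sm iz by (auto simp: q_def K.integral_iff)
    have "place_val C x q = int m * place_val C x s - 1"
      unfolding q_def using place_val_mult[OF x iz(1) sm(1)] sm(2) iz(2) zK(2) by simp
    then have "int p dvd place_val C x q" using m by (simp add: cong_iff_dvd_diff)
    then obtain d where d: "d \<in> carrier ?K" "q = d [^]\<^bsub>?K\<^esub> p" using place_val_root[OF x p q] by blast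
    have "d \<noteq> \<zero>\<^bsub>?K\<^esub>" using q d(2) p0 by (auto simp: K.nat_pow_zero)
    then have dU: "d \<in> Units ?K" using d(1) by (simp add: K.field_Units)
    define d' where "d' = inv\<^bsub>?K\<^esub> d"
    have d': "d' \<in> carrier ?K" "d' \<otimes>\<^bsub>?K\<^esub> d = \<one>\<^bsub>?K\<^esub>" using dU by (auto simp: d'_def)
    have zU: "z \<in> Units ?K" using zK by (simp add: K.field_Units)
    have "?sm = z \<otimes>\<^bsub>?K\<^esub> q" using zU sm(1) by (simp add: q_def K.m_assoc[symmetric] K.Units_closed)
    then have "d' [^]\<^bsub>?K\<^esub> p \<otimes>\<^bsub>?K\<^esub> ?sm = z \<otimes>\<^bsub>?K\<^esub> (d' \<otimes>\<^bsub>?K\<^esub> d) [^]\<^bsub>?K\<^esub> p"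
      unfolding d(2) K.nat_pow_distrib[OF d'(1) d(1)] using d'(1) d(1) zK(1) by (simp add: K.m_ac)
    then have dz: "d' [^]\<^bsub>?K\<^esub> p \<otimes>\<^bsub>?K\<^esub> ?sm = z" using zK by (simp add: d'(2))
    \<comment> \<open>The p-th root y^m / d of \<open>z\<close>; since \<open>d\<close> is a scalar,
      the eigenvalue is that of y^m.\<close>
    define \<beta> where "\<beta> = ?\<iota> d' \<otimes>\<^bsub>?E\<^esub> y [^]\<^bsub>?E\<^esub> m"
    have \<beta>E: "\<beta> \<in> carrier ?E" using d' yE by (simp add: \<beta>_def)
    have "\<beta> [^]\<^bsub>?E\<^esub> p = ?\<iota> d' [^]\<^bsub>?E\<^esub> p \<otimes>\<^bsub>?E\<^esub> (y [^]\<^bsub>?E\<^esub> p) [^]\<^bsub>?E\<^esub> m"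
      unfolding \<beta>_def using d' yE by (simp add: i.S.nat_pow_distrib i.S.nat_pow_pow mult.commute)
    also have "\<dots> = ?\<iota> (d' [^]\<^bsub>?K\<^esub> p \<otimes>\<^bsub>?K\<^esub> ?sm)" unfolding y(2) using d' s by simp
    finally have \<beta>p: "\<beta> [^]\<^bsub>?E\<^esub> p = ?\<iota> z" unfolding dz .
    have "k \<beta> = ?\<iota> d' \<otimes>\<^bsub>?E\<^esub> (?\<iota> (place_const C x \<omega>) \<otimes>\<^bsub>?E\<^esub> y) [^]\<^bsub>?E\<^esub> m"
      unfolding \<beta>_def using d' yE k'(2) by (simp add: ky)
    also have "\<dots> = ?\<iota> (place_const C x (\<omega> ^ m)) \<otimes>\<^bsub>?E\<^esub> \<beta>"
      unfolding \<beta>_def cpow[symmetric] using d' yE cK[of \<omega>] by (simp add: i.S.nat_pow_distrib i.S.m_ac)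
    finally have "k \<beta> \<otimes>\<^bsub>?E\<^esub> inv\<^bsub>?E\<^esub> \<beta> = ?\<iota> (place_const C x (\<omega> ^ m))"
      using ratio[OF unit[OF \<beta>E \<beta>p] cK] by blast
    moreover have "(\<omega> ^ m) ^ p = 1" using \<omega>(1) by (metis power_mult mult.commute power_one)
    ultimately show "?P (\<omega> ^ m)" using \<beta>E \<beta>p by blast
  next
    fix c assume "?P c"
    then obtain \<beta> where \<beta>: "\<beta> \<in> carrier ?E" "\<beta> [^]\<^bsub>?E\<^esub> p = ?\<iota> z"
      "k \<beta> \<otimes>\<^bsub>?E\<^esub> inv\<^bsub>?E\<^esub> \<beta> = ?\<iota> (place_const C x c)" by blast
    have k\<beta>: "k \<beta> = ?\<iota> (place_const C x c) \<otimes>\<^bsub>?E\<^esub> \<beta>" using ratio[OF unit[OF \<beta>(1,2)] cK] \<beta>(3) by blast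
    have inj: "i = j" if "i < p" "j < p" "place_const C x \<omega> [^]\<^bsub>?K\<^esub> i = place_const C x \<omega> [^]\<^bsub>?K\<^esub> j" for i j :: nat
    proof -
      have "[i = j] (mod p)" using that(3) c_inj root_of_unity_power_eq_iff[OF p(1) \<omega>] unfolding cpow by blast
      then show ?thesis using that(1,2) by (simp add: cong_def)
    qed
    have "s \<in> carrier ?K" "z \<in> carrier ?K" "z \<noteq> \<zero>\<^bsub>?K\<^esub>" using s zK by auto
    from i.power_basis_eigen_root[OF K.domain_axioms p0 y this(1) k' ky cK inj \<beta>(1) k\<beta> \<beta>(2) cK this(2,3)]
    obtain j b where jb: "j < p" "b \<in> carrier ?K" "place_const C x c = place_const C x \<omega> [^]\<^bsub>?K\<^esub> j"
      "z = b [^]\<^bsub>?K\<^esub> p \<otimes>\<^bsub>?K\<^esub> s [^]\<^bsub>?K\<^esub> j" by blast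
    have "c = \<omega> ^ j" using jb(3) c_inj unfolding cpow by blast
    have "b \<noteq> \<zero>\<^bsub>?K\<^esub>"
    proof
      assume "b = \<zero>\<^bsub>?K\<^esub>"
      then have "z = \<zero>\<^bsub>?K\<^esub>" using jb(4) p0 place_val_pow(1)[OF x s, of j] by (simp add: K.nat_pow_zero)
      then show False using zK by simp
    qed
    then have bK: "b \<in> carrier ?K - {\<zero>\<^bsub>?K\<^esub>}" using jb(2) by simp
    \<comment> \<open>Valuations in z = b^p s^j, where \<open>z\<close> is a uniformizer. Modulo p
      the term with \<open>b\<close> drops out.\<close>
    have "1 = int p * place_val C x b + int j * place_val C x s"
      using place_val_mult[OF x place_val_pow(1)[OF x bK, of p] place_val_pow(1)[OF x s, of j]]
      unfolding jb(4)[symmetric] zK(2) place_val_pow(2)[OF x bK] place_val_pow(2)[OF x s] .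
    then have j: "[int j * place_val C x s = 1] (mod int p)"
      by (simp add: cong_iff_dvd_diff) (metis add_diff_cancel_left' dvd_diff_commute dvd_triv_left diff_add_cancel)
    \<comment> \<open>Both \<open>j\<close> and \<open>m\<close> are inverse to the valuation of
      \<open>s\<close> modulo p; comparing j m v(s) in two ways identifies them.\<close>
    have "[int j * (int m * place_val C x s) = int j * 1] (mod int p)" by (rule cong_scalar_left[OF m])
    moreover have "[int m * (int j * place_val C x s) = int m * 1] (mod int p)" by (rule cong_scalar_left[OF j])
    ultimately have "[int j = int m] (mod int p)" by (simp add: mult_ac) (metis cong_sym cong_trans)
    then have "[j = m] (mod p)" by (simp add: cong_int_iff)
    then show "c = \<omega> ^ m" unfolding \<open>c = \<omega> ^ j\<close> using root_of_unity_power_eq_iff[OF p(1) \<omega>] by blast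
  qed
  then show ?thesis by (simp add: kummer_pairing_def)
qed

end

text \<open>The kernel of a character is a subgroup; if it contained a generator it would be the
  whole group.\<close>

lemma character_generator_nontrivial:
  assumes G: "group \<Gamma>" "subgroup H \<Gamma>" and \<chi>: "\<chi> \<in> hom (\<Gamma>\<lparr>carrier := H\<rparr>) (mu_group p :: 'k::field monoid)"
    and p: "p > 0" and nontriv: "\<exists>h\<in>H. \<chi> h \<noteq> 1" and g: "g \<in> H" "generate \<Gamma> {g} = H"
  shows "\<chi> g \<noteq> 1"
proof
  interpret group \<Gamma> by fact
  interpret H: subgroup H \<Gamma> by fact
  assume triv: "\<chi> g = 1"
  have mult: "\<chi> (a \<otimes>\<^bsub>\<Gamma>\<^esub> b) = \<chi> a * \<chi> b" if "a \<in> H" "b \<in> H" for a b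
    using hom_mult[OF \<chi>, of a b] that by (simp add: mu_group_def)
  have nz: "\<chi> a \<noteq> 0" if "a \<in> H" for a
    using hom_in_carrier[OF \<chi>, of a] that p by (auto simp: mu_group_def power_0_left)
  have one: "\<chi> \<one>\<^bsub>\<Gamma>\<^esub> = 1" using mult[of "\<one>\<^bsub>\<Gamma>\<^esub>" "\<one>\<^bsub>\<Gamma>\<^esub>"] nz[of "\<one>\<^bsub>\<Gamma>\<^esub>"] by simp
  have "subgroup {h \<in> H. \<chi> h = 1} \<Gamma>"
  proof (rule subgroupI)
    show "{h \<in> H. \<chi> h = 1} \<subseteq> carrier \<Gamma>" using H.subset by blast
    show "{h \<in> H. \<chi> h = 1} \<noteq> {}" using one H.one_closed by blast
  next
    fix a assume a: "a \<in> {h \<in> H. \<chi> h = 1}"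
    then have "\<chi> a * \<chi> (inv\<^bsub>\<Gamma>\<^esub> a) = 1" using mult[of a "inv\<^bsub>\<Gamma>\<^esub> a"] one by simp
    with a show "inv\<^bsub>\<Gamma>\<^esub> a \<in> {h \<in> H. \<chi> h = 1}" by simp
  qed (auto simp: mult)
  then have "generate \<Gamma> {g} \<subseteq> {h \<in> H. \<chi> h = 1}"
    using g(1) triv by (intro generate_subgroup_incl) auto
  then show False using nontriv unfolding g(2) by blast
qed

text \<open>Division in Z/(p) is carried out in \<open>residue_ring\<close>, and invertibility of
  the denominator is part of the claim. Since \<open>s\<close> is chosen before the quantifiers over
  \<open>g\<close>, \<open>\<zeta>\<close> and \<open>z\<close>, the result also expresses
  independence of these choices.\<close>

theorem proposition3p79:
  fixes C :: "('n::finite, 'k::alg_closed_field) ppoint set"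
    and p :: nat
    and t :: "('n, 'k) adele"
    and G :: "((nat \<Rightarrow> ('n, 'k) adele) set \<Rightarrow> (nat \<Rightarrow> ('n, 'k) adele) set) set"
    and \<chi> :: "((nat \<Rightarrow> ('n, 'k) adele) set \<Rightarrow> (nat \<Rightarrow> ('n, 'k) adele) set) \<Rightarrow> 'k"
    and \<alpha> :: "(nat \<Rightarrow> ('n, 'k) adele) set"
  assumes "nonsingular_projective_curve C"
    and "Factorial_Ring.prime p" and "p \<noteq> CHAR('k)"
    and "t \<in> ideles C"
    and "pointwise_transitive C p t G"
    and "\<chi> \<in> hom ((GG C p t)\<lparr>carrier := G\<rparr>) (mu_group p)" and "\<exists>h\<in>G. \<chi> h \<noteq> 1"
    and "primitive_element C p t G \<chi> \<alpha>"
  shows "\<exists>s\<in>ideles C. \<alpha> [^]\<^bsub>adele_ext C p t\<^esub> p = adele_emb C p t s \<and>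
    (\<forall>x\<in>C.
       ([place_val C x (s x) = 0] (mod int p) \<longleftrightarrow> x \<notin> Ram C p t) \<and>
       (x \<in> Ram C p t \<longrightarrow>
          (\<forall>g\<in>G. \<forall>\<zeta>. \<forall>z\<in>uniformizers C x.
             generate (GG C p t) {g} = G \<and> primitive_root_of_unity p \<zeta> \<longrightarrow>
             (let Zp = residue_ring (int p);
                  a = log_mu p \<zeta> (\<chi> g);
                  b = log_mu p \<zeta> (kummer_pairing C p t x (component_aut C p t x g) z)
              in b \<in> Units Zp \<and> [place_val C x (s x) = a \<otimes>\<^bsub>Zp\<^esub> inv\<^bsub>Zp\<^esub> b] (mod int p)))))"
proof -
  interpret curve C by unfold_locales (rule assms(1))
  note p = assms(2,3)
  have p0: "p > 0" using p(1) by (rule prime_gt_0_nat)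
  let ?A = "adele_ring C" and ?E = "adele_ext C p t" and ?\<iota> = "adele_emb C p t"
  interpret A: cring ?A by (rule cring_adele_ring)
  have t: "t \<in> carrier ?A" using assms(4) by (rule A.Units_closed)
  interpret i: ring_hom_cring ?A ?E ?\<iota> by (rule A.root_ext_emb_hom[OF t])
  interpret c: ring_hom_cring ring_of_type_algebra ?A "adele_const C" by (rule adele_const_hom)
  have cA: "adele_const C a \<in> carrier ?A" for a by (simp add: ring_of_type_algebra_simps)
  have cpow: "adele_const C a [^]\<^bsub>?A\<^esub> n = adele_const C (a ^ n)" for a and n :: nat
    using c.hom_pow[of a n] by (simp add: ring_of_type_algebra_simps ring_of_type_algebra_pow)
  have c1: "adele_const C 1 = \<one>\<^bsub>?A\<^esub>" using c.hom_one by (simp add: ring_of_type_algebra_simps)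
  note trans = assms(5)[unfolded pointwise_transitive_def]
  have sub: "subgroup G (GG C p t)" by (rule conjunct1[OF trans])
  have fixed: "{\<beta> \<in> carrier ?E. \<forall>g\<in>G. g \<beta> = \<beta>} = ?\<iota> ` carrier ?A"
    by (rule conjunct2[OF conjunct2[OF conjunct2[OF trans]]])
  note prim = assms(8)[unfolded primitive_element_def Let_def]
  have \<alpha>: "power_basis ?A ?E ?\<iota> p \<alpha>"
    unfolding power_basis_def by (rule conjI[OF conjunct1[OF prim] conjunct2[OF conjunct2[OF prim]]])
  have g\<alpha>: "g \<alpha> = ?\<iota> (adele_const C (\<chi> g)) \<otimes>\<^bsub>?E\<^esub> \<alpha>" if "g \<in> G" for g
    using conjunct1[OF conjunct2[OF prim]] that by (rule bspec)
  have \<alpha>E: "\<alpha> \<in> carrier ?E" by (rule i.power_basis_closed[OF \<alpha>])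
  have GG: "g \<in> carrier (GG C p t)" if "g \<in> G" for g using subgroup.mem_carrier[OF sub that] .
  have \<chi>: "\<chi> g ^ p = 1" if "g \<in> G" for g
    using hom_in_carrier[OF assms(6), of g] that by (simp add: mu_group_def)
  \<comment> \<open>The eigenvalue of the p-th power is the p-th power of \<open>\<chi> g\<close>,
    which is 1. The fixed ring consists of the adeles by pointwise transitivity.\<close>
  have "g (\<alpha> [^]\<^bsub>?E\<^esub> p) = \<alpha> [^]\<^bsub>?E\<^esub> p" if "g \<in> G" for g
  proof -
    interpret g: ring_hom_cring ?E ?E g
      using GG[OF that] unfolding root_ext_aut_carrier by (intro ring_hom_cringI i.S.is_cring) blast
    have "g (\<alpha> [^]\<^bsub>?E\<^esub> p) = ?\<iota> (adele_const C (\<chi> g) [^]\<^bsub>?A\<^esub> p) \<otimes>\<^bsub>?E\<^esub> \<alpha> [^]\<^bsub>?E\<^esub> p"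
      using \<alpha>E cA by (simp add: g\<alpha>[OF that] i.S.nat_pow_distrib)
    then show ?thesis unfolding cpow \<chi>[OF that] c1 using \<alpha>E by simp
  qed
  then have "\<alpha> [^]\<^bsub>?E\<^esub> p \<in> ?\<iota> ` carrier ?A" unfolding fixed[symmetric] using \<alpha>E by simp
  then obtain s where s: "s \<in> carrier ?A" "\<alpha> [^]\<^bsub>?E\<^esub> p = ?\<iota> s" by blast
  obtain h where h: "h \<in> G" "\<chi> h \<noteq> 1" using assms(7) by blast
  \<comment> \<open>The value \<open>\<chi> h\<close> is the root of unity that separates the two
    points in \<open>power_basis_unit\<close>: its difference to 1 is a nonzero constant and
    therefore an idele.\<close>
  have "adele_const C (\<chi> h) \<ominus>\<^bsub>?A\<^esub> \<one>\<^bsub>?A\<^esub> \<in> Units ?A"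
    unfolding c1[symmetric] const_hom_diff[OF adele_const_hom]
    by (rule const_hom_unit[OF adele_const_hom]) (simp add: h(2))
  moreover have "adele_const C (\<chi> h) [^]\<^bsub>?A\<^esub> p = \<one>\<^bsub>?A\<^esub>" unfolding cpow \<chi>[OF h(1)] by (rule c1)
  ultimately have sU: "s \<in> ideles C"
    using i.power_basis_unit[OF p0 A.power_basis_root_gen[OF t p0] A.root_gen_pow[OF t] \<alpha> s(2) assms(4) s(1) cA]
    by blast
  show ?thesis
  proof (intro bexI[OF _ sU] conjI ballI impI allI s(2))
    fix x assume x: "x \<in> C"
    let ?K = "place_field C x" and ?F = "place_ext C p t x" and ?j = "place_emb C p t x"
      and ?pr = "component_proj C p t x"
    interpret K: field ?K by (rule field_place_field[OF x])
    interpret S: split_projection ?A ?K "\<lambda>\<alpha>. \<alpha> x" "adele_single x \<one>\<^bsub>?K\<^esub>"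
      by (rule split_projection_component[OF x])
    note tx = idele_component_nonzero[OF x assms(4)] and sx = idele_component_nonzero[OF x sU]
    have txK: "t x \<in> carrier ?K" using tx by simp
    have hom: "ring_hom_cring ?K ?F ?j" by (rule K.root_ext_emb_hom[OF txK])
    interpret j: ring_hom_cring ?K ?F ?j by (rule hom)
    interpret pr: ring_hom_cring ?E ?F ?pr unfolding component_proj_eq by (rule S.root_ext_map_hom[OF t])
    have pr_emb: "?pr (?\<iota> a) = ?j (a x)" if "a \<in> carrier ?A" for a
      unfolding component_proj_eq by (rule S.root_ext_map_emb[OF t that])
    have y: "power_basis ?K ?F ?j p (?pr \<alpha>)" unfolding component_proj_eq by (rule S.power_basis_map[OF t p0 \<alpha>])
    have yp: "?pr \<alpha> [^]\<^bsub>?F\<^esub> p = ?j (s x)"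
      using pr.hom_pow[OF \<alpha>E, of p] unfolding s(2) pr_emb[OF s(1)] by simp
    note \<tau> = K.power_basis_root_gen[OF txK p0] and \<tau>p = K.root_gen_pow[OF txK, of p]
    \<comment> \<open>At \<open>x\<close> both the image of \<open>\<alpha>\<close> and the adjoined
      root generate a power basis, so the same lemma serves in both directions with the roles
      exchanged.\<close>
    have "int p dvd place_val C x (s x) \<longleftrightarrow> int p dvd place_val C x (t x)"
      using power_basis_val_dvd[OF x p hom y yp j.power_basis_closed[OF \<tau>] \<tau>p sx tx]
        power_basis_val_dvd[OF x p hom \<tau> \<tau>p j.power_basis_closed[OF y] yp tx sx] by blast
    then show iff: "[place_val C x (s x) = 0] (mod int p) \<longleftrightarrow> x \<notin> Ram C p t"
      using x by (simp add: Ram_def cong_0_iff)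
    fix g z and \<zeta> :: 'k assume ram: "x \<in> Ram C p t" and g: "g \<in> G" and z: "z \<in> uniformizers C x"
      and gz: "generate (GG C p t) {g} = G \<and> primitive_root_of_unity p \<zeta>"
    have "\<not> int p dvd place_val C x (s x)" using iff ram by (simp add: cong_0_iff)
    then have "coprime (place_val C x (s x)) (int p)"
      using p(1) prime_imp_coprime[of "int p"] coprime_commute by auto
    then obtain n where n: "[place_val C x (s x) * n = 1] (mod int p)" using cong_solve_coprime_int by blast
    \<comment> \<open>The inverse of the valuation of \<open>s\<close> modulo p, reduced to a
      natural number so that it can serve as an exponent.\<close>
    define m where "m = nat (n mod int p)"
    have "int m = n mod int p" using p0 by (simp add: m_def)
    then have "[int m * place_val C x (s x) = place_val C x (s x) * n] (mod int p)"
      by (simp add: cong_def mod_mult_left_eq mult.commute)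
    then have m: "[int m * place_val C x (s x) = 1] (mod int p)" using n by (rule cong_trans)
    have \<omega>: "\<chi> g \<noteq> 1"
      using character_generator_nontrivial[OF A.group_root_ext_aut[OF t] sub assms(6) p0 assms(7) g] gz by blast
    note k = component_aut[OF x p0 t GG[OF g]]
    have "component_aut C p t x g (?pr \<alpha>) = ?j (place_const C x (\<chi> g)) \<otimes>\<^bsub>?F\<^esub> ?pr \<alpha>"
      unfolding k(2)[OF \<alpha>E] g\<alpha>[OF g] using pr.hom_mult[OF i.hom_closed[OF cA] \<alpha>E] pr_emb[OF cA] x
      by (simp add: adele_const_def)
    from kummer_pairing_primitive[where t = t, OF x p txK k(1) y yp sx this \<chi>[OF g] \<omega> z m]
    have kp: "kummer_pairing C p t x (component_aut C p t x g) z = \<chi> g ^ m" .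
    show "let Zp = residue_ring (int p); a = log_mu p \<zeta> (\<chi> g);
        b = log_mu p \<zeta> (kummer_pairing C p t x (component_aut C p t x g) z)
      in b \<in> Units Zp \<and> [place_val C x (s x) = a \<otimes>\<^bsub>Zp\<^esub> inv\<^bsub>Zp\<^esub> b] (mod int p)"
      unfolding Let_def kp using log_quotient[OF p(1) conjunct2[OF gz] \<chi>[OF g] \<omega> m] by blast
  qed
qed

end
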